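(* Work in Euclidean $\mathbb R^N$. Let $p_1,p_2>1$, $q_1>p_1-1$, $q_2>p_2-1$, let $\mathcal A_1,\mathcal A_2$ be W-$p_1$-C and W-$p_2$-C respectively, and let $(u,v)$ be a weak solution of $$\mathrm{div}\,\mathcal A_1(x,u,\nabla u)\ge v^{q_2},\quad \mathrm{div}\,\mathcal A_2(x,v,\nabla v)\ge u^{q_1},\quad u\ge0,\ v\ge0\quad\text{on }\mathbb R^N.$$ Assume that either $\mathcal A_1$ is radial and $u$ is a $C^1$ radial function, or $\mathcal A_2$ is radial and $v$ is a $C^1$ radial function. Then $u=v=0$ a.e. on $\mathbb R^N$.
   Context: $\mathcal A:\mathbb R^N\times\mathbb R\times\mathbb R^N\to\mathbb R^N$ Carathéodory (measurable in $x$, continuous in $(t,\xi)$) is W-$p$-C if $\mathcal A(x,t,\xi)\cdot\xi\ge0$ for all $x,t,\xi$, $\mathcal A(x,0,\xi)=0$ or $\mathcal A(x,t,0)=0$, and there is $k_2>0$ with $(\mathcal A(x,t,\xi)\cdot\xi)^{p-1}\ge k_2^{p-1}|\mathcal A(x,t,\xi)|^p$ for all $x,t,\xi$. $\mathcal A$ is radial if there is a Carathéodory function $A:\mathbb R\times\mathbb R\times\mathbb R\to\mathbb R$ such that for every radial $u\in C^1(\mathbb R^N)$, $u(x)=u(|x|)$, one has $\mathcal A(x,u,\nabla u)=A(|x|,u(|x|),u'(|x|))\frac{x}{|x|}$. A weak solution of the system is a pair $(u,v)\in W^{1,p_1}_{loc}\times W^{1,p_2}_{loc}$ with $u,v\ge0$,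 $\mathcal A_1(\cdot,u,\nabla u)\in L^{p_1'}_{loc}$, $\mathcal A_2(\cdot,v,\nabla v)\in L^{p_2'}_{loc}$, $u^{q_1},v^{q_2}\in L^1_{loc}$, and for all nonnegative $\phi\in C^1_0(\mathbb R^N)$: $-\int\mathcal A_1(x,u,\nabla u)\cdot\nabla\phi\ge\int v^{q_2}\phi$, $-\int\mathcal A_2(x,v,\nabla v)\cdot\nabla\phi\ge\int u^{q_1}\phi$. *)

theory Defs
  imports "HOL-Analysis.Analysis"
begin

definition C1_grad :: "('a::euclidean_space \<Rightarrow> real) \<Rightarrow> ('a \<Rightarrow> 'a) \<Rightarrow> bool" where
  "C1_grad \<phi> g \<longleftrightarrow> (\<forall>x. (\<phi> has_derivative (\<lambda>h. g x \<bullet> h)) (at x)) \<and> continuous_on UNIV g"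

definition test_fun :: "('a::euclidean_space \<Rightarrow> real) \<Rightarrow> ('a \<Rightarrow> 'a) \<Rightarrow> bool" where
  "test_fun \<phi> g \<longleftrightarrow> C1_grad \<phi> g \<and> compact (closure {x. \<phi> x \<noteq> 0})"

definition Lp_loc :: "real \<Rightarrow> ('a::euclidean_space \<Rightarrow> real) \<Rightarrow> bool" where
  "Lp_loc p u \<longleftrightarrow> u \<in> borel_measurable lebesgue \<and>
     (\<forall>K. compact K \<longrightarrow> set_integrable lebesgue K (\<lambda>x. \<bar>u x\<bar> powr p))"

definition Lp_loc_vec :: "real \<Rightarrow> ('a::euclidean_space \<Rightarrow> 'a) \<Rightarrow> bool" where
  "Lp_loc_vec p F \<longleftrightarrow> F \<in> borel_measurable lebesgue \<and>
     (\<forall>K. compact K \<longrightarrow> set_integrable lebesgue K (\<lambda>x. norm (F x) powr p))"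

definition weak_grad :: "('a::euclidean_space \<Rightarrow> real) \<Rightarrow> ('a \<Rightarrow> 'a) \<Rightarrow> bool" where
  "weak_grad u G \<longleftrightarrow> (\<forall>\<phi> D\<phi>. test_fun \<phi> D\<phi> \<longrightarrow>
     (\<forall>b\<in>Basis. (\<integral>x. u x * (D\<phi> x \<bullet> b) \<partial>lebesgue) = - (\<integral>x. (G x \<bullet> b) * \<phi> x \<partial>lebesgue)))"

definition W1p_loc :: "real \<Rightarrow> ('a::euclidean_space \<Rightarrow> real) \<Rightarrow> ('a \<Rightarrow> 'a) \<Rightarrow> bool" where
  "W1p_loc p u G \<longleftrightarrow> Lp_loc p u \<and> Lp_loc_vec p G \<and> weak_grad u G"

definition caratheodory :: "('a::euclidean_space \<Rightarrow> real \<Rightarrow> 'a \<Rightarrow> 'a) \<Rightarrow> bool" where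
  "caratheodory A \<longleftrightarrow> (\<forall>t \<xi>. (\<lambda>x. A x t \<xi>) \<in> borel_measurable lebesgue) \<and>
     (\<forall>x. continuous_on UNIV (\<lambda>(t, \<xi>). A x t \<xi>))"

definition caratheodory_radial :: "(real \<Rightarrow> real \<Rightarrow> real \<Rightarrow> real) \<Rightarrow> bool" where
  "caratheodory_radial A \<longleftrightarrow> (\<forall>t s. (\<lambda>r. A r t s) \<in> borel_measurable lebesgue) \<and>
     (\<forall>r. continuous_on UNIV (\<lambda>(t, s). A r t s))"

definition WpC :: "real \<Rightarrow> ('a::euclidean_space \<Rightarrow> real \<Rightarrow> 'a \<Rightarrow> 'a) \<Rightarrow> bool" where
  "WpC p A \<longleftrightarrow> caratheodory A \<and>
     (\<forall>x t \<xi>. A x t \<xi> \<bullet> \<xi> \<ge> 0) \<and>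
     ((\<forall>x \<xi>. A x 0 \<xi> = 0) \<or> (\<forall>x t. A x t 0 = 0)) \<and>
     (\<exists>k2>0. \<forall>x t \<xi>. (A x t \<xi> \<bullet> \<xi>) powr (p - 1) \<ge> k2 powr (p - 1) * norm (A x t \<xi>) powr p)"

definition radial_op :: "('a::euclidean_space \<Rightarrow> real \<Rightarrow> 'a \<Rightarrow> 'a) \<Rightarrow> bool" where
  "radial_op A \<longleftrightarrow> (\<exists>A0. caratheodory_radial A0 \<and>
     (\<forall>f g. C1_grad (\<lambda>x. f (norm x)) g \<longrightarrow>
        (\<forall>x. x \<noteq> 0 \<longrightarrow>
           A x (f (norm x)) (g x) = A0 (norm x) (f (norm x)) (deriv f (norm x)) *\<^sub>R (x /\<^sub>R norm x))))"

definition radial_C1 :: "('a::euclidean_space \<Rightarrow> real) \<Rightarrow> bool" where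
  "radial_C1 u \<longleftrightarrow> (\<exists>g. C1_grad u g) \<and> (\<exists>f. \<forall>x. u x = f (norm x))"

definition weak_solution ::
  "real \<Rightarrow> real \<Rightarrow> real \<Rightarrow> real \<Rightarrow> ('a::euclidean_space \<Rightarrow> real \<Rightarrow> 'a \<Rightarrow> 'a) \<Rightarrow> ('a \<Rightarrow> real \<Rightarrow> 'a \<Rightarrow> 'a)
    \<Rightarrow> ('a \<Rightarrow> real) \<Rightarrow> ('a \<Rightarrow> real) \<Rightarrow> bool" where
  "weak_solution p1 p2 q1 q2 A1 A2 u v \<longleftrightarrow>
     (\<exists>Gu Gv. W1p_loc p1 u Gu \<and> W1p_loc p2 v Gv \<and>
       (AE x in lebesgue. u x \<ge> 0) \<and> (AE x in lebesgue. v x \<ge> 0) \<and>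
       Lp_loc_vec (p1 / (p1 - 1)) (\<lambda>x. A1 x (u x) (Gu x)) \<and>
       Lp_loc_vec (p2 / (p2 - 1)) (\<lambda>x. A2 x (v x) (Gv x)) \<and>
       Lp_loc 1 (\<lambda>x. u x powr q1) \<and> Lp_loc 1 (\<lambda>x. v x powr q2) \<and>
       (\<forall>\<phi> D\<phi>. test_fun \<phi> D\<phi> \<and> (\<forall>x. \<phi> x \<ge> 0) \<longrightarrow>
          - (\<integral>x. A1 x (u x) (Gu x) \<bullet> D\<phi> x \<partial>lebesgue) \<ge> (\<integral>x. v x powr q2 * \<phi> x \<partial>lebesgue) \<and>
          - (\<integral>x. A2 x (v x) (Gv x) \<bullet> D\<phi> x \<partial>lebesgue) \<ge> (\<integral>x. u x powr q1 * \<phi> x \<partial>lebesgue)))"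

end

theory Submission
  imports Defs
begin

text \<open>Testing the inequality $\mathrm{div}\,\mathcal A(x,v,\nabla v) \ge w$ with a cutoff times a bounded
  increasing function of $v$ bounds $\int_{B_a} w$ by $\int_{B_b} v^q$ to the power $(p-1)/q < 1$, with a
  factor $(b-a)^{-p}$ in front. For the system the two bounds compose, and absorbing the sublinear power shows that the
  mean of $u^{q_1}$ over $B_R$ decays like a negative power of $R$. Since Sobolev functions are involved, the
  test function is justified by mollifying $v$.

  If $u$ and $\mathcal A_1$ are radial, then a radial cutoff that is constant off an annulus on which
  $u' \le 0$ shows that $v = 0$ inside the annulus. So either there are such annuli arbitrarily far out, whence
  $v = 0$ and then $u = 0$, or $u$ is nondecreasing and bounded below by a positive constant far out, which
  contradicts the decay of its means.\<close>

text \<open>Testing with powers of v would demand integrability that a weak solution need not have.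
  The function of v therefore stays between 1 and 2 and has a bounded derivative: the left side
  keeps the full integral of w, and every term is integrable. It carries a free scale s, and the
  resulting bound has the two terms |B_b| and s^(-q) times the integral of v^q; making s the q-mean
  of v balances them and creates the exponent (p-1)/q. The hypothesis q > p-1 enters twice, as
  boundedness of that function and as smallness of that exponent. Each bound passes to a larger
  ball, so absorption at a single radius is impossible; a weight (2R-a)^tau on the radii R <= a < 2R
  restores it, with no growth condition on the solution. In the radial half the field is a multiple
  of x, so the sign of u' decides the sign of its radial component, and at zeros of u' coercivity
  makes the field vanish. The gradient in the definition of a weak solution is only some weak
  gradient; it has to be identified a.e. with the classical one before radial symmetry can be
  used.\<close>

section \<open>Test functions: supports, bounds, uniform continuity\<close>

lemma test_fun_support:
  fixes \<phi> :: "'a::euclidean_space \<Rightarrow> real"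
  assumes "test_fun \<phi> D\<phi>"
  obtains r where "r > 0" "\<And>x. norm x \<ge> r \<Longrightarrow> \<phi> x = 0" "\<And>x. norm x \<ge> r \<Longrightarrow> D\<phi> x = 0"
proof -
  have c: "compact (closure {x. \<phi> x \<noteq> 0})"
    and d: "\<And>x. (\<phi> has_derivative (\<lambda>h. D\<phi> x \<bullet> h)) (at x)"
    using assms by (auto simp: test_fun_def C1_grad_def)
  from c have "bounded (closure {x. \<phi> x \<noteq> 0})" by (rule compact_imp_bounded)
  then obtain B where B: "B > 0" "\<And>x. x \<in> closure {x. \<phi> x \<noteq> 0} \<Longrightarrow> norm x \<le> B"
    by (auto simp: bounded_pos)
  have z: "\<phi> x = 0" if "norm x > B" for x
    using B(2)[of x] closure_subset[of "{x. \<phi> x \<noteq> 0}"] that by fastforce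
  \<comment> \<open>The extra 1 places \<open>x\<close> in the open set \<open>norm y > B\<close>,
    on which \<phi> is constantly 0; uniqueness of the derivative then kills the gradient.\<close>
  have "D\<phi> x = 0" if x: "norm x \<ge> B + 1" for x
  proof -
    have o: "open {y::'a. norm y > B}" by (intro open_Collect_less continuous_intros)
    have "((\<lambda>_. 0::real) has_derivative (\<lambda>h. D\<phi> x \<bullet> h)) (at x)"
      by (rule has_derivative_transform_within_open[OF d o]) (use x z in auto)
    moreover have "((\<lambda>_. 0::real) has_derivative (\<lambda>h. 0)) (at x)" by simp
    ultimately have "(\<lambda>h. D\<phi> x \<bullet> h) = (\<lambda>h. 0)" by (rule has_derivative_unique)
    then have "D\<phi> x \<bullet> D\<phi> x = 0" by meson
    then show ?thesis by simp
  qed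
  with z B(1) that[of "B+1"] show ?thesis by force
qed

lemma test_funI:
  fixes \<phi> :: "'a::euclidean_space \<Rightarrow> real"
  assumes "C1_grad \<phi> D\<phi>" "\<And>x. norm x \<ge> r \<Longrightarrow> \<phi> x = 0"
  shows "test_fun \<phi> D\<phi>"
proof -
  have "{x. \<phi> x \<noteq> 0} \<subseteq> cball 0 r" using assms(2) by (force simp: not_le)
  then have "closure {x. \<phi> x \<noteq> 0} \<subseteq> cball 0 r" by (simp add: closure_minimal)
  then have "compact (closure {x. \<phi> x \<noteq> 0})"
    by (meson bounded_cball bounded_subset closed_closure compact_eq_bounded_closed)
  with assms(1) show ?thesis by (simp add: test_fun_def)
qed

lemma C1_grad_continuous: "C1_grad \<phi> g \<Longrightarrow> continuous_on UNIV \<phi>"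
  unfolding C1_grad_def by (meson continuous_at_imp_continuous_on has_derivative_continuous)

lemma continuous_vanishing_bounded:
  fixes f :: "'a::euclidean_space \<Rightarrow> 'b::real_normed_vector"
  assumes "continuous_on UNIV f" "\<And>x. norm x \<ge> r \<Longrightarrow> f x = 0"
  obtains B where "B > 0" "\<And>x. norm (f x) \<le> B"
proof -
  have "compact (f ` cball 0 r)"
    by (intro compact_continuous_image) (use assms(1) continuous_on_subset in auto)
  then have "bounded (f ` cball 0 r)" by (rule compact_imp_bounded)
  then obtain B where B: "B > 0" "\<forall>x\<in>f ` cball 0 r. norm x \<le> B" by (auto simp: bounded_pos)
  have "norm (f x) \<le> B" for x
    using B assms(2)[of x] by (cases "norm x \<le> r") auto
  with B that show ?thesis by blast
qed

text \<open>Points closer than 1 either both lie in the ball of radius \<open>r + 1\<close>, where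
  compactness gives the modulus, or both lie outside radius \<open>r\<close>, where \<open>f\<close>
  vanishes.\<close>

lemma continuous_vanishing_uniformly_continuous:
  fixes f :: "'a::euclidean_space \<Rightarrow> 'b::real_normed_vector"
  assumes c: "continuous_on UNIV f" and z: "\<And>x. norm x \<ge> r \<Longrightarrow> f x = 0" and "e > 0"
  obtains d where "d > 0" "\<And>x y. dist x y < d \<Longrightarrow> dist (f x) (f y) < e"
proof -
  have "uniformly_continuous_on (cball 0 (r+1)) f"
    by (intro compact_uniformly_continuous) (use c continuous_on_subset in auto)
  then obtain d where d: "d > 0" "\<And>x y. x \<in> cball 0 (r+1) \<Longrightarrow> y \<in> cball 0 (r+1) \<Longrightarrow> dist x y < d \<Longrightarrow> dist (f x) (f y) < e"
    using \<open>e > 0\<close> unfolding uniformly_continuous_on_def by metis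
  have "dist (f x) (f y) < e" if xy: "dist x y < min d 1" for x y
  proof (cases "norm x \<le> r+1 \<and> norm y \<le> r+1")
    case True
    then show ?thesis using d(2)[of x y] xy by simp
  next
    case False
    have "\<bar>norm x - norm y\<bar> < 1"
      using norm_triangle_ineq3[of x y] xy by (simp add: dist_norm)
    with False have "norm x \<ge> r" "norm y \<ge> r" by auto
    then show ?thesis using z \<open>e > 0\<close> by simp
  qed
  with d(1) that[of "min d 1"] show ?thesis by simp
qed

section \<open>Locally integrable functions\<close>

text \<open>One class for functions, gradients and fields alike: it is implied by every
  \<open>Lp_loc\<close> and \<open>Lp_loc_vec\<close> with exponent at least 1, and it suffices for
  convolution with a continuous kernel of compact support.\<close>

definition loc_integrable :: "('a::euclidean_space \<Rightarrow> 'b::euclidean_space) \<Rightarrow> bool" where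
  "loc_integrable f \<longleftrightarrow> f \<in> borel_measurable lebesgue \<and>
     (\<forall>K. compact K \<longrightarrow> set_integrable lebesgue K f)"

lemma loc_integrableD:
  assumes "loc_integrable f" "compact K"
  shows "integrable lebesgue (\<lambda>x. indicator K x *\<^sub>R f x)" "f \<in> borel_measurable lebesgue"
  using assms by (auto simp: loc_integrable_def set_integrable_def)

lemma integrable_indicator_compact:
  fixes K :: "'a::euclidean_space set"
  assumes "compact K"
  shows "integrable lebesgue (\<lambda>x. indicator K x *\<^sub>R (c::'b::{banach, second_countable_topology}))"
proof -
  have "K \<in> lmeasurable" using assms by (simp add: lmeasurable_compact)
  then show ?thesis
    by (intro integrable_scaleR_left) (auto simp: fmeasurable_def)
qed

text \<open>On a compact set, which has finite measure, \<open>t \<le> 1 + t powr p\<close>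
  dominates the function by an integrable one.\<close>

lemma loc_integrable_of_powr:
  fixes f :: "'a::euclidean_space \<Rightarrow> 'b::euclidean_space"
  assumes "p \<ge> 1" "f \<in> borel_measurable lebesgue"
    and i: "\<And>K. compact K \<Longrightarrow> set_integrable lebesgue K (\<lambda>x. norm (f x) powr p)"
  shows "loc_integrable f"
  unfolding loc_integrable_def
proof (intro conjI allI impI)
  fix K :: "'a set" assume K: "compact K"
  have Ks: "K \<in> sets lebesgue" using K by (simp add: compact_imp_closed)
  have *: "t \<le> 1 + t powr p" if "t \<ge> 0" for t :: real
  proof (cases "t \<le> 1")
    case True then show ?thesis by (simp add: add_increasing2)
  next
    case False
    then have "t powr 1 \<le> t powr p" using assms(1) by (intro powr_mono) auto
    then show ?thesis using False by simp
  qed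
  have "integrable lebesgue (\<lambda>x. indicator K x *\<^sub>R 1 + indicator K x *\<^sub>R norm (f x) powr p)"
    using i[OF K] integrable_indicator_compact[OF K, of "1::real"]
    by (intro Bochner_Integration.integrable_add) (auto simp: set_integrable_def)
  then show "set_integrable lebesgue K f"
    unfolding set_integrable_def
    by (rule Bochner_Integration.integrable_bound)
       (use assms(2) Ks *[of "norm (f _)"] in \<open>auto simp: indicator_def\<close>)
qed (fact assms(2))

lemma Lp_loc_loc_integrable: "p \<ge> 1 \<Longrightarrow> Lp_loc p u \<Longrightarrow> loc_integrable u"
  by (rule loc_integrable_of_powr[of p]) (auto simp: Lp_loc_def)

lemma Lp_loc_vec_loc_integrable: "p \<ge> 1 \<Longrightarrow> Lp_loc_vec p F \<Longrightarrow> loc_integrable F"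
  by (rule loc_integrable_of_powr[of p]) (auto simp: Lp_loc_vec_def)

lemma loc_integrable_norm_powr: "Lp_loc_vec p F \<Longrightarrow> loc_integrable (\<lambda>x. norm (F x) powr p)"
  by (auto simp: Lp_loc_vec_def loc_integrable_def)

lemma loc_integrable_bounded_scale:
  fixes f :: "'a::euclidean_space \<Rightarrow> 'b::euclidean_space" and g :: "'a \<Rightarrow> real"
  assumes f: "loc_integrable f" and [measurable]: "g \<in> borel_measurable lebesgue"
    and b: "AE x in lebesgue. \<bar>g x\<bar> \<le> B" and z: "\<And>x. x \<notin> cball a r \<Longrightarrow> g x = 0"
  shows "integrable lebesgue (\<lambda>x. g x *\<^sub>R f x)"
proof -
  have [measurable]: "f \<in> borel_measurable lebesgue" using f by (simp add: loc_integrable_def)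
  have i: "integrable lebesgue (\<lambda>x. B *\<^sub>R (indicator (cball a r) x *\<^sub>R f x))"
    using loc_integrableD(1)[OF f compact_cball] by (intro integrable_scaleR_right)
  show ?thesis
  proof (rule Bochner_Integration.integrable_bound[OF i])
    show "AE x in lebesgue. norm (g x *\<^sub>R f x) \<le> norm (B *\<^sub>R indicator (cball a r) x *\<^sub>R f x)"
      using b
    proof eventually_elim
      case (elim x)
      have "\<bar>g x\<bar> * norm (f x) \<le> \<bar>B\<bar> * norm (f x)"
        using elim by (intro mult_right_mono) auto
      then show ?case using z[of x] by (cases "x \<in> cball a r") auto
    qed
  qed measurable
qed

lemma loc_integrable_inner:
  fixes f g :: "'a::euclidean_space \<Rightarrow> 'b::euclidean_space"
  assumes f: "loc_integrable f" and [measurable]: "g \<in> borel_measurable lebesgue"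
    and b: "\<And>x. norm (g x) \<le> B" and z: "\<And>x. x \<notin> cball a r \<Longrightarrow> g x = 0"
  shows "integrable lebesgue (\<lambda>x. f x \<bullet> g x)"
proof -
  have [measurable]: "f \<in> borel_measurable lebesgue" using f by (simp add: loc_integrable_def)
  have i: "integrable lebesgue (\<lambda>x. B *\<^sub>R (indicator (cball a r) x *\<^sub>R f x))"
    using loc_integrableD(1)[OF f compact_cball] by (intro integrable_scaleR_right)
  show ?thesis
  proof (rule Bochner_Integration.integrable_bound[OF i])
    have "norm (f x \<bullet> g x) \<le> norm (B *\<^sub>R indicator (cball a r) x *\<^sub>R f x)" for x
    proof (cases "x \<in> cball a r")
      case True
      have "\<bar>f x \<bullet> g x\<bar> \<le> norm (f x) * norm (g x)" by (rule Cauchy_Schwarz_ineq2)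
      also have "\<dots> \<le> norm (f x) * \<bar>B\<bar>" using b[of x] by (intro mult_left_mono) auto
      finally show ?thesis using True by (simp add: mult.commute)
    qed (use z[of x] in simp)
    then show "AE x in lebesgue. norm (f x \<bullet> g x) \<le> norm (B *\<^sub>R indicator (cball a r) x *\<^sub>R f x)"
      by simp
  qed measurable
qed

lemma continuous_borel_lebesgue:
  fixes f :: "'a::euclidean_space \<Rightarrow> 'b::topological_space"
  shows "continuous_on UNIV f \<Longrightarrow> f \<in> borel_measurable lebesgue"
  using borel_measurable_continuous_onI[of f] by (intro measurable_completion) simp

section \<open>Mollification\<close>

text \<open>Convolution of the kernel with \<open>f\<close>. The values of \<open>f\<close> may be
  scalars or vectors, so a function and its weak gradient are smoothed by the same operator.\<close>

definition mollify :: "('a::euclidean_space \<Rightarrow> real) \<Rightarrow> ('a \<Rightarrow> 'b::euclidean_space) \<Rightarrow> 'a \<Rightarrow> 'b" where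
  "mollify \<rho> f x = (\<integral>y. \<rho> (x - y) *\<^sub>R f y \<partial>lebesgue)"

lemma kernel_measurable:
  fixes \<rho> :: "'a::euclidean_space \<Rightarrow> 'b::topological_space"
  assumes "continuous_on UNIV \<rho>"
  shows "(\<lambda>y. \<rho> (x - y)) \<in> borel_measurable lebesgue"
  by (intro continuous_borel_lebesgue continuous_on_compose2[OF assms]) (auto intro!: continuous_intros)

lemma mollify_integrable:
  assumes c: "continuous_on UNIV \<rho>" and z: "\<And>x. norm x \<ge> r \<Longrightarrow> \<rho> x = 0" and f: "loc_integrable f"
  shows "integrable lebesgue (\<lambda>y. \<rho> (x - y) *\<^sub>R f y)"
proof -
  obtain B where B: "B > 0" "\<And>x. norm (\<rho> x) \<le> B"
    using continuous_vanishing_bounded[OF c z] by blast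
  show ?thesis
    by (rule loc_integrable_bounded_scale[OF f kernel_measurable[OF c], where B=B and a=x and r=r])
       (use B z in \<open>auto simp: dist_norm\<close>)
qed

text \<open>Sequential continuity by dominated convergence: along a bounded sequence all translated
  kernels live in one ball, where a multiple of the norm of \<open>f\<close> is the
  majorant.\<close>

lemma mollify_continuous:
  fixes \<rho> :: "'a::euclidean_space \<Rightarrow> real" and f :: "'a \<Rightarrow> 'b::euclidean_space"
  assumes c: "continuous_on UNIV \<rho>" and z: "\<And>x. norm x \<ge> r \<Longrightarrow> \<rho> x = 0" and f: "loc_integrable f"
  shows "continuous_on UNIV (mollify \<rho> f)"
proof (rule continuous_at_imp_continuous_on, rule ballI, unfold continuous_at_sequentially comp_def, intro allI impI)
  fix x :: 'a and X :: "nat \<Rightarrow> 'a" assume X: "X \<longlonglongrightarrow> x"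
  have [measurable]: "f \<in> borel_measurable lebesgue" using f by (simp add: loc_integrable_def)
  obtain B where B: "B > 0" "\<And>x. norm (\<rho> x) \<le> B"
    using continuous_vanishing_bounded[OF c z] by blast
  obtain M where M: "\<And>n. norm (X n) \<le> M"
    using convergent_imp_Bseq[OF convergentI[OF X]] by (auto simp: Bseq_def)
  show "(\<lambda>n. mollify \<rho> f (X n)) \<longlonglongrightarrow> mollify \<rho> f x"
    unfolding mollify_def
  proof (rule integral_dominated_convergence[where w="\<lambda>y. B * norm (indicator (cball 0 (M+r)) y *\<^sub>R f y)"])
    show "integrable lebesgue (\<lambda>y. B * norm (indicator (cball 0 (M + r)) y *\<^sub>R f y))"
      using loc_integrableD(1)[OF f compact_cball]
      by (intro integrable_mult_right integrable_norm)
    have "(\<lambda>n. \<rho> (X n - y) *\<^sub>R f y) \<longlonglongrightarrow> \<rho> (x - y) *\<^sub>R f y" for y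
    proof -
      have "isCont \<rho> (x - y)" using c by (simp add: continuous_on_eq_continuous_at)
      then have "(\<lambda>n. \<rho> (X n - y)) \<longlonglongrightarrow> \<rho> (x - y)"
        by (rule isCont_tendsto_compose) (intro tendsto_intros X)
      then show ?thesis by (intro tendsto_intros)
    qed
    then show "AE y in lebesgue. (\<lambda>n. \<rho> (X n - y) *\<^sub>R f y) \<longlonglongrightarrow> \<rho> (x - y) *\<^sub>R f y" by simp
    have "norm (\<rho> (X n - y) *\<^sub>R f y) \<le> B * norm (indicator (cball 0 (M + r)) y *\<^sub>R f y)" for n y
    proof (cases "norm y \<le> M + r")
      case True
      then show ?thesis using B(2)[of "X n - y"] by (auto intro: mult_right_mono)
    next
      case False
      have "norm y \<le> norm (X n) + norm (X n - y)" by (metis norm_minus_commute norm_triangle_sub)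
      then show ?thesis using False M[of n] z[of "X n - y"] by simp
    qed
    then show "AE y in lebesgue. norm (\<rho> (X n - y) *\<^sub>R f y) \<le> B * norm (indicator (cball 0 (M + r)) y *\<^sub>R f y)" for n
      by simp
  qed (use kernel_measurable[OF c] in \<open>measurable\<close>)
qed

lemma C1_grad_reflect:
  assumes "C1_grad \<rho> D\<rho>"
  shows "C1_grad (\<lambda>y. \<rho> (x - y)) (\<lambda>y. - D\<rho> (x - y))"
proof -
  have d: "\<And>z. (\<rho> has_derivative (\<lambda>h. D\<rho> z \<bullet> h)) (at z)"
    and c: "continuous_on UNIV D\<rho>"
    using assms by (auto simp: C1_grad_def)
  have "((\<lambda>y. \<rho> (x - y)) has_derivative (\<lambda>h. - D\<rho> (x - y) \<bullet> h)) (at y)" for y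
  proof -
    have "((\<lambda>y. x - y) has_derivative (\<lambda>h. - h)) (at y)"
      by (auto intro!: derivative_eq_intros)
    from has_derivative_compose[OF this d[of "x - y"]] show ?thesis by simp
  qed
  moreover have "continuous_on UNIV (\<lambda>y. - D\<rho> (x - y))"
    by (intro continuous_intros continuous_on_compose2[OF c]) auto
  ultimately show ?thesis by (simp add: C1_grad_def)
qed

lemma test_fun_reflect:
  assumes "test_fun \<rho> D\<rho>"
  shows "test_fun (\<lambda>y. \<rho> (x - y)) (\<lambda>y. - D\<rho> (x - y))"
proof -
  obtain r where r: "\<And>x. norm x \<ge> r \<Longrightarrow> \<rho> x = 0" using test_fun_support[OF assms] by metis
  show ?thesis
  proof (rule test_funI)
    show "C1_grad (\<lambda>y. \<rho> (x - y)) (\<lambda>y. - D\<rho> (x - y))"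
      using assms by (intro C1_grad_reflect) (simp add: test_fun_def)
    show "\<rho> (x - y) = 0" if "norm y \<ge> norm x + r" for y
      using that norm_triangle_ineq2[of y x] by (intro r) (simp add: norm_minus_commute)
  qed
qed

text \<open>The mean value inequality, with the oscillation of \<open>D\<rho>\<close> around
  \<open>w\<close> as error. Once that oscillation is uniform the bound does not depend on
  \<open>w\<close>, which allows integrating it.\<close>

lemma C1_grad_remainder:
  fixes \<rho> :: "'a::euclidean_space \<Rightarrow> real"
  assumes "C1_grad \<rho> D\<rho>" and "\<And>z. dist z w \<le> norm h \<Longrightarrow> norm (D\<rho> z - D\<rho> w) \<le> e"
  shows "\<bar>\<rho> (w + h) - \<rho> w - D\<rho> w \<bullet> h\<bar> \<le> e * norm h"
proof -
  have d: "(\<rho> has_derivative (\<lambda>h. D\<rho> z \<bullet> h)) (at z within cball w (norm h))" for z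
    using assms(1) by (auto simp: C1_grad_def intro: has_derivative_at_withinI)
  have "norm (\<rho> (w + h) - \<rho> w - D\<rho> w \<bullet> ((w + h) - w)) \<le> norm ((w + h) - w) * e"
  proof (rule differentiable_bound_linearization[where S="cball w (norm h)" and f'="\<lambda>z. (\<bullet>) (D\<rho> z)"])
    show "w + t *\<^sub>R (w + h - w) \<in> cball w (norm h)" if "t \<in> {0..1}" for t
      using that by (auto simp: dist_norm mult_left_le_one_le)
    show "onorm ((\<bullet>) (D\<rho> x) - (\<bullet>) (D\<rho> w)) \<le> e" if "x \<in> cball w (norm h)" for x
      unfolding fun_diff_def
    proof (rule onorm_le)
      fix k
      have "norm (D\<rho> x \<bullet> k - D\<rho> w \<bullet> k) \<le> norm (D\<rho> x - D\<rho> w) * norm k"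
        by (metis inner_diff_left real_norm_def Cauchy_Schwarz_ineq2)
      also have "\<dots> \<le> e * norm k"
        using assms(2)[of x] that by (intro mult_right_mono) (auto simp: dist_commute)
      finally show "norm (D\<rho> x \<bullet> k - D\<rho> w \<bullet> k) \<le> e * norm k" .
    qed
  qed (use d in auto)
  then show ?thesis by (simp add: mult.commute)
qed

lemma scaled_kernel_integrable:
  fixes v :: "'a::euclidean_space \<Rightarrow> real" and k :: "'a \<Rightarrow> 'b::euclidean_space"
  assumes c: "continuous_on UNIV k" and z: "\<And>x. norm x \<ge> r \<Longrightarrow> k x = 0" and v: "loc_integrable v"
  shows "integrable lebesgue (\<lambda>y. v y *\<^sub>R k (x - y))"
  proof -
    obtain B where B: "\<And>x. norm (k x) \<le> B"
      using continuous_vanishing_bounded[OF c z] by blast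
    have [measurable]: "v \<in> borel_measurable lebesgue" using v by (simp add: loc_integrable_def)
    note [measurable] = kernel_measurable[OF c]
    have "integrable lebesgue (\<lambda>y. B * norm (indicator (cball x r) y *\<^sub>R v y))"
      using loc_integrableD(1)[OF v compact_cball] by (intro integrable_mult_right integrable_norm)
    then show ?thesis
    proof (rule Bochner_Integration.integrable_bound)
      have "norm (v y *\<^sub>R k (x - y)) \<le> norm (B * norm (indicator (cball x r) y *\<^sub>R v y))" for y
      proof (cases "dist x y \<le> r")
        case True
        have "norm (k (x - y)) \<le> \<bar>B\<bar>" using B[of "x-y"] by simp
        then have "\<bar>v y\<bar> * norm (k (x - y)) \<le> \<bar>v y\<bar> * \<bar>B\<bar>" by (intro mult_left_mono) auto
        then show ?thesis using True by (simp add: abs_mult mult.commute)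
      qed (use z[of "x-y"] in \<open>simp add: dist_norm\<close>)
      then show "AE y in lebesgue. norm (v y *\<^sub>R k (x - y)) \<le> norm (B * norm (indicator (cball x r) y *\<^sub>R v y))"
        by simp
    qed measurable
  qed

text \<open>The weak gradient is tested with the reflected kernel
  \<open>\<lambda>y. \<rho> (x - y)\<close>; the minus sign of its gradient cancels the one of
  integration by parts. The right side does not mention \<open>G\<close>, a fact used again for
  uniqueness of weak gradients.\<close>

lemma mollify_weak_grad:
  fixes v :: "'a::euclidean_space \<Rightarrow> real"
  assumes v: "loc_integrable v" and G: "loc_integrable G" and w: "weak_grad v G" and t: "test_fun \<rho> D\<rho>"
  shows "mollify \<rho> G x = (\<integral>y. v y *\<^sub>R D\<rho> (x - y) \<partial>lebesgue)"
proof (rule euclidean_eqI)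
  fix b :: 'a assume b: "b \<in> Basis"
  obtain r where r: "\<And>x. norm x \<ge> r \<Longrightarrow> \<rho> x = 0" "\<And>x. norm x \<ge> r \<Longrightarrow> D\<rho> x = 0"
    using test_fun_support[OF t] by metis
  have c: "continuous_on UNIV \<rho>" "continuous_on UNIV D\<rho>"
    using t by (auto simp: test_fun_def C1_grad_continuous) (simp add: C1_grad_def)
  have i1: "integrable lebesgue (\<lambda>y. \<rho> (x - y) *\<^sub>R G y)" by (rule mollify_integrable[OF c(1) r(1) G])
  have i2: "integrable lebesgue (\<lambda>y. v y *\<^sub>R D\<rho> (x - y))"
    by (rule scaled_kernel_integrable[OF c(2) r(2) v])
  have "mollify \<rho> G x \<bullet> b = (\<integral>y. (\<rho> (x - y) *\<^sub>R G y) \<bullet> b \<partial>lebesgue)"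
    unfolding mollify_def using integral_inner_left[of b, OF i1] by simp
  also have "\<dots> = (\<integral>y. (G y \<bullet> b) * \<rho> (x - y) \<partial>lebesgue)" by (simp add: mult.commute)
  also have "\<dots> = - (\<integral>y. v y * (- D\<rho> (x - y) \<bullet> b) \<partial>lebesgue)"
  proof -
    have "\<forall>b\<in>Basis. (\<integral>y. v y * (- D\<rho> (x - y) \<bullet> b) \<partial>lebesgue) = - (\<integral>y. (G y \<bullet> b) * \<rho> (x - y) \<partial>lebesgue)"
      using w test_fun_reflect[OF t, of x] unfolding weak_grad_def by blast
    with b show ?thesis by simp
  qed
  also have "\<dots> = (\<integral>y. (v y *\<^sub>R D\<rho> (x - y)) \<bullet> b \<partial>lebesgue)" by simp
  also have "\<dots> = (\<integral>y. v y *\<^sub>R D\<rho> (x - y) \<partial>lebesgue) \<bullet> b"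
    by (rule integral_inner_left[OF i2])
  finally show "mollify \<rho> G x \<bullet> b = (\<integral>y. v y *\<^sub>R D\<rho> (x - y) \<partial>lebesgue) \<bullet> b" .
qed

text \<open>Differentiation falls on the kernel and is moved to \<open>G\<close> by the weak
  gradient identity. Uniform continuity of \<open>D\<rho>\<close> makes the first-order remainder
  small simultaneously for all \<open>y\<close>, so its integral against \<open>v\<close> is
  small.\<close>

lemma mollify_C1_grad:
  fixes v :: "'a::euclidean_space \<Rightarrow> real"
  assumes v: "loc_integrable v" and G: "loc_integrable G" and w: "weak_grad v G" and t: "test_fun \<rho> D\<rho>"
  shows "C1_grad (mollify \<rho> v) (mollify \<rho> G)"
proof -
  obtain r where r: "r > 0" "\<And>x. norm x \<ge> r \<Longrightarrow> \<rho> x = 0" "\<And>x. norm x \<ge> r \<Longrightarrow> D\<rho> x = 0"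
    using test_fun_support[OF t] by metis
  have C1: "C1_grad \<rho> D\<rho>" using t by (simp add: test_fun_def)
  then have c: "continuous_on UNIV \<rho>" "continuous_on UNIV D\<rho>"
    by (simp add: C1_grad_continuous) (use C1 in \<open>simp add: C1_grad_def\<close>)
  have [measurable]: "v \<in> borel_measurable lebesgue" using v by (simp add: loc_integrable_def)
  have "(mollify \<rho> v has_derivative (\<lambda>h. mollify \<rho> G x \<bullet> h)) (at x)" for x
    unfolding has_derivative_at_alt
  proof (intro conjI allI impI)
    show "bounded_linear ((\<bullet>) (mollify \<rho> G x))" by (rule bounded_linear_inner_right)
    fix e :: real assume e: "e > 0"
    define I where "I = (\<integral>y. norm (indicator (cball x (r+1)) y *\<^sub>R v y) \<partial>lebesgue)"
    have I: "I \<ge> 0" "integrable lebesgue (\<lambda>y. norm (indicator (cball x (r+1)) y *\<^sub>R v y))"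
      using loc_integrableD(1)[OF v compact_cball]
      by (auto simp: I_def intro!: integral_nonneg_AE integrable_norm)
    \<comment> \<open>\<open>I\<close> is the L1 norm of \<open>v\<close> over all points that the
      kernel, moved by less than 1, can reach; adding 1 keeps the quotient meaningful when
      \<open>I\<close> is 0.\<close>
    define e' where "e' = e / (I + 1)"
    have e': "e' > 0" using e I by (simp add: e'_def)
    obtain d where d: "d > 0" "\<And>x y. dist x y < d \<Longrightarrow> dist (D\<rho> x) (D\<rho> y) < e'"
      using continuous_vanishing_uniformly_continuous[OF c(2) r(3) e'] by metis
    show "\<exists>d>0. \<forall>y. norm (y - x) < d \<longrightarrow>
        norm (mollify \<rho> v y - mollify \<rho> v x - mollify \<rho> G x \<bullet> (y - x)) \<le> e * norm (y - x)"
    proof (intro exI[of _ "min d 1"] conjI allI impI)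
      fix z assume z: "norm (z - x) < min d 1"
      define h where "h = z - x"
      define R where "R y = \<rho> (z - y) - \<rho> (x - y) - D\<rho> (x - y) \<bullet> h" for y
      have R: "\<bar>R y\<bar> \<le> e' * norm h" for y
      proof -
        have "\<bar>\<rho> ((x - y) + h) - \<rho> (x - y) - D\<rho> (x - y) \<bullet> h\<bar> \<le> e' * norm h"
          using d(2) z by (intro C1_grad_remainder[OF C1]) (force simp: h_def dist_norm less_imp_le)
        then show ?thesis by (simp add: R_def h_def)
      qed
      have R0: "R y = 0" if "y \<notin> cball x (r+1)" for y
      proof -
        have "norm (x - y) > r + 1" using that by (simp add: dist_norm)
        moreover have "norm (x - y) \<le> norm (z - y) + norm (z - x)"
          using norm_triangle_ineq[of "z - y" "x - z"] by (simp add: norm_minus_commute)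
        ultimately show ?thesis using r z by (simp add: R_def)
      qed
      have i1: "integrable lebesgue (\<lambda>y. \<rho> (w - y) *\<^sub>R v y)" for w
        by (rule mollify_integrable[OF c(1) r(2) v])
      have i2: "integrable lebesgue (\<lambda>y. v y *\<^sub>R D\<rho> (x - y))"
        by (rule scaled_kernel_integrable[OF c(2) r(3) v])
      have i3: "integrable lebesgue (\<lambda>y. (D\<rho> (x - y) \<bullet> h) * v y)"
        using integrable_inner_left[of h, OF i2] by (simp add: mult.commute)
      have "mollify \<rho> G x \<bullet> h = (\<integral>y. (v y *\<^sub>R D\<rho> (x - y)) \<bullet> h \<partial>lebesgue)"
        using mollify_weak_grad[OF v G w t, of x] integral_inner_left[of h, OF i2] by simp
      then have "mollify \<rho> v z - mollify \<rho> v x - mollify \<rho> G x \<bullet> h = (\<integral>y. R y * v y \<partial>lebesgue)"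
        using i1 i3 by (simp add: mollify_def R_def algebra_simps)
      then have "norm (mollify \<rho> v z - mollify \<rho> v x - mollify \<rho> G x \<bullet> h)
          = norm (\<integral>y. R y * v y \<partial>lebesgue)" by simp
      also have "\<dots> \<le> (\<integral>y. norm (R y * v y) \<partial>lebesgue)" by (rule integral_norm_bound)
      also have "\<dots> \<le> (\<integral>y. (e' * norm h) * norm (indicator (cball x (r+1)) y *\<^sub>R v y) \<partial>lebesgue)"
      proof (rule integral_mono')
        fix y
        show "norm (R y * v y) \<le> e' * norm h * norm (indicat_real (cball x (r + 1)) y *\<^sub>R v y)"
          using mult_right_mono[OF R[of y], of "\<bar>v y\<bar>"] R0[of y]
          by (cases "y \<in> cball x (r+1)") (simp_all add: abs_mult)
      qed (use I e' in auto)
      also have "\<dots> = (e' * norm h) * I" unfolding I_def by (rule integral_mult_right_zero)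
      also have "\<dots> = (e' * I) * norm h" by (simp add: mult_ac)
      also have "\<dots> \<le> e * norm h"
        using e I by (intro mult_right_mono) (auto simp: e'_def divide_simps)
      finally show "norm (mollify \<rho> v z - mollify \<rho> v x - mollify \<rho> G x \<bullet> (z - x)) \<le> e * norm (z - x)"
        by (simp add: h_def)
    qed (use d in simp)
  qed
  moreover have "continuous_on UNIV (mollify \<rho> G)" by (rule mollify_continuous[OF c(1) r(2) G])
  ultimately show ?thesis by (simp add: C1_grad_def)
qed

section \<open>Continuous approximation in L1 and the L1 contraction property of
  mollification\<close>

text \<open>Induction over integrable functions. For an indicator, a Urysohn function between a
  closed inner and an open outer approximation differs from it only on the small set
  \<open>U - C\<close>.\<close>

lemma integrable_approx_continuous:
  fixes f :: "'a::euclidean_space \<Rightarrow> 'b::euclidean_space"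
  assumes "integrable lebesgue f" "e > 0"
  obtains g where "continuous_on UNIV g" "integrable lebesgue g" "(\<integral>x. norm (f x - g x) \<partial>lebesgue) < e"
proof -
  have "\<forall>e>0. \<exists>g. continuous_on UNIV g \<and> integrable lebesgue g \<and> (\<integral>x. norm (f x - g x) \<partial>lebesgue) < e"
    using assms(1)
  proof (induction rule: integrable_induct)
    case (base A c)
    show ?case
    proof (intro allI impI)
      fix e :: real assume e: "e > 0"
      \<comment> \<open>The set where the Urysohn function can be wrong has measure below
        \<open>2 * e'\<close>, and the error there is at most \<open>norm c\<close>.\<close>
      define e' where "e' = e / (2 * (norm c + 1))"
      have e': "e' > 0" using e by (simp add: e'_def add_nonneg_pos)
      obtain C where C: "closed C" "C \<subseteq> A" "A - C \<in> lmeasurable" "emeasure lebesgue (A - C) < ennreal e'"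
        using sets_lebesgue_inner_closed[OF base(1) e'] by metis
      obtain U where U: "open U" "A \<subseteq> U" "U - A \<in> lmeasurable" "emeasure lebesgue (U - A) < ennreal e'"
        using sets_lebesgue_outer_open[OF base(1) e'] by metis
      have CU: "closed (- U)" "C \<inter> - U = {}" using C(2) U(1,2) by auto
      obtain h :: "'a \<Rightarrow> real" where h: "continuous_on UNIV h" "\<And>x. h x \<in> closed_segment 1 0"
        "\<And>x. x \<in> C \<Longrightarrow> h x = 1" "\<And>x. x \<in> - U \<Longrightarrow> h x = 0"
        using Urysohn[OF C(1) CU, of "1::real" 0 thesis] by blast
      have h01: "0 \<le> h x" "h x \<le> 1" for x using h(2)[of x] by (auto simp: closed_segment_eq_real_ivl)
      have UC: "U - C = (A - C) \<union> (U - A)" using C U by auto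
      then have UCm: "U - C \<in> lmeasurable" using C(3) U(3) by (simp add: fmeasurable.Un)
      have mUC: "measure lebesgue (U - C) < 2 * e'"
      proof -
        have "measure lebesgue (U - C) \<le> measure lebesgue (A - C) + measure lebesgue (U - A)"
          unfolding UC using C(3) U(3) by (intro measure_Un_le) auto
        moreover have "measure lebesgue (A - C) < e'" "measure lebesgue (U - A) < e'"
          using C(3,4) U(3,4) e' by (simp_all add: emeasure_eq_measure2 ennreal_less_iff)
        ultimately show ?thesis by simp
      qed
      have Ai: "integrable lebesgue (\<lambda>x. indicator A x *\<^sub>R c)"
        using base by (intro integrable_scaleR_left) auto
      have UCi: "integrable lebesgue (\<lambda>x. norm c * indicat_real (U - C) x)"
        using UCm by (intro integrable_mult_right) (auto simp: fmeasurable_def)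
      define g where "g x = h x *\<^sub>R c" for x
      have gc: "continuous_on UNIV g" unfolding g_def by (intro continuous_intros h)
      have [measurable]: "g \<in> borel_measurable lebesgue" by (rule continuous_borel_lebesgue[OF gc])
      have bnd: "norm (indicator A x *\<^sub>R c - g x) \<le> norm c * indicat_real (U - C) x" for x
      proof -
        have "norm (indicator A x *\<^sub>R c - g x) = \<bar>indicator A x - h x\<bar> * norm c"
          by (simp add: g_def flip: scaleR_diff_left)
        also have "\<dots> \<le> indicat_real (U - C) x * norm c"
          using h(3,4)[of x] h01[of x] C U by (intro mult_right_mono) (auto simp: indicator_def)
        finally show ?thesis by (simp add: mult.commute)
      qed
      have "integrable lebesgue (\<lambda>x. indicator A x *\<^sub>R c - g x)"
        using UCi by (rule Bochner_Integration.integrable_bound) (use base bnd in \<open>auto intro: order_trans[OF bnd]\<close>)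
      from Bochner_Integration.integrable_diff[OF Ai this]
      have gi: "integrable lebesgue g" by simp
      have "(\<integral>x. norm (indicator A x *\<^sub>R c - g x) \<partial>lebesgue) \<le> (\<integral>x. norm c * indicat_real (U - C) x \<partial>lebesgue)"
        by (rule integral_mono') (use UCi bnd in auto)
      also have "\<dots> = norm c * measure lebesgue (U - C)" using UCm by simp
      also have "\<dots> \<le> norm c * (2 * e')" using mUC by (intro mult_left_mono) auto
      also have "\<dots> < e" using e by (simp add: e'_def divide_simps add_nonneg_pos)
      finally show "\<exists>g. continuous_on UNIV g \<and> integrable lebesgue g \<and>
         (\<integral>x. norm (indicator A x *\<^sub>R c - g x) \<partial>lebesgue) < e"
        using gc gi by blast
    qed
  next
    case (add f1 f2)
    show ?case
    proof (intro allI impI)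
      fix e :: real assume "e > 0"
      then have e2: "e / 2 > 0" by simp
      obtain g1 g2 where g: "continuous_on UNIV g1" "integrable lebesgue g1" "(\<integral>x. norm (f1 x - g1 x) \<partial>lebesgue) < e/2"
         "continuous_on UNIV g2" "integrable lebesgue g2" "(\<integral>x. norm (f2 x - g2 x) \<partial>lebesgue) < e/2"
        using add(3)[rule_format, OF e2] add(4)[rule_format, OF e2] by blast
      have "(\<integral>x. norm ((f1 x + f2 x) - (g1 x + g2 x)) \<partial>lebesgue) \<le> (\<integral>x. norm (f1 x - g1 x) + norm (f2 x - g2 x) \<partial>lebesgue)"
        using add(1,2) g by (intro integral_mono') (auto simp: add_diff_add intro: norm_triangle_ineq)
      also have "\<dots> < e" using g add(1,2) by (subst Bochner_Integration.integral_add) auto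
      finally show "\<exists>g. continuous_on UNIV g \<and> integrable lebesgue g \<and> (\<integral>x. norm ((f1 x + f2 x) - g x) \<partial>lebesgue) < e"
        using g by (intro exI[of _ "\<lambda>x. g1 x + g2 x"]) (auto intro!: continuous_intros)
    qed
  next
    case (lim f s)
    have [measurable]: "\<And>i. s i \<in> borel_measurable lebesgue" "f \<in> borel_measurable lebesgue"
      using lim by auto
    have "(\<lambda>i. \<integral>x. norm (f x - s i x) \<partial>lebesgue) \<longlonglongrightarrow> integral\<^sup>L lebesgue (\<lambda>_::'a. 0::real)"
    proof (rule integral_dominated_convergence[where w="\<lambda>x. 3 * norm (f x)" and f="\<lambda>_. 0::real" and s="\<lambda>i x. norm (f x - s i x)" and M=lebesgue])
      show "AE x in lebesgue. (\<lambda>i. norm (f x - s i x)) \<longlonglongrightarrow> 0"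
      proof (rule AE_I2)
        fix x
        have "(\<lambda>i. norm (f x - s i x)) \<longlonglongrightarrow> norm (f x - f x)"
          using lim(2)[of x] by (intro tendsto_intros) simp
        then show "(\<lambda>i. norm (f x - s i x)) \<longlonglongrightarrow> 0" by simp
      qed
      \<comment> \<open>The approximants of the induction principle are bounded by
        \<open>2 * norm (f x)\<close>, hence the factor 3.\<close>
      have "norm (f x - s i x) \<le> 3 * norm (f x)" for i x
        using norm_triangle_ineq4[of "f x" "s i x"] lim(3)[of x i] by simp
      then show "AE x in lebesgue. norm (norm (f x - s i x)) \<le> 3 * norm (f x)" for i by simp
    qed (use lim in auto)
    then have l0: "(\<lambda>i. \<integral>x. norm (f x - s i x) \<partial>lebesgue) \<longlonglongrightarrow> 0" by simp
    show ?case
    proof (intro allI impI)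
      fix e :: real assume e: "e > 0"
      then obtain i where i: "(\<integral>x. norm (f x - s i x) \<partial>lebesgue) < e/2"
        using order_tendstoD(2)[OF l0, of "e/2"] by (auto simp: eventually_sequentially)
      obtain g where g: "continuous_on UNIV g" "integrable lebesgue g" "(\<integral>x. norm (s i x - g x) \<partial>lebesgue) < e/2"
        using lim(5)[rule_format, of "e/2" i] e by auto
      have "(\<integral>x. norm (f x - g x) \<partial>lebesgue) \<le> (\<integral>x. norm (f x - s i x) + norm (s i x - g x) \<partial>lebesgue)"
        using lim(1,4) g by (intro integral_mono') (auto intro: order_trans[OF _ norm_triangle_ineq])
      also have "\<dots> < e" using g i lim(1,4) by (subst Bochner_Integration.integral_add) auto
      finally show "\<exists>g. continuous_on UNIV g \<and> integrable lebesgue g \<and> (\<integral>x. norm (f x - g x) \<partial>lebesgue) < e"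
        using g by blast
    qed
  qed
  with assms(2) that show ?thesis by blast
qed

text \<open>Tonelli and translation invariance: averaging against a probability kernel does not
  increase the L1 norm. Tonelli is applied over \<open>lborel\<close>, so the norm of
  \<open>f\<close>, measurable only for the completion, is first replaced by a Borel function equal
  to it a.e.\<close>

lemma mollify_nn_integral_le:
  fixes f :: "'a::euclidean_space \<Rightarrow> 'b::euclidean_space"
  assumes c: "continuous_on UNIV \<rho>" and nn: "\<And>x. \<rho> x \<ge> 0" and one: "(\<integral>\<^sup>+x. ennreal (\<rho> x) \<partial>lborel) = 1"
    and f: "integrable lebesgue f"
  shows "(\<integral>\<^sup>+x. ennreal (norm (mollify \<rho> f x)) \<partial>lebesgue) \<le> (\<integral>\<^sup>+x. ennreal (norm (f x)) \<partial>lebesgue)"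
proof -
  have [measurable]: "\<rho> \<in> borel_measurable borel" using c by (rule borel_measurable_continuous_onI)
  have [measurable]: "f \<in> borel_measurable lebesgue" using f by auto
  have "(\<lambda>x. ennreal (norm (f x))) \<in> borel_measurable lebesgue" by measurable
  from completion_ex_borel_measurable[OF this]
  obtain f' where [measurable]: "f' \<in> borel_measurable lborel" and "AE x in lborel. ennreal (norm (f x)) = f' x"
    by auto
  then have f': "AE x in lebesgue. ennreal (norm (f x)) = f' x" by (intro AE_completion)
  have [measurable]: "f' \<in> borel_measurable borel" using \<open>f' \<in> borel_measurable lborel\<close> by simp
  have 1: "ennreal (norm (mollify \<rho> f x)) \<le> (\<integral>\<^sup>+y. ennreal (\<rho> (x - y)) * f' y \<partial>lborel)" for x
  proof -
    have "ennreal (norm (mollify \<rho> f x)) \<le> (\<integral>\<^sup>+y. norm (\<rho> (x - y) *\<^sub>R f y) \<partial>lebesgue)"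
    proof (cases "integrable lebesgue (\<lambda>y. \<rho> (x - y) *\<^sub>R f y)")
      case True
      then show ?thesis unfolding mollify_def by (rule integral_norm_bound_ennreal)
    next
      \<comment> \<open>The Bochner integral of a non-integrable function is 0 by convention, so the
        bound is trivial.\<close>
      case False
      then show ?thesis by (simp add: mollify_def not_integrable_integral_eq)
    qed
    also have "\<dots> = (\<integral>\<^sup>+y. ennreal (\<rho> (x - y)) * f' y \<partial>lebesgue)"
      by (rule nn_integral_cong_AE) (use f' in eventually_elim, simp add: nn ennreal_mult)
    also have "\<dots> = (\<integral>\<^sup>+y. ennreal (\<rho> (x - y)) * f' y \<partial>lborel)"
      by (rule nn_integral_completion)
    finally show ?thesis .
  qed
  have tr: "(\<integral>\<^sup>+x. ennreal (\<rho> (x - y)) \<partial>lborel) = 1" for y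
  proof -
    have "1 = (\<integral>\<^sup>+x. ennreal (\<rho> x) \<partial>distr lborel borel ((+) (- y)))"
      by (simp add: lborel_distr_plus one)
    also have "\<dots> = (\<integral>\<^sup>+x. ennreal (\<rho> (- y + x)) \<partial>lborel)" by (rule nn_integral_distr) auto
    finally show ?thesis by simp
  qed
  have "(\<integral>\<^sup>+x. ennreal (norm (mollify \<rho> f x)) \<partial>lebesgue)
      \<le> (\<integral>\<^sup>+x. (\<integral>\<^sup>+y. ennreal (\<rho> (x - y)) * f' y \<partial>lborel) \<partial>lebesgue)"
    by (intro nn_integral_mono 1)
  also have "\<dots> = (\<integral>\<^sup>+x. (\<integral>\<^sup>+y. ennreal (\<rho> (x - y)) * f' y \<partial>lborel) \<partial>lborel)"
    by (rule nn_integral_completion)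
  also have "\<dots> = (\<integral>\<^sup>+y. (\<integral>\<^sup>+x. ennreal (\<rho> (x - y)) * f' y \<partial>lborel) \<partial>lborel)"
    by (rule lborel_pair.Fubini') measurable
  also have "\<dots> = (\<integral>\<^sup>+y. f' y \<partial>lborel)"
    by (subst nn_integral_multc) (auto simp: tr)
  also have "\<dots> = (\<integral>\<^sup>+y. f' y \<partial>lebesgue)" by (rule nn_integral_completion[symmetric])
  also have "\<dots> = (\<integral>\<^sup>+x. ennreal (norm (f x)) \<partial>lebesgue)"
    by (rule nn_integral_cong_AE) (use f' in eventually_elim, simp)
  finally show ?thesis .
qed

section \<open>Construction of mollifiers\<close>

lemma nonneg_continuous_integral_pos:
  fixes h :: "'a::euclidean_space \<Rightarrow> real"
  assumes c: "continuous_on UNIV h" and nn: "\<And>x. h x \<ge> 0" and a: "h a > 0" and i: "integrable lborel h"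
  shows "(\<integral>x. h x \<partial>lborel) > 0"
proof -
  have "open {x. h x > h a / 2}" by (intro open_Collect_less continuous_intros c)
  moreover have "a \<in> {x. h x > h a / 2}" using a by simp
  ultimately obtain d where d: "d > 0" "ball a d \<subseteq> {x. h x > h a / 2}"
    unfolding open_contains_ball by blast
  have "0 < (h a / 2) * measure lborel (ball a d)"
    using a d content_ball_pos[of d a] by simp
  also have "\<dots> = (\<integral>x. (h a / 2) * indicator (ball a d) x \<partial>lborel)"
    by simp
  also have "\<dots> \<le> (\<integral>x. h x \<partial>lborel)"
    using i
  proof (rule integral_mono')
    show "(h a / 2) * indicat_real (ball a d) x \<le> h x" for x
      using d nn[of x] by (auto simp: indicator_def)
  qed (use nn in auto)
  finally show ?thesis .
qed

text \<open>The building block for kernels and cutoffs, which need only be C1. Exponents from 2 on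
  make the one-sided derivatives agree at 0, where the difference quotient is at most a positive
  power of \<open>\<bar>h\<bar>\<close>.\<close>

lemma has_real_derivative_max0_power:
  assumes n: "n \<ge> 2"
  shows "((\<lambda>t::real. max 0 t ^ n) has_real_derivative real n * max 0 t ^ (n - 1)) (at t)"
proof -
  consider "t > 0" | "t < 0" | "t = 0" by linarith
  then show ?thesis
  proof cases
    case 1
    have "((\<lambda>t. t ^ n) has_real_derivative real n * max 0 t ^ (n - 1)) (at t)"
      using 1 by (auto intro!: derivative_eq_intros)
    then show ?thesis
      by (rule has_field_derivative_transform_within_open[OF _ open_greaterThan[of 0]]) (use 1 in auto)
  next
    case 2
    have "((\<lambda>t. 0) has_real_derivative real n * max 0 t ^ (n - 1)) (at t)"
      using 2 n by (auto intro!: derivative_eq_intros)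
    then show ?thesis
      by (rule has_field_derivative_transform_within_open[OF _ open_lessThan[of 0]]) (use 2 n in auto)
  next
    case 3
    have "(\<lambda>h::real. (max 0 (0 + h) ^ n - max 0 0 ^ n) / h) \<midarrow>0\<rightarrow> 0"
    proof (rule Lim_null_comparison)
      have "norm ((max 0 (0 + h) ^ n - max 0 0 ^ n) / h) \<le> \<bar>h\<bar> ^ (n - 1)" for h :: real
        using n by (cases n) (auto simp: max_def)
      then show "\<forall>\<^sub>F h in at 0. norm ((max 0 (0 + h) ^ n - max 0 0 ^ n) / h) \<le> \<bar>h::real\<bar> ^ (n - 1)"
        by (intro always_eventually allI)
      have "((\<lambda>h::real. \<bar>h\<bar> ^ (n - 1)) \<longlongrightarrow> \<bar>0\<bar> ^ (n - 1)) (at 0)" by (intro tendsto_intros)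
      then show "(\<lambda>h::real. \<bar>h\<bar> ^ (n - 1)) \<midarrow>0\<rightarrow> 0" using n by (simp add: power_0_left)
    qed
    then show ?thesis using 3 n by (simp add: DERIV_def power_0_left)
  qed
qed

text \<open>The kernel is the square of the positive part of \<open>d^2 - x \<bullet> x\<close>,
  divided by its integral. The squared norm keeps it differentiable at the origin.\<close>

lemma mollifier_exists:
  fixes d :: real
  assumes d: "d > 0"
  obtains \<rho> D\<rho> where "test_fun \<rho> D\<rho>" "\<And>x::'a::euclidean_space. \<rho> x \<ge> 0" "\<And>x. norm x \<ge> d \<Longrightarrow> \<rho> x = 0"
    "(\<integral>\<^sup>+x. ennreal (\<rho> x) \<partial>lborel) = 1"
proof -
  define m where "m t = (max 0 t)^2" for t :: real
  have md: "(m has_real_derivative 2 * max 0 t) (at t)" for t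
    using has_real_derivative_max0_power[of 2 t] by (simp add: m_def[abs_def])
  define g where "g x = m (d^2 - x \<bullet> x)" for x :: 'a
  define Dg where "Dg x = (- 4 * max 0 (d^2 - x \<bullet> x)) *\<^sub>R x" for x :: 'a
  have gd: "(g has_derivative (\<lambda>h. Dg x \<bullet> h)) (at x)" for x
  proof -
    have "((\<lambda>x. d^2 - x \<bullet> x) has_derivative (\<lambda>h. - 2 * (x \<bullet> h))) (at x)"
      by (auto intro!: derivative_eq_intros simp: inner_commute)
    from has_derivative_compose[OF this md[unfolded has_field_derivative_def]]
    show ?thesis by (simp add: g_def[abs_def] Dg_def o_def mult_ac)
  qed
  have "continuous_on UNIV Dg" unfolding Dg_def by (intro continuous_intros)
  with gd have C1: "C1_grad g Dg" by (simp add: C1_grad_def)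
  have g0: "g x = 0" if "norm x \<ge> d" for x
    using that d power_mono[of d "norm x" 2] by (simp add: g_def m_def dot_square_norm)
  have gc: "continuous_on UNIV g" by (rule C1_grad_continuous[OF C1])
  have gnn: "g x \<ge> 0" for x by (simp add: g_def m_def)
  obtain B where B: "\<And>x. norm (g x) \<le> B" using continuous_vanishing_bounded[OF gc g0] by blast
  have gi: "integrable lborel g"
  proof (rule Bochner_Integration.integrable_bound[where f="\<lambda>x. B * indicator (cball 0 d) x"])
    show "integrable lborel (\<lambda>x::'a. B * indicat_real (cball 0 d) x)"
      by (intro integrable_mult_right integrable_real_indicator) (use emeasure_lborel_cball_finite[of "0::'a" d] in auto)
    show "g \<in> borel_measurable lborel" using borel_measurable_continuous_onI[OF gc] by simp
    have "norm (g x) \<le> norm (B * indicat_real (cball 0 d) x)" for x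
      using B[of x] g0[of x] by (auto simp: indicator_def)
    then show "AE x in lborel. norm (g x) \<le> norm (B * indicat_real (cball 0 d) x)" by simp
  qed
  define I where "I = (\<integral>x. g x \<partial>lborel)"
  have I: "I > 0" unfolding I_def
    by (rule nonneg_continuous_integral_pos[OF gc gnn _ gi, of 0]) (use d in \<open>simp add: g_def m_def\<close>)
  show ?thesis
  proof (rule that[of "\<lambda>x. g x / I" "\<lambda>x. Dg x /\<^sub>R I"])
    have "((\<lambda>x. g x / I) has_derivative (\<lambda>h. (Dg x /\<^sub>R I) \<bullet> h)) (at x)" for x
      using has_derivative_mult_left[OF gd[of x], of "inverse I"] by (simp add: divide_inverse mult.commute)
    moreover have "continuous_on UNIV (\<lambda>x. Dg x /\<^sub>R I)"
      using C1 by (intro continuous_intros) (simp add: C1_grad_def)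
    ultimately have "C1_grad (\<lambda>x. g x / I) (\<lambda>x. Dg x /\<^sub>R I)" by (simp add: C1_grad_def)
    then show "test_fun (\<lambda>x. g x / I) (\<lambda>x. Dg x /\<^sub>R I)"
      by (rule test_funI[of _ _ d]) (simp add: g0)
    show "(\<integral>\<^sup>+x. ennreal (g x / I) \<partial>lborel) = 1"
      using gi gnn I by (subst nn_integral_eq_integral) (auto simp: I_def)
  qed (use g0 gnn I in auto)
qed

definition mollifier_seq :: "(nat \<Rightarrow> 'a::euclidean_space \<Rightarrow> real) \<Rightarrow> (nat \<Rightarrow> 'a \<Rightarrow> 'a) \<Rightarrow> bool" where
  "mollifier_seq \<rho> D\<rho> \<longleftrightarrow> (\<forall>n. test_fun (\<rho> n) (D\<rho> n) \<and> (\<forall>x. \<rho> n x \<ge> 0) \<and>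
     (\<forall>x. norm x \<ge> 1 / Suc n \<longrightarrow> \<rho> n x = 0) \<and> (\<integral>\<^sup>+x. ennreal (\<rho> n x) \<partial>lborel) = 1)"

lemma mollifier_seq_exists:
  obtains \<rho> :: "nat \<Rightarrow> 'a::euclidean_space \<Rightarrow> real" and D\<rho> where "mollifier_seq \<rho> D\<rho>"
proof -
  have "\<exists>r Dr. test_fun r Dr \<and> (\<forall>x::'a. r x \<ge> 0) \<and>
     (\<forall>x. norm x \<ge> 1 / Suc n \<longrightarrow> r x = 0) \<and> (\<integral>\<^sup>+x. ennreal (r x) \<partial>lborel) = 1" for n
  proof -
    have "0 < 1 / real (Suc n)" by simp
    from mollifier_exists[OF this, where 'a='a] show ?thesis by metis
  qed
  then show ?thesis using that unfolding mollifier_seq_def by metis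
qed

section \<open>Kernels of mass one and local L1 convergence\<close>

lemma kernel_has_integral_1:
  assumes c: "continuous_on UNIV \<rho>" and nn: "\<And>x. \<rho> x \<ge> 0" and one: "(\<integral>\<^sup>+x. ennreal (\<rho> x) \<partial>lborel) = 1"
  shows "has_bochner_integral lebesgue (\<lambda>y::'a::euclidean_space. \<rho> (x - y)) 1"
proof -
  have [measurable]: "\<rho> \<in> borel_measurable borel" using c by (rule borel_measurable_continuous_onI)
  have L: "distr lborel borel (\<lambda>y. x - y) = lborel"
    using lborel_affine[of "-1" x] by (simp add: density_1)
  have "1 = (\<integral>\<^sup>+y. ennreal (\<rho> y) \<partial>distr lborel borel (\<lambda>y. x - y))"
    unfolding L by (simp add: one)
  also have "\<dots> = (\<integral>\<^sup>+y. ennreal (\<rho> (x - y)) \<partial>lborel)"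
    by (simp add: nn_integral_distr)
  also have "\<dots> = (\<integral>\<^sup>+y. ennreal (\<rho> (x - y)) \<partial>lebesgue)" by (rule nn_integral_completion[symmetric])
  finally have "(\<integral>\<^sup>+y. ennreal (\<rho> (x - y)) \<partial>lebesgue) = ennreal 1" by simp
  then show ?thesis
    by (intro has_bochner_integral_nn_integral) (use nn kernel_measurable[OF c] in auto)
qed

lemma mollify_const:
  assumes "continuous_on UNIV \<rho>" "\<And>x. \<rho> x \<ge> 0" "(\<integral>\<^sup>+x. ennreal (\<rho> x) \<partial>lborel) = 1"
  shows "mollify \<rho> (\<lambda>_. c) x = c" "integrable lebesgue (\<lambda>y. \<rho> (x - y) *\<^sub>R c)"
proof -
  have "has_bochner_integral lebesgue (\<lambda>y. \<rho> (x - y) *\<^sub>R c) (1 *\<^sub>R c)"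
    by (intro has_bochner_integral_scaleR_left kernel_has_integral_1 assms)
  then show "mollify \<rho> (\<lambda>_. c) x = c" "integrable lebesgue (\<lambda>y. \<rho> (x - y) *\<^sub>R c)"
    by (auto simp: mollify_def has_bochner_integral_integral_eq integrable.intros)
qed

lemma mollify_cong:
  assumes "\<And>x. norm x \<ge> d \<Longrightarrow> \<rho> x = 0" "\<And>y. dist x y < d \<Longrightarrow> f y = g y"
  shows "mollify \<rho> f x = mollify \<rho> g x"
  unfolding mollify_def
proof (rule Bochner_Integration.integral_cong[OF refl])
  fix y
  show "\<rho> (x - y) *\<^sub>R f y = \<rho> (x - y) *\<^sub>R g y"
    using assms(1)[of "x - y"] assms(2)[of y] by (cases "dist x y < d") (auto simp: dist_norm)
qed

lemma loc_integrable_continuous: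
  fixes g :: "'a::euclidean_space \<Rightarrow> 'b::euclidean_space"
  assumes "continuous_on UNIV g"
  shows "loc_integrable g"
proof -
  have "set_integrable lebesgue K g" if "compact K" for K
  proof -
    have "set_integrable lborel K g"
      using borel_integrable_compact[OF that continuous_on_subset[OF assms]]
      by (simp add: set_integrable_def indicator_scaleR_eq_if)
    then show ?thesis unfolding set_integrable_def
      by (rule integrable_completion[THEN iffD2, rotated])
         (use that assms borel_measurable_continuous_onI[OF assms] in \<open>auto simp: compact_imp_closed\<close>)
  qed
  then show ?thesis using continuous_borel_lebesgue[OF assms] by (simp add: loc_integrable_def)
qed

lemma integrable_loc_integrable:
  fixes g :: "'a::euclidean_space \<Rightarrow> 'b::euclidean_space"
  assumes "integrable lebesgue g"
  shows "loc_integrable g"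
  using assms by (auto simp: loc_integrable_def set_integrable_def compact_imp_closed intro!: integrable_mult_indicator)

lemma mollify_diff_le:
  fixes g :: "'a::euclidean_space \<Rightarrow> 'b::euclidean_space"
  assumes c: "continuous_on UNIV \<rho>" and nn: "\<And>x. \<rho> x \<ge> 0" and one: "(\<integral>\<^sup>+x. ennreal (\<rho> x) \<partial>lborel) = 1"
    and z: "\<And>x. norm x \<ge> d \<Longrightarrow> \<rho> x = 0" and g: "loc_integrable g"
    and e: "\<And>y. dist x y < d \<Longrightarrow> norm (g y - g x) \<le> e"
  shows "norm (mollify \<rho> g x - g x) \<le> e"
proof -
  have i: "integrable lebesgue (\<lambda>y. \<rho> (x - y) *\<^sub>R g y)" by (rule mollify_integrable[OF c z g])
  have "mollify \<rho> g x - g x = (\<integral>y. \<rho> (x - y) *\<^sub>R g y \<partial>lebesgue) - (\<integral>y. \<rho> (x - y) *\<^sub>R g x \<partial>lebesgue)"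
    using mollify_const(1)[OF c nn one, of "g x" x] by (simp add: mollify_def)
  also have "\<dots> = (\<integral>y. \<rho> (x - y) *\<^sub>R (g y - g x) \<partial>lebesgue)"
    using i mollify_const(2)[OF c nn one, of x "g x"] by (simp add: scaleR_diff_right)
  finally have "norm (mollify \<rho> g x - g x) \<le> (\<integral>y. norm (\<rho> (x - y) *\<^sub>R (g y - g x)) \<partial>lebesgue)"
    by (metis integral_norm_bound)
  also have "\<dots> \<le> (\<integral>y. \<rho> (x - y) *\<^sub>R e \<partial>lebesgue)"
  proof (rule integral_mono')
    show "integrable lebesgue (\<lambda>y. \<rho> (x - y) *\<^sub>R e)" by (rule mollify_const(2)[OF c nn one])
    fix y
    show "norm (\<rho> (x - y) *\<^sub>R (g y - g x)) \<le> \<rho> (x - y) *\<^sub>R e"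
      using e[of y] z[of "x - y"] nn[of "x - y"]
      by (cases "dist x y < d") (auto simp: dist_norm intro: mult_left_mono)
    \<comment> \<open>\<open>e\<close> is not assumed nonnegative: a point within distance
      \<open>d\<close> forces it to be, and elsewhere the kernel vanishes.\<close>
    have "\<rho> (x - y) = 0 \<or> e \<ge> 0"
      using e[of y] z[of "x - y"] norm_ge_zero[of "g y - g x"] by (force simp: dist_norm simp del: norm_ge_zero)
    then show "0 \<le> \<rho> (x - y) *\<^sub>R e" using nn by auto
  qed
  also have "\<dots> = e" using mollify_const(1)[OF c nn one, of e x] by (simp add: mollify_def)
  finally show ?thesis .
qed

text \<open>On the ball, \<open>f\<close> is split into a continuous \<open>g\<close> and a
  remainder small in L1. Mollification does not enlarge the remainder, while it moves
  \<open>g\<close> by at most its modulus of continuity; the error consists of three thirds of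
  \<open>e\<close>.\<close>

lemma mollify_tendsto_L1_loc:
  fixes f :: "'a::euclidean_space \<Rightarrow> 'b::euclidean_space"
  assumes m: "mollifier_seq \<rho> D\<rho>" and f: "loc_integrable f"
  shows "(\<lambda>n. \<integral>x. norm (indicat_real (cball 0 r) x *\<^sub>R (mollify (\<rho> n) f x - f x)) \<partial>lebesgue) \<longlonglongrightarrow> 0"
proof (rule LIMSEQ_I)
  fix e :: real assume e: "e > 0"
  have \<rho>: "continuous_on UNIV (\<rho> n)" "\<And>x. \<rho> n x \<ge> 0" "(\<integral>\<^sup>+x. ennreal (\<rho> n x) \<partial>lborel) = 1"
    "\<And>x. norm x \<ge> 1 / Suc n \<Longrightarrow> \<rho> n x = 0" "\<And>x. norm x \<ge> 1 \<Longrightarrow> \<rho> n x = 0" for n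
  proof -
    show "continuous_on UNIV (\<rho> n)" "\<And>x. \<rho> n x \<ge> 0" "(\<integral>\<^sup>+x. ennreal (\<rho> n x) \<partial>lborel) = 1"
      and z: "\<And>x. norm x \<ge> 1 / Suc n \<Longrightarrow> \<rho> n x = 0"
      using m by (auto simp: mollifier_seq_def test_fun_def intro: C1_grad_continuous)
    have "1 / real (Suc n) \<le> 1" by simp
    with z show "\<And>x. norm x \<ge> 1 \<Longrightarrow> \<rho> n x = 0" by (meson order_trans)
  qed
  define K where "K = cball (0::'a) r"
  \<comment> \<open>Kernels have radius at most 1, so cutting \<open>f\<close> off outside radius
    \<open>r + 1\<close> leaves its mollifications on \<open>K\<close> unchanged and makes it
    globally integrable.\<close>
  define f' where "f' x = indicat_real (cball 0 (r+1)) x *\<^sub>R f x" for x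
  have f'i: "integrable lebesgue f'"
    unfolding f'_def using loc_integrableD(1)[OF f compact_cball] .
  obtain g where g: "continuous_on UNIV g" "integrable lebesgue g" "(\<integral>x. norm (f' x - g x) \<partial>lebesgue) < e/3"
    using integrable_approx_continuous[OF f'i, of "e/3"] e by auto
  have gl: "loc_integrable g" by (rule loc_integrable_continuous[OF g(1)])
  define e' where "e' = e / (3 * (measure lebesgue K + 1))"
  have e': "e' > 0" using e by (simp add: e'_def add_nonneg_pos)
  have Kl: "K \<in> lmeasurable" by (simp add: K_def)
  have "uniformly_continuous_on (cball 0 (r+1)) g"
    by (intro compact_uniformly_continuous) (use g(1) continuous_on_subset in auto)
  then obtain d where d: "d > 0" "\<And>x y. x \<in> cball 0 (r+1) \<Longrightarrow> y \<in> cball 0 (r+1) \<Longrightarrow> dist y x < d \<Longrightarrow> dist (g y) (g x) < e'"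
    using e' unfolding uniformly_continuous_on_def by metis
  obtain N where N: "1 / real (Suc N) < d" using d(1) nat_approx_posE by blast
  have fg: "integrable lebesgue (\<lambda>x. f' x - g x)" using f'i g by auto
  have main: "(\<integral>x. norm (indicat_real K x *\<^sub>R (mollify (\<rho> n) f x - f x)) \<partial>lebesgue) < e" if n: "n \<ge> N" for n
  proof -
    have nd: "1 / real (Suc n) < d"
    proof -
      have "1 / real (Suc n) \<le> 1 / real (Suc N)" using n by (intro divide_left_mono) auto
      with N show ?thesis by linarith
    qed
    have n1: "1 / real (Suc n) \<le> 1" by simp
    have mc: "continuous_on UNIV (mollify (\<rho> n) (\<lambda>x. f' x - g x))"
      by (rule mollify_continuous[OF \<rho>(1) \<rho>(4) integrable_loc_integrable[OF fg]])
    have nni: "(\<integral>\<^sup>+x. ennreal (norm (mollify (\<rho> n) (\<lambda>x. f' x - g x) x)) \<partial>lebesgue) \<le> (\<integral>\<^sup>+x. ennreal (norm (f' x - g x)) \<partial>lebesgue)"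
      by (rule mollify_nn_integral_le[OF \<rho>(1,2,3) fg])
    also have eq: "\<dots> = ennreal (\<integral>x. norm (f' x - g x) \<partial>lebesgue)"
      using fg by (intro nn_integral_eq_integral) auto
    also have "\<dots> < \<infinity>" by simp
    finally have mi: "integrable lebesgue (mollify (\<rho> n) (\<lambda>x. f' x - g x))"
      using continuous_borel_lebesgue[OF mc] by (simp add: integrable_iff_bounded)
    have m1: "(\<integral>x. norm (mollify (\<rho> n) (\<lambda>x. f' x - g x) x) \<partial>lebesgue) < e/3"
    proof -
      have "ennreal (\<integral>x. norm (mollify (\<rho> n) (\<lambda>x. f' x - g x) x) \<partial>lebesgue) \<le> ennreal (\<integral>x. norm (f' x - g x) \<partial>lebesgue)"
        using nni eq mi by (subst nn_integral_eq_integral[symmetric]) auto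
      then have "(\<integral>x. norm (mollify (\<rho> n) (\<lambda>x. f' x - g x) x) \<partial>lebesgue) \<le> (\<integral>x. norm (f' x - g x) \<partial>lebesgue)"
        by (simp add: ennreal_le_iff)
      with g(3) show ?thesis by simp
    qed
    have pt: "norm (indicat_real K x *\<^sub>R (mollify (\<rho> n) f x - f x)) \<le>
        norm (mollify (\<rho> n) (\<lambda>x. f' x - g x) x) + (indicat_real K x * e' + norm (f' x - g x))" for x
    proof (cases "x \<in> K")
      case True
      then have xr: "norm x \<le> r" by (simp add: K_def)
      have near: "y \<in> cball 0 (r+1)" if "dist x y < 1 / Suc n" for y
      proof -
        have "dist x y < 1" using that n1 by linarith
        then show ?thesis
          using norm_triangle_ineq2[of y x] xr by (simp add: dist_norm norm_minus_commute)
      qed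
      have "mollify (\<rho> n) f x = mollify (\<rho> n) f' x"
        by (rule mollify_cong[OF \<rho>(4)]) (use near in \<open>auto simp: f'_def\<close>)
      moreover have "mollify (\<rho> n) (\<lambda>x. (f' x - g x) + g x) x = mollify (\<rho> n) (\<lambda>x. f' x - g x) x + mollify (\<rho> n) g x"
        unfolding mollify_def scaleR_add_right
        by (intro Bochner_Integration.integral_add mollify_integrable[OF \<rho>(1)[of n] \<rho>(4)[of n]]
            integrable_loc_integrable[OF fg] gl)
      moreover have "norm (mollify (\<rho> n) g x - g x) \<le> e'"
      proof (rule mollify_diff_le[OF \<rho>(1,2,3) \<rho>(4) gl])
        fix y assume y: "dist x y < 1 / real (Suc n)"
        have "dist (g y) (g x) < e'"
          using d(2)[of x y] near[OF y] near[of x] y nd by (simp add: dist_commute)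
        then show "norm (g y - g x) \<le> e'" by (simp add: dist_norm)
      qed
      moreover have "f x = f' x" using xr by (simp add: f'_def)
      ultimately have eq: "mollify (\<rho> n) f x - f x =
          mollify (\<rho> n) (\<lambda>x. f' x - g x) x + ((mollify (\<rho> n) g x - g x) - (f' x - g x))"
        and le: "norm (mollify (\<rho> n) g x - g x) \<le> e'"
        by simp_all
      have "norm (mollify (\<rho> n) f x - f x) \<le>
          norm (mollify (\<rho> n) (\<lambda>x. f' x - g x) x) + (norm (mollify (\<rho> n) g x - g x) + norm (f' x - g x))"
        unfolding eq by (intro order_trans[OF norm_triangle_ineq] add_left_mono norm_triangle_ineq4)
      with le True show ?thesis by simp
    qed simp
    have iK: "integrable lebesgue (\<lambda>x. indicat_real K x * e')"
      using Kl by (intro integrable_mult_left) (auto simp: fmeasurable_def)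
    have "(\<integral>x. norm (indicat_real K x *\<^sub>R (mollify (\<rho> n) f x - f x)) \<partial>lebesgue) \<le>
      (\<integral>x. norm (mollify (\<rho> n) (\<lambda>x. f' x - g x) x) + (indicat_real K x * e' + norm (f' x - g x)) \<partial>lebesgue)"
      by (rule integral_mono') (use pt mi iK fg e' in auto)
    also have "\<dots> = (\<integral>x. norm (mollify (\<rho> n) (\<lambda>x. f' x - g x) x) \<partial>lebesgue) +
       (measure lebesgue K * e' + (\<integral>x. norm (f' x - g x) \<partial>lebesgue))"
      using mi iK fg Kl by (subst Bochner_Integration.integral_add; (subst Bochner_Integration.integral_add)?) auto
    also have "\<dots> < e/3 + (e/3 + e/3)"
    proof -
      have "t * (e / (3 * (t + 1))) \<le> e / 3" if "t \<ge> 0" for t :: real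
        using that e by (simp add: divide_simps)
      from this[of "measure lebesgue K"] have "measure lebesgue K * e' \<le> e / 3" by (simp add: e'_def)
      then show ?thesis using m1 g(3) by linarith
    qed
    finally show ?thesis by simp
  qed
  have "(\<integral>x. norm (indicat_real K x *\<^sub>R (mollify (\<rho> n) f x - f x)) \<partial>lebesgue) \<ge> 0" for n
    by (intro integral_nonneg_AE) auto
  with main show "\<exists>no. \<forall>n\<ge>no. norm ((\<integral>x. norm (indicat_real (cball 0 r) x *\<^sub>R (mollify (\<rho> n) f x - f x)) \<partial>lebesgue) - 0) < e"
    unfolding K_def by (auto intro!: exI[of _ N])
qed

text \<open>The majorants \<open>b n\<close> vary but converge in L1 to \<open>B\<close>. Truncating
  \<open>s n\<close> to the range between \<open>- B\<close> and \<open>B\<close> gives a sequence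
  with the fixed majorant \<open>B\<close>, and the truncation changes \<open>s n\<close> by at most
  \<open>\<bar>b n x - B x\<bar>\<close>.\<close>

lemma dominated_convergence_L1:
  fixes f :: "'a \<Rightarrow> real" and s :: "nat \<Rightarrow> 'a \<Rightarrow> real"
  assumes [measurable]: "f \<in> borel_measurable M" "\<And>n. s n \<in> borel_measurable M"
    and B: "integrable M B" and Bn: "\<And>n. integrable M (b n)"
    and bB: "(\<lambda>n. \<integral>x. \<bar>b n x - B x\<bar> \<partial>M) \<longlonglongrightarrow> 0"
    and lim: "AE x in M. (\<lambda>n. s n x) \<longlonglongrightarrow> f x"
    and le: "AE x in M. \<bar>f x\<bar> \<le> B x" and len: "\<And>n. AE x in M. \<bar>s n x\<bar> \<le> b n x"
  shows "integrable M f" "\<And>n. integrable M (s n)" "(\<lambda>n. \<integral>x. s n x \<partial>M) \<longlonglongrightarrow> (\<integral>x. f x \<partial>M)"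
proof -
  show fi: "integrable M f"
    by (rule Bochner_Integration.integrable_bound[OF B]) (use le in auto)
  show si: "integrable M (s n)" for n
    by (rule Bochner_Integration.integrable_bound[OF Bn[of n]]) (use len[of n] in auto)
  have [measurable]: "B \<in> borel_measurable M" using B by auto
  define c where "c n x = max (- B x) (min (B x) (s n x))" for n x
  have cm [measurable]: "c n \<in> borel_measurable M" for n unfolding c_def by measurable
  have c_le: "AE x in M. norm (c n x) \<le> B x" for n
    using le by eventually_elim (auto simp: c_def)
  have cl: "(\<lambda>n. \<integral>x. c n x \<partial>M) \<longlonglongrightarrow> (\<integral>x. f x \<partial>M)"
  proof (rule integral_dominated_convergence[OF _ _ B])
    show "AE x in M. (\<lambda>n. c n x) \<longlonglongrightarrow> f x"
      using lim le
    proof eventually_elim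
      case (elim x)
      have "(\<lambda>n. c n x) \<longlonglongrightarrow> max (- B x) (min (B x) (f x))"
        unfolding c_def by (intro tendsto_intros elim)
      moreover have "max (- B x) (min (B x) (f x)) = f x" using elim(2) by auto
      ultimately show ?case by simp
    qed
  qed (use c_le in auto)
  have ci: "integrable M (c n)" for n
    by (rule Bochner_Integration.integrable_bound[OF B]) (use c_le[of n] in auto)
  have "(\<lambda>n. (\<integral>x. s n x \<partial>M) - (\<integral>x. c n x \<partial>M)) \<longlonglongrightarrow> 0"
  proof (rule Lim_null_comparison[OF _ bB], rule always_eventually, rule allI)
    fix n
    have "norm ((\<integral>x. s n x \<partial>M) - (\<integral>x. c n x \<partial>M)) = norm (\<integral>x. s n x - c n x \<partial>M)"
      using si ci by simp
    also have "\<dots> \<le> (\<integral>x. norm (s n x - c n x) \<partial>M)" by (rule integral_norm_bound)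
    also have "\<dots> \<le> (\<integral>x. \<bar>b n x - B x\<bar> \<partial>M)"
    proof (rule integral_mono_AE)
      show "AE x in M. norm (s n x - c n x) \<le> \<bar>b n x - B x\<bar>"
        using len[of n] le by eventually_elim (auto simp: c_def)
    qed (use si ci B Bn in auto)
    finally show "norm ((\<integral>x. s n x \<partial>M) - (\<integral>x. c n x \<partial>M)) \<le> (\<integral>x. \<bar>b n x - B x\<bar> \<partial>M)" .
  qed
  from tendsto_add[OF this cl] show "(\<lambda>n. \<integral>x. s n x \<partial>M) \<longlonglongrightarrow> (\<integral>x. f x \<partial>M)" by simp
qed

section \<open>Composite test functions\<close>

text \<open>Young's inequality with its two denominators, both larger than 1, dropped.\<close>

lemma young_powr:
  fixes a b p :: real
  assumes "p > 1" "a \<ge> 0" "b \<ge> 0"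
  shows "a * b \<le> a powr (p / (p - 1)) + b powr p"
proof -
  have q: "p / (p - 1) > 1" "1 / (p / (p - 1)) + 1 / p = 1" using assms(1) by (simp_all add: field_simps)
  have "a * b \<le> a powr (p / (p - 1)) / (p / (p - 1)) + b powr p / p"
    by (rule Youngs_inequality) (use assms q in auto)
  also have "\<dots> \<le> a powr (p / (p - 1)) / 1 + b powr p / 1"
    using assms(1) q by (intro add_mono divide_left_mono) auto
  finally show ?thesis by simp
qed

text \<open>Young's inequality is applied to \<open>a\<close> and \<open>norm (G y)\<close> under
  the kernel, before integrating. As the kernel has mass 1, the constant term survives unchanged;
  the other term is itself a mollification, whose local L1 convergence is known.\<close>

lemma mollify_young:
  fixes G :: "'a::euclidean_space \<Rightarrow> 'a"
  assumes p: "p > 1" and G: "Lp_loc_vec p G" and a: "a \<ge> 0"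
    and c: "continuous_on UNIV \<rho>" and nn: "\<And>x. \<rho> x \<ge> 0" and one: "(\<integral>\<^sup>+x. ennreal (\<rho> x) \<partial>lborel) = 1"
    and z: "\<And>x. norm x \<ge> d \<Longrightarrow> \<rho> x = 0"
  shows "a * norm (mollify \<rho> G x) \<le> a powr (p / (p - 1)) + mollify \<rho> (\<lambda>y. norm (G y) powr p) x"
proof -
  have i1: "integrable lebesgue (\<lambda>y. \<rho> (x - y) *\<^sub>R G y)"
    using p by (intro mollify_integrable[OF c z] Lp_loc_vec_loc_integrable[OF _ G]) auto
  have i2: "integrable lebesgue (\<lambda>y. \<rho> (x - y) *\<^sub>R norm (G y) powr p)"
    by (intro mollify_integrable[OF c z] loc_integrable_norm_powr[OF G])
  have i3: "integrable lebesgue (\<lambda>y. \<rho> (x - y) *\<^sub>R a powr (p / (p - 1)))" by (rule mollify_const(2)[OF c nn one])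
  have "a * norm (mollify \<rho> G x) \<le> a * (\<integral>y. norm (\<rho> (x - y) *\<^sub>R G y) \<partial>lebesgue)"
    unfolding mollify_def using a by (intro mult_left_mono integral_norm_bound)
  also have "\<dots> = (\<integral>y. a * norm (\<rho> (x - y) *\<^sub>R G y) \<partial>lebesgue)" by simp
  also have "\<dots> \<le> (\<integral>y. \<rho> (x - y) *\<^sub>R a powr (p / (p - 1)) + \<rho> (x - y) *\<^sub>R norm (G y) powr p \<partial>lebesgue)"
  proof (rule integral_mono)
    fix y
    have "\<rho> (x - y) * (a * norm (G y)) \<le> \<rho> (x - y) * (a powr (p / (p - 1)) + norm (G y) powr p)"
      using young_powr[OF p a, of "norm (G y)"] nn by (intro mult_left_mono) auto
    then show "a * norm (\<rho> (x - y) *\<^sub>R G y) \<le> \<rho> (x - y) *\<^sub>R a powr (p / (p - 1)) + \<rho> (x - y) *\<^sub>R norm (G y) powr p"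
      using nn[of "x - y"] by (simp add: algebra_simps)
  qed (use i1[THEN integrable_norm] i2 i3 in auto)
  also have "\<dots> = a powr (p / (p - 1)) + mollify \<rho> (\<lambda>y. norm (G y) powr p) x"
    using i2 i3 mollify_const(1)[OF c nn one, of "a powr (p / (p - 1))" x]
    by (simp add: mollify_def)
  finally show ?thesis .
qed

lemma mollify_nonneg:
  fixes v :: "'a::euclidean_space \<Rightarrow> real"
  assumes "\<And>x. \<rho> x \<ge> 0" "AE x in lebesgue. v x \<ge> 0"
  shows "mollify \<rho> v x \<ge> 0"
  unfolding mollify_def
  by (rule integral_nonneg_AE) (use assms(2) in eventually_elim, use assms(1) in simp)

text \<open>\<open>h\<close> is controlled only on nonnegative arguments, so the chain rule needs
  \<open>v\<close> nonnegative at every point. Mollified functions satisfy this even when the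
  original function is nonnegative only a.e.\<close>

lemma test_fun_mult_C1:
  fixes v :: "'a::euclidean_space \<Rightarrow> real" and h h' :: "real \<Rightarrow> real"
  assumes t: "test_fun \<eta> D\<eta>" and v: "C1_grad v Dv" "\<And>x. v x \<ge> 0"
    and h: "\<And>t. t \<ge> 0 \<Longrightarrow> (h has_real_derivative h' t) (at t)" "\<And>t. t \<ge> 0 \<Longrightarrow> isCont h' t"
  shows "test_fun (\<lambda>x. \<eta> x * h (v x)) (\<lambda>x. h (v x) *\<^sub>R D\<eta> x + (\<eta> x * h' (v x)) *\<^sub>R Dv x)"
    and "continuous_on UNIV (\<lambda>x. h (v x))" "continuous_on UNIV (\<lambda>x. h' (v x))"
proof -
  obtain r where r: "\<And>x. norm x \<ge> r \<Longrightarrow> \<eta> x = 0" using test_fun_support[OF t] by metis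
  have vd: "(v has_derivative (\<lambda>k. Dv x \<bullet> k)) (at x)" and ed: "(\<eta> has_derivative (\<lambda>k. D\<eta> x \<bullet> k)) (at x)" for x
    using t v(1) by (auto simp: test_fun_def C1_grad_def)
  have cont: "continuous_on UNIV \<eta>" "continuous_on UNIV D\<eta>" "continuous_on UNIV v" "continuous_on UNIV Dv"
    using t v(1) C1_grad_continuous by (auto simp: test_fun_def C1_grad_def)
  have hd: "((\<lambda>x. h (v x)) has_derivative (\<lambda>k. h' (v x) * (Dv x \<bullet> k))) (at x)" for x
    using has_derivative_compose[OF vd[of x] h(1)[OF v(2)[of x], unfolded has_field_derivative_def]] .
  have vc: "isCont v x" for x using cont(3) by (simp add: continuous_on_eq_continuous_at)
  show c1: "continuous_on UNIV (\<lambda>x. h (v x))"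
    using hd has_derivative_continuous by (blast intro: continuous_at_imp_continuous_on)
  show c2: "continuous_on UNIV (\<lambda>x. h' (v x))"
    by (intro continuous_at_imp_continuous_on ballI isCont_o2[OF vc] h(2) v(2))
  show "test_fun (\<lambda>x. \<eta> x * h (v x)) (\<lambda>x. h (v x) *\<^sub>R D\<eta> x + (\<eta> x * h' (v x)) *\<^sub>R Dv x)"
  proof (rule test_funI[of _ _ r])
    have "((\<lambda>x. \<eta> x * h (v x)) has_derivative (\<lambda>k. (h (v x) *\<^sub>R D\<eta> x + (\<eta> x * h' (v x)) *\<^sub>R Dv x) \<bullet> k)) (at x)" for x
      by (rule has_derivative_eq_rhs[OF has_derivative_mult[OF ed hd]]) (simp add: fun_eq_iff inner_add_left mult_ac)
    moreover have "continuous_on UNIV (\<lambda>x. h (v x) *\<^sub>R D\<eta> x + (\<eta> x * h' (v x)) *\<^sub>R Dv x)"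
      by (intro continuous_intros c1 c2 cont)
    ultimately show "C1_grad (\<lambda>x. \<eta> x * h (v x)) (\<lambda>x. h (v x) *\<^sub>R D\<eta> x + (\<eta> x * h' (v x)) *\<^sub>R Dv x)"
      by (simp add: C1_grad_def)
  qed (use r in simp)
qed

text \<open>The two L1 errors are added before a subsequence is extracted, so one subsequence serves
  the function and its gradient.\<close>

lemma mollify_AE_subseq:
  fixes v :: "'a::euclidean_space \<Rightarrow> real" and G :: "'a \<Rightarrow> 'a"
  assumes m: "mollifier_seq \<rho> D\<rho>" and v: "loc_integrable v" and G: "loc_integrable G"
  obtains r where "strict_mono r"
    "AE x in lebesgue. x \<in> cball 0 R \<longrightarrow> (\<lambda>n. mollify (\<rho> (r n)) v x) \<longlonglongrightarrow> v x \<and> (\<lambda>n. mollify (\<rho> (r n)) G x) \<longlonglongrightarrow> G x"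
proof -
  define K where "K = cball (0::'a) R"
  have cK: "compact K" by (simp add: K_def)
  have int: "integrable lebesgue (\<lambda>x. indicator K x *\<^sub>R (mollify (\<rho> n) f x - f x))"
    if "loc_integrable f" for n and f :: "'a \<Rightarrow> 'c::euclidean_space"
  proof -
    have "continuous_on UNIV (mollify (\<rho> n) f)"
      using m by (intro mollify_continuous[where r="1 / Suc n"] that)
         (auto simp: mollifier_seq_def test_fun_def intro: C1_grad_continuous)
    from loc_integrableD(1)[OF loc_integrable_continuous[OF this] cK] loc_integrableD(1)[OF that cK]
    show ?thesis by (simp add: scaleR_diff_right)
  qed
  define u where "u n x = norm (indicat_real K x *\<^sub>R (mollify (\<rho> n) v x - v x)) + norm (indicat_real K x *\<^sub>R (mollify (\<rho> n) G x - G x))" for n x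
  have ui: "integrable lebesgue (u n)" for n
    unfolding u_def using int[OF v, of n] int[OF G, of n] by (intro Bochner_Integration.integrable_add integrable_norm)
  have "(\<lambda>n. \<integral>x. norm (u n x) \<partial>lebesgue) \<longlonglongrightarrow> 0"
  proof -
    have "(\<lambda>n. (\<integral>x. norm (indicat_real K x *\<^sub>R (mollify (\<rho> n) v x - v x)) \<partial>lebesgue) +
          (\<integral>x. norm (indicat_real K x *\<^sub>R (mollify (\<rho> n) G x - G x)) \<partial>lebesgue)) \<longlonglongrightarrow> 0 + 0"
      unfolding K_def by (intro tendsto_add mollify_tendsto_L1_loc[OF m] v G)
    moreover have "(\<integral>x. norm (u n x) \<partial>lebesgue) = (\<integral>x. norm (indicat_real K x *\<^sub>R (mollify (\<rho> n) v x - v x)) \<partial>lebesgue) +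
          (\<integral>x. norm (indicat_real K x *\<^sub>R (mollify (\<rho> n) G x - G x)) \<partial>lebesgue)" for n
    proof -
      have "norm (u n x) = u n x" for x by (simp add: u_def)
      then have "(\<integral>x. norm (u n x) \<partial>lebesgue) = (\<integral>x. u n x \<partial>lebesgue)" by presburger
      also have "\<dots> = (\<integral>x. norm (indicat_real K x *\<^sub>R (mollify (\<rho> n) v x - v x)) \<partial>lebesgue) +
          (\<integral>x. norm (indicat_real K x *\<^sub>R (mollify (\<rho> n) G x - G x)) \<partial>lebesgue)"
        unfolding u_def using int[OF v, of n] int[OF G, of n] by (intro Bochner_Integration.integral_add integrable_norm)
      finally show ?thesis .
    qed
    ultimately show ?thesis by simp
  qed
  from tendsto_L1_AE_subseq[OF ui this]
  obtain r where r: "strict_mono r" "AE x in lebesgue. (\<lambda>n. u (r n) x) \<longlonglongrightarrow> 0" by blast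
  have "AE x in lebesgue. x \<in> cball 0 R \<longrightarrow> (\<lambda>n. mollify (\<rho> (r n)) v x) \<longlonglongrightarrow> v x \<and> (\<lambda>n. mollify (\<rho> (r n)) G x) \<longlonglongrightarrow> G x"
    using r(2)
  proof eventually_elim
    case (elim x)
    show ?case
    proof (intro impI conjI)
      assume x: "x \<in> cball 0 R"
      have "(\<lambda>n. mollify (\<rho> (r n)) v x - v x) \<longlonglongrightarrow> 0"
        by (rule Lim_null_comparison[OF _ elim]) (use x in \<open>auto simp: u_def K_def\<close>)
      then show "(\<lambda>n. mollify (\<rho> (r n)) v x) \<longlonglongrightarrow> v x" by (rule LIM_zero_cancel)
      have "(\<lambda>n. mollify (\<rho> (r n)) G x - G x) \<longlonglongrightarrow> 0"
        by (rule Lim_null_comparison[OF _ elim]) (use x in \<open>auto simp: u_def K_def\<close>)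
      then show "(\<lambda>n. mollify (\<rho> (r n)) G x) \<longlonglongrightarrow> G x" by (rule LIM_zero_cancel)
    qed
  qed
  with r(1) that show ?thesis by blast
qed

text \<open>Convergence of $\nabla v_n$ in $L^p$ is not needed: by Young's inequality
  $|F \cdot \nabla v_n|$ is dominated by $|F|^{p'}$ plus the mollification of $|G|^p$, which converges in $L^1$.\<close>

lemma weak_ineq_composite:
  fixes v w :: "'a::euclidean_space \<Rightarrow> real" and F G :: "'a \<Rightarrow> 'a" and h h' :: "real \<Rightarrow> real"
  assumes p: "p > 1"
    and v: "Lp_loc p v" "weak_grad v G" "Lp_loc_vec p G" "AE x in lebesgue. v x \<ge> 0"
    and F: "Lp_loc_vec (p / (p - 1)) F" and w: "loc_integrable w"
    and ineq: "\<And>\<phi> D\<phi>. test_fun \<phi> D\<phi> \<Longrightarrow> (\<And>x. \<phi> x \<ge> 0) \<Longrightarrow>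
      (\<integral>x. w x * \<phi> x \<partial>lebesgue) \<le> - (\<integral>x. F x \<bullet> D\<phi> x \<partial>lebesgue)"
    and h: "\<And>t. t \<ge> 0 \<Longrightarrow> (h has_real_derivative h' t) (at t)" "\<And>t. t \<ge> 0 \<Longrightarrow> isCont h' t"
      "\<And>t. t \<ge> 0 \<Longrightarrow> 0 \<le> h t" "\<And>t. t \<ge> 0 \<Longrightarrow> h t \<le> H" "\<And>t. t \<ge> 0 \<Longrightarrow> \<bar>h' t\<bar> \<le> H"
      "h \<in> borel_measurable borel" "h' \<in> borel_measurable borel"
    and \<eta>: "test_fun \<eta> D\<eta>" "\<And>x. \<eta> x \<ge> 0"
  shows "integrable lebesgue (\<lambda>x. w x * (\<eta> x * h (v x)))"
    and "integrable lebesgue (\<lambda>x. (F x \<bullet> G x) * (\<eta> x * h' (v x)))"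
    and "integrable lebesgue (\<lambda>x. (F x \<bullet> D\<eta> x) * h (v x))"
    and "(\<integral>x. w x * (\<eta> x * h (v x)) \<partial>lebesgue) + (\<integral>x. (F x \<bullet> G x) * (\<eta> x * h' (v x)) \<partial>lebesgue)
       \<le> - (\<integral>x. (F x \<bullet> D\<eta> x) * h (v x) \<partial>lebesgue)"
proof -
  obtain \<rho> :: "nat \<Rightarrow> 'a \<Rightarrow> real" and D\<rho> where m: "mollifier_seq \<rho> D\<rho>"
    using mollifier_seq_exists by blast
  have \<rho>: "test_fun (\<rho> n) (D\<rho> n)" "continuous_on UNIV (\<rho> n)" "\<And>x. \<rho> n x \<ge> 0" "(\<integral>\<^sup>+x. ennreal (\<rho> n x) \<partial>lborel) = 1"
    "\<And>x. norm x \<ge> 1 / Suc n \<Longrightarrow> \<rho> n x = 0" for n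
    using m by (auto simp: mollifier_seq_def test_fun_def intro: C1_grad_continuous)
  have vl: "loc_integrable v" and Gl: "loc_integrable G"
    using p v Lp_loc_loc_integrable Lp_loc_vec_loc_integrable by (metis less_imp_le)+
  have "p / (p - 1) \<ge> 1" using p by simp
  with F have Fl: "loc_integrable F" using Lp_loc_vec_loc_integrable by blast
  have [measurable]: "v \<in> borel_measurable lebesgue" "G \<in> borel_measurable lebesgue"
      "F \<in> borel_measurable lebesgue" "w \<in> borel_measurable lebesgue"
      "h \<in> borel_measurable borel" "h' \<in> borel_measurable borel"
    using vl Gl Fl w h by (auto simp: loc_integrable_def)
  obtain R where R: "\<And>x. norm x \<ge> R \<Longrightarrow> \<eta> x = 0" "\<And>x. norm x \<ge> R \<Longrightarrow> D\<eta> x = 0"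
    using test_fun_support[OF \<eta>(1)] by metis
  have ec: "continuous_on UNIV \<eta>" "continuous_on UNIV D\<eta>"
    using \<eta>(1) C1_grad_continuous by (auto simp: test_fun_def C1_grad_def)
  have [measurable]: "\<eta> \<in> borel_measurable lebesgue" "D\<eta> \<in> borel_measurable lebesgue"
    using ec by (auto intro: continuous_borel_lebesgue)
  obtain E where E: "E > 0" "\<And>x. norm (\<eta> x) \<le> E" using continuous_vanishing_bounded[OF ec(1) R(1)] by blast
  obtain E' where E': "E' > 0" "\<And>x. norm (D\<eta> x) \<le> E'" using continuous_vanishing_bounded[OF ec(2) R(2)] by blast
  define K where "K = cball (0::'a) R"
  \<comment> \<open>Every integrand below contains \<eta> or its gradient, so a.e. convergence of
    the mollified functions is needed on \<open>K\<close> only.\<close>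
  have Kout: "\<eta> x = 0" "D\<eta> x = 0" if "x \<notin> K" for x using R[of x] that by (auto simp: K_def)
  have H0: "H \<ge> 0" using h(3,4)[of 0] by linarith
  obtain r where r: "strict_mono r"
    "AE x in lebesgue. x \<in> cball 0 R \<longrightarrow> (\<lambda>n. mollify (\<rho> (r n)) v x) \<longlonglongrightarrow> v x \<and> (\<lambda>n. mollify (\<rho> (r n)) G x) \<longlonglongrightarrow> G x"
    using mollify_AE_subseq[OF m vl Gl] by blast
  define vn where "vn n = mollify (\<rho> (r n)) v" for n
  define Gn where "Gn n = mollify (\<rho> (r n)) G" for n
  have conv: "AE x in lebesgue. x \<in> K \<longrightarrow> (\<lambda>n. vn n x) \<longlonglongrightarrow> v x \<and> (\<lambda>n. Gn n x) \<longlonglongrightarrow> G x"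
    using r(2) by (simp add: vn_def Gn_def K_def)
  have vn0: "vn n x \<ge> 0" for n x unfolding vn_def by (rule mollify_nonneg[OF \<rho>(3) v(4)])
  have C1: "C1_grad (vn n) (Gn n)" for n
    unfolding vn_def Gn_def by (rule mollify_C1_grad[OF vl Gl v(2) \<rho>(1)])
  have Gc: "continuous_on UNIV (Gn n)" for n using C1[of n] by (simp add: C1_grad_def)
  note comp = test_fun_mult_C1[OF \<eta>(1) C1 vn0 h(1,2)]
  have [measurable]: "vn n \<in> borel_measurable lebesgue" "Gn n \<in> borel_measurable lebesgue" for n
    using C1_grad_continuous[OF C1] Gc by (auto intro: continuous_borel_lebesgue)
  have hv: "0 \<le> h (vn n x)" "h (vn n x) \<le> H" "\<bar>h' (vn n x)\<bar> \<le> H" for n x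
    using h(3,4,5)[OF vn0] by auto
  have i3: "integrable lebesgue (\<lambda>x. F x \<bullet> D\<eta> x)"
    by (rule loc_integrable_inner[OF Fl, of D\<eta> E' 0 R]) (use E' R in auto)
  have i1: "integrable lebesgue (\<lambda>x. \<eta> x * w x)"
    using loc_integrable_bounded_scale[OF w, of \<eta> E 0 R] E(2) R by auto
  have hlim: "(\<lambda>n. h (vn n x)) \<longlonglongrightarrow> h (v x)" "(\<lambda>n. h' (vn n x)) \<longlonglongrightarrow> h' (v x)"
    if "(\<lambda>n. vn n x) \<longlonglongrightarrow> v x" "v x \<ge> 0" for x
    using isCont_tendsto_compose[OF DERIV_isCont[OF h(1)] that(1)] isCont_tendsto_compose[OF h(2) that(1)] that(2)
    by auto

  have T1: "integrable lebesgue (\<lambda>x. w x * (\<eta> x * h (v x)))"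
     "\<And>n. integrable lebesgue (\<lambda>x. w x * (\<eta> x * h (vn n x)))"
     "(\<lambda>n. \<integral>x. w x * (\<eta> x * h (vn n x)) \<partial>lebesgue) \<longlonglongrightarrow> (\<integral>x. w x * (\<eta> x * h (v x)) \<partial>lebesgue)"
  proof -
    have wi: "integrable lebesgue (\<lambda>x. norm (\<eta> x * w x) * H)"
      using i1 by (intro integrable_mult_left integrable_norm)
    have lim: "AE x in lebesgue. (\<lambda>n. w x * (\<eta> x * h (vn n x))) \<longlonglongrightarrow> w x * (\<eta> x * h (v x))"
      using conv v(4)
    proof eventually_elim
      case (elim x)
      then show ?case using Kout[of x] by (cases "x \<in> K") (auto intro!: tendsto_intros hlim)
    qed
    have bd: "norm (w x * (\<eta> x * h (vn n x))) \<le> norm (\<eta> x * w x) * H" for n x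
    proof -
      have "norm (w x * (\<eta> x * h (vn n x))) = norm (\<eta> x * w x) * h (vn n x)"
        using hv(1)[of n x] by (simp add: abs_mult mult_ac)
      also have "\<dots> \<le> norm (\<eta> x * w x) * H" using hv(2) by (intro mult_left_mono) auto
      finally show ?thesis .
    qed
    have ms: "(\<lambda>x. w x * (\<eta> x * h (v x))) \<in> borel_measurable lebesgue"
      "\<And>n. (\<lambda>x. w x * (\<eta> x * h (vn n x))) \<in> borel_measurable lebesgue" by measurable
    note dct = integrable_dominated_convergence[OF ms(1) ms(2) wi lim AE_I2[OF bd]]
      integrable_dominated_convergence2[OF ms(1) ms(2) wi lim AE_I2[OF bd]]
      integral_dominated_convergence[OF ms(1) ms(2) wi lim AE_I2[OF bd]]
    show "integrable lebesgue (\<lambda>x. w x * (\<eta> x * h (v x)))" by (rule dct(1))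
    show "integrable lebesgue (\<lambda>x. w x * (\<eta> x * h (vn n x)))" for n by (rule dct(2))
    show "(\<lambda>n. \<integral>x. w x * (\<eta> x * h (vn n x)) \<partial>lebesgue) \<longlonglongrightarrow> (\<integral>x. w x * (\<eta> x * h (v x)) \<partial>lebesgue)"
      by (rule dct(3))
  qed

  have T3: "integrable lebesgue (\<lambda>x. (F x \<bullet> D\<eta> x) * h (v x))"
     "\<And>n. integrable lebesgue (\<lambda>x. (F x \<bullet> D\<eta> x) * h (vn n x))"
     "(\<lambda>n. \<integral>x. (F x \<bullet> D\<eta> x) * h (vn n x) \<partial>lebesgue) \<longlonglongrightarrow> (\<integral>x. (F x \<bullet> D\<eta> x) * h (v x) \<partial>lebesgue)"
  proof -
    have wi: "integrable lebesgue (\<lambda>x. norm (F x \<bullet> D\<eta> x) * H)"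
      using i3 by (intro integrable_mult_left integrable_norm)
    have lim: "AE x in lebesgue. (\<lambda>n. (F x \<bullet> D\<eta> x) * h (vn n x)) \<longlonglongrightarrow> (F x \<bullet> D\<eta> x) * h (v x)"
      using conv v(4)
    proof eventually_elim
      case (elim x)
      then show ?case using Kout[of x] by (cases "x \<in> K") (auto intro!: tendsto_intros hlim)
    qed
    have bd: "norm ((F x \<bullet> D\<eta> x) * h (vn n x)) \<le> norm (F x \<bullet> D\<eta> x) * H" for n x
      using hv(1,2)[of n x] by (auto simp: abs_mult intro!: mult_left_mono)
    have ms: "(\<lambda>x. (F x \<bullet> D\<eta> x) * h (v x)) \<in> borel_measurable lebesgue"
      "\<And>n. (\<lambda>x. (F x \<bullet> D\<eta> x) * h (vn n x)) \<in> borel_measurable lebesgue" by measurable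
    note dct = integrable_dominated_convergence[OF ms(1) ms(2) wi lim AE_I2[OF bd]]
      integrable_dominated_convergence2[OF ms(1) ms(2) wi lim AE_I2[OF bd]]
      integral_dominated_convergence[OF ms(1) ms(2) wi lim AE_I2[OF bd]]
    show "integrable lebesgue (\<lambda>x. (F x \<bullet> D\<eta> x) * h (v x))" by (rule dct(1))
    show "integrable lebesgue (\<lambda>x. (F x \<bullet> D\<eta> x) * h (vn n x))" for n by (rule dct(2))
    show "(\<lambda>n. \<integral>x. (F x \<bullet> D\<eta> x) * h (vn n x) \<partial>lebesgue) \<longlonglongrightarrow> (\<integral>x. (F x \<bullet> D\<eta> x) * h (v x) \<partial>lebesgue)"
      by (rule dct(3))
  qed

  define Fp where "Fp x = norm (F x) powr (p / (p - 1))" for x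
  define Gp where "Gp x = norm (G x) powr p" for x
  have Fpl: "loc_integrable Fp" and Gpl: "loc_integrable Gp"
    unfolding Fp_def Gp_def by (intro loc_integrable_norm_powr F v(3))+
  define C where "C = E * H"
  have C0: "C \<ge> 0" using E H0 by (simp add: C_def)
  \<comment> \<open>The term with the gradient of \<open>vn n\<close> gets a majorant that changes
    with \<open>n\<close>; these majorants converge in L1 to \<open>B\<close>, so
    \<open>dominated_convergence_L1\<close> takes the place of the usual theorem.\<close>
  define b where "b n x = C * (indicat_real K x * (Fp x + mollify (\<rho> (r n)) Gp x))" for n x
  define B where "B x = C * (indicat_real K x * (Fp x + Gp x))" for x
  have cK: "compact K" by (simp add: K_def)
  have ml: "loc_integrable (mollify (\<rho> n) Gp)" for n
    by (intro loc_integrable_continuous mollify_continuous[OF \<rho>(2) \<rho>(5) Gpl])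
  have bi: "integrable lebesgue (b n)" for n
    using loc_integrableD(1)[OF Fpl cK] loc_integrableD(1)[OF ml[of "r n"] cK]
    unfolding b_def by (intro integrable_mult_right) (simp add: distrib_left)
  have Bi: "integrable lebesgue B"
    using loc_integrableD(1)[OF Fpl cK] loc_integrableD(1)[OF Gpl cK]
    unfolding B_def by (intro integrable_mult_right) (simp add: distrib_left)
  have bB: "(\<lambda>n. \<integral>x. \<bar>b n x - B x\<bar> \<partial>lebesgue) \<longlonglongrightarrow> 0"
  proof -
    have "(\<lambda>n. C * (\<integral>x. norm (indicat_real K x *\<^sub>R (mollify (\<rho> (r n)) Gp x - Gp x)) \<partial>lebesgue)) \<longlonglongrightarrow> C * 0"
      using LIMSEQ_subseq_LIMSEQ[OF mollify_tendsto_L1_loc[OF m Gpl, of R] r(1)]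
      by (intro tendsto_mult_left) (simp add: o_def K_def)
    moreover have "\<bar>b n x - B x\<bar> = C * norm (indicat_real K x *\<^sub>R (mollify (\<rho> (r n)) Gp x - Gp x))" for n x
      using C0 by (simp add: b_def B_def abs_mult flip: right_diff_distrib)
    ultimately show ?thesis by simp
  qed
  have bound: "\<bar>(F x \<bullet> g) * (\<eta> x * t)\<bar> \<le> C * (indicat_real K x * (Fp x + y))"
    if "norm (F x) * norm g \<le> Fp x + y" "\<bar>t\<bar> \<le> H" for x g t y
  proof (cases "x \<in> K")
    case True
    have "\<bar>(F x \<bullet> g) * (\<eta> x * t)\<bar> = \<bar>F x \<bullet> g\<bar> * (\<bar>\<eta> x\<bar> * \<bar>t\<bar>)" by (simp add: abs_mult)
    also have "\<dots> \<le> (norm (F x) * norm g) * (E * H)"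
      using E(2)[of x] that(2) E(1) by (intro mult_mono Cauchy_Schwarz_ineq2) auto
    also have "\<dots> \<le> (Fp x + y) * (E * H)" using that(1) C0 by (intro mult_right_mono) (auto simp: C_def)
    finally show ?thesis using True by (simp add: C_def mult_ac)
  qed (use Kout[of x] in simp)
  have T2: "integrable lebesgue (\<lambda>x. (F x \<bullet> G x) * (\<eta> x * h' (v x)))"
     "\<And>n. integrable lebesgue (\<lambda>x. (F x \<bullet> Gn n x) * (\<eta> x * h' (vn n x)))"
     "(\<lambda>n. \<integral>x. (F x \<bullet> Gn n x) * (\<eta> x * h' (vn n x)) \<partial>lebesgue) \<longlonglongrightarrow> (\<integral>x. (F x \<bullet> G x) * (\<eta> x * h' (v x)) \<partial>lebesgue)"
  proof -
    have lim: "AE x in lebesgue. (\<lambda>n. (F x \<bullet> Gn n x) * (\<eta> x * h' (vn n x))) \<longlonglongrightarrow> (F x \<bullet> G x) * (\<eta> x * h' (v x))"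
      using conv v(4)
    proof eventually_elim
      case (elim x)
      then show ?case using Kout[of x] by (cases "x \<in> K") (auto intro!: tendsto_intros hlim)
    qed
    have le: "AE x in lebesgue. \<bar>(F x \<bullet> G x) * (\<eta> x * h' (v x))\<bar> \<le> B x"
      using v(4)
    proof eventually_elim
      case (elim x)
      show ?case unfolding B_def
        by (rule bound) (use young_powr[OF p, of "norm (F x)" "norm (G x)"] h(5)[OF elim] in \<open>auto simp: Fp_def Gp_def\<close>)
    qed
    have len: "AE x in lebesgue. \<bar>(F x \<bullet> Gn n x) * (\<eta> x * h' (vn n x))\<bar> \<le> b n x" for n
      unfolding b_def
    proof (intro AE_I2 bound)
      show "norm (F x) * norm (Gn n x) \<le> Fp x + mollify (\<rho> (r n)) Gp x" for x
        unfolding Gn_def Fp_def Gp_def by (rule mollify_young[OF p v(3) norm_ge_zero \<rho>(2,3,4,5)])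
    qed (rule hv)
    have ms: "(\<lambda>x. (F x \<bullet> G x) * (\<eta> x * h' (v x))) \<in> borel_measurable lebesgue"
      "\<And>n. (\<lambda>x. (F x \<bullet> Gn n x) * (\<eta> x * h' (vn n x))) \<in> borel_measurable lebesgue" by measurable
    note dct = dominated_convergence_L1[OF ms(1) ms(2) Bi bi bB lim le len]
    show "integrable lebesgue (\<lambda>x. (F x \<bullet> G x) * (\<eta> x * h' (v x)))" by (rule dct(1))
    show "integrable lebesgue (\<lambda>x. (F x \<bullet> Gn n x) * (\<eta> x * h' (vn n x)))" for n by (rule dct(2))
    show "(\<lambda>n. \<integral>x. (F x \<bullet> Gn n x) * (\<eta> x * h' (vn n x)) \<partial>lebesgue) \<longlonglongrightarrow> (\<integral>x. (F x \<bullet> G x) * (\<eta> x * h' (v x)) \<partial>lebesgue)"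
      by (rule dct(3))
  qed

  \<comment> \<open>For the C1 function \<open>vn n\<close> the composite is a genuine test
    function. The field \<open>F\<close> stays the original one, so
    \<open>F x \<bullet> Gn n x\<close> has no known sign; coercivity becomes available only in the
    limit.\<close>
  have step: "(\<integral>x. w x * (\<eta> x * h (vn n x)) \<partial>lebesgue) + (\<integral>x. (F x \<bullet> Gn n x) * (\<eta> x * h' (vn n x)) \<partial>lebesgue)
     \<le> - (\<integral>x. (F x \<bullet> D\<eta> x) * h (vn n x) \<partial>lebesgue)" for n
  proof -
    have "(\<integral>x. w x * (\<eta> x * h (vn n x)) \<partial>lebesgue)
       \<le> - (\<integral>x. F x \<bullet> (h (vn n x) *\<^sub>R D\<eta> x + (\<eta> x * h' (vn n x)) *\<^sub>R Gn n x) \<partial>lebesgue)"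
      by (rule ineq[OF comp(1)]) (use \<eta>(2) hv in auto)
    also have "(\<integral>x. F x \<bullet> (h (vn n x) *\<^sub>R D\<eta> x + (\<eta> x * h' (vn n x)) *\<^sub>R Gn n x) \<partial>lebesgue)
       = (\<integral>x. (F x \<bullet> D\<eta> x) * h (vn n x) + (F x \<bullet> Gn n x) * (\<eta> x * h' (vn n x)) \<partial>lebesgue)"
      by (simp add: inner_add_right mult_ac)
    also have "\<dots> = (\<integral>x. (F x \<bullet> D\<eta> x) * h (vn n x) \<partial>lebesgue) + (\<integral>x. (F x \<bullet> Gn n x) * (\<eta> x * h' (vn n x)) \<partial>lebesgue)"
      by (intro Bochner_Integration.integral_add T2 T3)
    finally show ?thesis by simp
  qed
  show "integrable lebesgue (\<lambda>x. w x * (\<eta> x * h (v x)))" by (rule T1(1))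
  show "integrable lebesgue (\<lambda>x. (F x \<bullet> G x) * (\<eta> x * h' (v x)))" by (rule T2(1))
  show "integrable lebesgue (\<lambda>x. (F x \<bullet> D\<eta> x) * h (v x))" by (rule T3(1))
  show "(\<integral>x. w x * (\<eta> x * h (v x)) \<partial>lebesgue) + (\<integral>x. (F x \<bullet> G x) * (\<eta> x * h' (v x)) \<partial>lebesgue)
       \<le> - (\<integral>x. (F x \<bullet> D\<eta> x) * h (v x) \<partial>lebesgue)"
    by (rule LIMSEQ_le[OF tendsto_add[OF T1(3) T2(3)] tendsto_minus[OF T3(3)]]) (use step in auto)
qed

section \<open>Local integral estimates\<close>

text \<open>\<open>k\<close> records that the gradient is a nonpositive multiple of \<open>x\<close>
  and vanishes off the annulus, which the radial argument needs. The power of \<Phi> in the last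
  bound is the one that lets Young's inequality absorb the gradient term into an integral weighted
  by \<Phi> itself.\<close>

definition radial_cutoff_fun ::
  "real \<Rightarrow> real \<Rightarrow> real \<Rightarrow> real \<Rightarrow> ('a::euclidean_space \<Rightarrow> real) \<Rightarrow> ('a \<Rightarrow> 'a) \<Rightarrow> ('a \<Rightarrow> real) \<Rightarrow> bool" where
  "radial_cutoff_fun p C a b \<Phi> D\<Phi> k \<longleftrightarrow> test_fun \<Phi> D\<Phi> \<and>
     (\<forall>x. 0 \<le> \<Phi> x \<and> \<Phi> x \<le> 1 \<and> (norm x \<le> a \<longrightarrow> \<Phi> x = 1) \<and> (norm x \<ge> b \<longrightarrow> \<Phi> x = 0) \<and>
        D\<Phi> x = (- k x) *\<^sub>R x \<and> k x \<ge> 0 \<and> (norm x \<le> a \<or> norm x \<ge> b \<longrightarrow> k x = 0) \<and>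
        norm (D\<Phi> x) \<le> C / (b - a) * \<Phi> x powr ((p - 1) / p))"

text \<open>The cutoff is the \<open>m\<close>-th power of the positive part of
  \<open>1 - \<tau>^2\<close>, where \<tau> runs from 0 to 1 as \<open>norm x\<close> grows from
  \<open>a\<close> to \<open>b\<close>. Squaring \<tau> gives a C1 function across the inner sphere;
  the power \<open>m\<close> bounds the gradient by a power of the cutoff itself.\<close>

lemma radial_cutoff:
  fixes p :: real
  assumes p: "p > 1"
  obtains C where "C > 0"
    "\<And>a b. 0 < a \<Longrightarrow> a < b \<Longrightarrow>
      \<exists>(\<Phi> :: 'a::euclidean_space \<Rightarrow> real) D\<Phi> k. radial_cutoff_fun p C a b \<Phi> D\<Phi> k"
proof -
  \<comment> \<open>\<open>m \<ge> 2\<close> gives a C1 function across the outer sphere.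
    \<open>m \<ge> p\<close> gives \<open>m - m / p \<le> m - 1\<close>, so that
    \<open>Z x ^ (m - 1)\<close> is at most \<open>\<Phi> x powr ((p - 1) / p)\<close>.\<close>
  obtain m0 :: nat where m0: "real m0 \<ge> p" using real_arch_simple by blast
  define m where "m = max 2 m0"
  have m: "m \<ge> 2" "real m \<ge> p" using m0 by (auto simp: m_def)
  show ?thesis
  proof (rule that[of "4 * real m"])
    show "4 * real m > 0" using m by simp
    fix a b :: real assume ab: "0 < a" "a < b"
    define d where "d = b^2 - a^2"
    have d: "d > 0" using ab by (simp add: d_def power_strict_mono)
    define \<tau> where "\<tau> x = max 0 ((x \<bullet> x - a^2) / d)" for x :: 'a
    define Z where "Z x = max 0 (1 - \<tau> x ^ 2)" for x :: 'a
    define \<Phi> where "\<Phi> x = Z x ^ m" for x :: 'a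
    define k where "k x = 4 * real m / d * \<tau> x * Z x ^ (m - 1)" for x :: 'a
    have nn: "x \<bullet> x = norm x ^ 2" for x :: 'a by (simp add: dot_square_norm)
    have \<tau>0: "\<tau> x \<ge> 0" for x by (simp add: \<tau>_def)
    have Z0: "0 \<le> Z x" "Z x \<le> 1" for x by (auto simp: Z_def)
    have in_a: "\<tau> x = 0" if "norm x \<le> a" for x
      using that d power_mono[OF that, of 2] by (simp add: \<tau>_def nn divide_nonpos_pos)
    have out_b: "Z x = 0" if "norm x \<ge> b" for x
    proof -
      have "norm x ^ 2 \<ge> b ^ 2" using that ab by (intro power_mono) auto
      then have "(x \<bullet> x - a^2) / d \<ge> 1" using d by (simp add: nn d_def)
      then have "\<tau> x \<ge> 1" by (simp add: \<tau>_def)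
      then have "\<tau> x ^ 2 \<ge> 1" by simp
      then show ?thesis by (simp add: Z_def)
    qed
    have in_b: "Z x > 0" if "norm x < b" for x
    proof -
      have "norm x ^ 2 < b ^ 2" using that by (intro power_strict_mono) auto
      then have "(x \<bullet> x - a^2) / d < 1" using d by (simp add: nn d_def)
      then have "\<tau> x < 1" by (simp add: \<tau>_def)
      then have "\<tau> x ^ 2 < 1" using \<tau>0[of x] by (simp add: power_less_one_iff abs_square_less_1)
      then show ?thesis by (simp add: Z_def)
    qed
    have \<tau>d: "((\<lambda>x. \<tau> x ^ 2) has_derivative (\<lambda>h. 4 / d * \<tau> x * (x \<bullet> h))) (at x)" for x
    proof -
      have "((\<lambda>x. (x \<bullet> x - a^2) / d) has_derivative (\<lambda>h. 2 / d * (x \<bullet> h))) (at x)"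
        using d by (auto intro!: derivative_eq_intros simp: inner_commute)
      from has_derivative_compose[OF this has_real_derivative_max0_power[of 2, unfolded has_field_derivative_def]]
      show ?thesis by (simp add: \<tau>_def mult_ac)
    qed
    have \<Phi>d: "(\<Phi> has_derivative (\<lambda>h. ((- k x) *\<^sub>R x) \<bullet> h)) (at x)" for x
    proof -
      have "((\<lambda>x. 1 - \<tau> x ^ 2) has_derivative (\<lambda>h. - (4 / d * \<tau> x * (x \<bullet> h)))) (at x)"
        using has_derivative_diff[OF has_derivative_const[of 1] \<tau>d[of x]] by simp
      from has_derivative_compose[OF this has_real_derivative_max0_power[of m, unfolded has_field_derivative_def]]
      show ?thesis using m(1) by (simp add: \<Phi>_def[abs_def] Z_def k_def mult_ac)
    qed
    have "continuous_on UNIV (\<lambda>x. (- k x) *\<^sub>R x)"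
      unfolding k_def Z_def \<tau>_def by (intro continuous_intros) (use d in auto)
    with \<Phi>d have "C1_grad \<Phi> (\<lambda>x. (- k x) *\<^sub>R x)" by (simp add: C1_grad_def)
    then have tf: "test_fun \<Phi> (\<lambda>x. (- k x) *\<^sub>R x)"
      by (rule test_funI[of _ _ b]) (use out_b m in \<open>auto simp: \<Phi>_def\<close>)
    have k0: "k x \<ge> 0" for x using d \<tau>0 Z0 by (simp add: k_def)
    have bound: "norm ((- k x) *\<^sub>R x) \<le> 4 * real m / (b - a) * \<Phi> x powr ((p - 1) / p)" for x
    proof (cases "norm x < b")
      case True
      have Zp: "Z x > 0" by (rule in_b[OF True])
      then have "\<tau> x ^ 2 < 1" by (simp add: Z_def less_max_iff_disj)
      then have t1: "\<tau> x \<le> 1" by (simp add: abs_square_less_1)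
      have e: "Z x ^ (m - 1) \<le> \<Phi> x powr ((p - 1) / p)"
      proof -
        have "Z x ^ (m - 1) = Z x powr real (m - 1)" using Zp by (simp add: powr_realpow)
        also have "\<dots> \<le> Z x powr (real m * ((p - 1) / p))"
        proof (rule powr_mono')
          have "real m * ((p - 1) / p) = real m - real m / p" using p by (simp add: field_simps)
          also have "\<dots> \<le> real (m - 1)" using m p by simp
          finally show "real m * ((p - 1) / p) \<le> real (m - 1)" .
        qed (use Z0 in auto)
        also have "\<dots> = \<Phi> x powr ((p - 1) / p)"
          using Zp by (simp add: \<Phi>_def powr_powr flip: powr_realpow)
        finally show ?thesis .
      qed
      have "norm ((- k x) *\<^sub>R x) = k x * norm x" using k0[of x] by simp
      also have "\<dots> = 4 * real m / d * \<tau> x * norm x * Z x ^ (m - 1)" by (simp add: k_def)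
      also have "\<dots> \<le> 4 * real m / (b - a) * Z x ^ (m - 1)"
      proof (rule mult_right_mono)
        \<comment> \<open>The crude bound \<open>norm x \<le> b + a\<close> cancels one factor of
          \<open>d = (b - a) * (b + a)\<close>, leaving a constant independent of the radii.\<close>
        have "4 * real m / d * \<tau> x * norm x \<le> 4 * real m / d * 1 * (b + a)"
          using t1 True ab d \<tau>0 by (intro mult_mono) auto
        also have "\<dots> = 4 * real m / (b - a)"
        proof -
          have "d = (b - a) * (b + a)" by (simp add: d_def power2_eq_square algebra_simps)
          then show ?thesis using ab by (simp add: divide_simps)
        qed
        finally show "4 * real m / d * \<tau> x * norm x \<le> 4 * real m / (b - a)" .
      qed (use Z0 in simp)
      also have "\<dots> \<le> 4 * real m / (b - a) * \<Phi> x powr ((p - 1) / p)"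
        using e ab by (intro mult_left_mono) auto
      finally show ?thesis .
    next
      case False
      then have "k x = 0" using out_b m by (simp add: k_def)
      then show ?thesis using ab by simp
    qed
    show "\<exists>(\<Phi> :: 'a \<Rightarrow> real) D\<Phi> k. radial_cutoff_fun p (4 * real m) a b \<Phi> D\<Phi> k"
      unfolding radial_cutoff_fun_def
    proof (rule exI[of _ \<Phi>], rule exI[of _ "\<lambda>x. (- k x) *\<^sub>R x"], rule exI[of _ k], intro conjI allI)
      show "test_fun \<Phi> (\<lambda>x. (- k x) *\<^sub>R x)" by (rule tf)
      fix x
      show "(- k x) *\<^sub>R x = (- k x) *\<^sub>R x" "k x \<ge> 0"
        "norm ((- k x) *\<^sub>R x) \<le> 4 * real m / (b - a) * \<Phi> x powr ((p - 1) / p)"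
        by (auto simp only: k0 bound)
      show "0 \<le> \<Phi> x" "\<Phi> x \<le> 1" using Z0[of x] by (auto simp: \<Phi>_def power_le_one)
      show "norm x \<le> a \<longrightarrow> \<Phi> x = 1"  using in_a[of x] by (simp add: \<Phi>_def Z_def)
      show "norm x \<ge> b \<longrightarrow> \<Phi> x = 0"  using out_b[of x] m by (simp add: \<Phi>_def)
      show "norm x \<le> a \<or> norm x \<ge> b \<longrightarrow> k x = 0"  using in_a[of x] out_b[of x] m by (auto simp: k_def)
    qed
  qed
qed

text \<open>The pointwise absorption step, with \<open>Y\<close> for the product of field and
  gradient, \<open>f\<close> for the norm of the field, \<open>d\<close> for that of the cutoff
  gradient and \<open>g\<close> for \<open>h' (v x)\<close>. Coercivity bounds \<open>f\<close> by
  \<open>Y / k\<close> to the power (p-1)/p; the factors are regrouped so that Young's inequality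
  returns exactly \<open>Y * (\<phi> * g)\<close>. The factor 2 is the upper bound of
  \<open>h\<close>.\<close>

lemma coercive_young:
  fixes p k Y f d g \<phi> D :: real
  assumes p: "p > 1" and k: "k > 0" and Y: "Y \<ge> 0" and f: "f \<ge> 0" "Y powr (p - 1) \<ge> k powr (p - 1) * f powr p"
    and \<phi>: "\<phi> \<ge> 0" and d: "d \<ge> 0" "d \<le> D * \<phi> powr ((p - 1) / p)" and D: "D \<ge> 0" and g: "g > 0"
  shows "2 * (f * d) \<le> Y * (\<phi> * g) + (2 * D) powr p * k powr (1 - p) * g powr (1 - p)"
proof -
  define \<theta> where "\<theta> = (p - 1) / p"
  have \<theta>: "\<theta> * (p / (p - 1)) = 1" "\<theta> * p = p - 1" using p by (simp_all add: \<theta>_def)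
  have fle: "f \<le> (Y / k) powr \<theta>"
  proof -
    have "f powr p \<le> (Y / k) powr (p - 1)" using f(2) k Y by (simp add: powr_divide field_simps)
    then have "(f powr p) powr (1/p) \<le> ((Y / k) powr (p - 1)) powr (1/p)" using p by (intro powr_mono2) auto
    then show ?thesis using p f(1) by (simp add: powr_powr \<theta>_def)
  qed
  have "2 * (f * d) \<le> 2 * ((Y / k) powr \<theta> * (D * \<phi> powr \<theta>))"
    using fle d f by (intro mult_left_mono mult_mono) (auto simp: \<theta>_def)
  also have "\<dots> = (Y * (\<phi> * g)) powr \<theta> * (2 * D * (k powr (- \<theta>) * g powr (- \<theta>)))"
    using Y k g \<phi> by (simp add: powr_mult powr_divide powr_minus field_simps)
  also have "\<dots> \<le> ((Y * (\<phi> * g)) powr \<theta>) powr (p / (p - 1)) + (2 * D * (k powr (- \<theta>) * g powr (- \<theta>))) powr p"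
    using D by (intro young_powr p) auto
  also have "((Y * (\<phi> * g)) powr \<theta>) powr (p / (p - 1)) = Y * (\<phi> * g)"
    unfolding powr_powr \<theta> using Y \<phi> g by simp
  also have "(2 * D * (k powr (- \<theta>) * g powr (- \<theta>))) powr p = (2 * D) powr p * k powr (1 - p) * g powr (1 - p)"
    using D k g \<theta>(2) by (simp add: powr_mult powr_powr)
  finally show ?thesis .
qed

text \<open>One inequality of the system in isolation: \<open>F\<close> stands for the field
  evaluated along the solution and \<open>w\<close> for the right side, a power of the other
  unknown. Both inequalities are instances, and the operator itself no longer appears.\<close>

definition coercive_subsolution ::
  "real \<Rightarrow> real \<Rightarrow> real \<Rightarrow> ('a::euclidean_space \<Rightarrow> real) \<Rightarrow> ('a \<Rightarrow> real) \<Rightarrow> ('a \<Rightarrow> 'a) \<Rightarrow> ('a \<Rightarrow> 'a) \<Rightarrow> bool" where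
  "coercive_subsolution p q k v w G F \<longleftrightarrow>
     Lp_loc p v \<and> weak_grad v G \<and> Lp_loc_vec p G \<and> (AE x in lebesgue. v x \<ge> 0) \<and>
     Lp_loc_vec (p / (p - 1)) F \<and> loc_integrable w \<and> (AE x in lebesgue. w x \<ge> 0) \<and>
     loc_integrable (\<lambda>x. v x powr q) \<and>
     (\<forall>x. F x \<bullet> G x \<ge> 0 \<and> (F x \<bullet> G x) powr (p - 1) \<ge> k powr (p - 1) * norm (F x) powr p) \<and>
     (\<forall>\<phi> D\<phi>. test_fun \<phi> D\<phi> \<and> (\<forall>x. \<phi> x \<ge> 0) \<longrightarrow>
        (\<integral>x. w x * \<phi> x \<partial>lebesgue) \<le> - (\<integral>x. F x \<bullet> D\<phi> x \<partial>lebesgue))"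

definition ball_integral :: "('a::euclidean_space \<Rightarrow> real) \<Rightarrow> real \<Rightarrow> real" where
  "ball_integral f r = (\<integral>x. indicat_real (cball 0 r) x * f x \<partial>lebesgue)"

lemma loc_integrable_ball:
  fixes f :: "'a::euclidean_space \<Rightarrow> real"
  shows "loc_integrable f \<Longrightarrow> integrable lebesgue (\<lambda>x. indicat_real (cball 0 r) x * f x)"
  using loc_integrableD(1)[OF _ compact_cball, of f 0 r] by simp

lemma powr_one_plus_le:
  fixes t q :: real
  assumes "t \<ge> 0" "q > 0"
  shows "(1 + t) powr q \<le> 2 powr q * (1 + t powr q)"
proof -
  have "(1 + t) powr q \<le> (2 * max 1 t) powr q" using assms by (intro powr_mono2) auto
  also have "\<dots> = 2 powr q * (max 1 t) powr q" using assms by (simp add: powr_mult)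
  also have "\<dots> \<le> 2 powr q * (1 + t powr q)" by (intro mult_left_mono) (auto simp: max_def)
  finally show ?thesis .
qed

text \<open>Testing with \<^term>\<open>\<lambda>x. \<Phi> x * h (v x)\<close> for the bounded increasing function
  $h(t) = 2 - (1 + t/s)^{-\gamma}$, $1 + \gamma = q/(p-1)$: Young's inequality absorbs the
  coercive term and leaves the weight $h'(v)^{1-p}$, which is a multiple of $(1 + v/s)^q$.\<close>

lemma key_estimate:
  fixes p q k :: real
  assumes p: "p > 1" and q: "q > p - 1" and k: "k > 0"
  obtains C where "C > 0"
    "\<And>v w G (F :: 'a::euclidean_space \<Rightarrow> 'a) a b s. coercive_subsolution p q k v w G F \<Longrightarrow> 0 < a \<Longrightarrow> a < b \<Longrightarrow> s > 0 \<Longrightarrow>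
       ball_integral w a \<le> C * s powr (p - 1) * (b - a) powr (- p) *
         (measure lebesgue (cball (0::'a) b) + s powr (- q) * ball_integral (\<lambda>x. v x powr q) b)"
proof -
  obtain C1 where C1: "C1 > 0"
    and cut: "\<And>a b. 0 < a \<Longrightarrow> a < b \<Longrightarrow> \<exists>(\<Phi> :: 'a \<Rightarrow> real) D\<Phi> k. radial_cutoff_fun p C1 a b \<Phi> D\<Phi> k"
    using radial_cutoff[OF p, where 'a='a] by blast
  \<comment> \<open>Positive exactly because \<open>q > p - 1\<close>; positivity keeps
    \<open>h\<close> increasing and bounded.\<close>
  define \<gamma> where "\<gamma> = q / (p - 1) - 1"
  have \<gamma>: "\<gamma> > 0" using p q by (simp add: \<gamma>_def divide_simps)
  have \<gamma>1: "(\<gamma> + 1) * (p - 1) = q" using p by (simp add: \<gamma>_def)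
  have q0: "q > 0" using p q by simp
  define C where "C = (2 * C1) powr p * k powr (1 - p) * \<gamma> powr (1 - p) * 2 powr q"
  have C0: "C > 0" using C1 k \<gamma> by (simp add: C_def)
  show ?thesis
  proof (rule that[OF C0])
    fix v w :: "'a \<Rightarrow> real" and G F :: "'a \<Rightarrow> 'a" and a b s :: real
    assume S: "coercive_subsolution p q k v w G F" and ab: "0 < a" "a < b" and s: "s > 0"
    note S' = S[unfolded coercive_subsolution_def]
    have v: "Lp_loc p v" "weak_grad v G" "Lp_loc_vec p G" "AE x in lebesgue. v x \<ge> 0"
      and F: "Lp_loc_vec (p / (p - 1)) F" and w: "loc_integrable w" "AE x in lebesgue. w x \<ge> 0"
      and vq: "loc_integrable (\<lambda>x. v x powr q)" using S' by auto
    have FG: "F x \<bullet> G x \<ge> 0" "(F x \<bullet> G x) powr (p - 1) \<ge> k powr (p - 1) * norm (F x) powr p" for x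
      using S' by auto
    obtain \<Phi> :: "'a \<Rightarrow> real" and D\<Phi> \<kappa> where \<Phi>c: "radial_cutoff_fun p C1 a b \<Phi> D\<Phi> \<kappa>"
      using cut[OF ab] by blast
    then have tf: "test_fun \<Phi> D\<Phi>" by (simp add: radial_cutoff_fun_def)
    note * = \<Phi>c[unfolded radial_cutoff_fun_def, THEN conjunct2]
    have \<Phi>: "\<And>x. 0 \<le> \<Phi> x" "\<And>x. norm x \<le> a \<Longrightarrow> \<Phi> x = 1" "\<And>x. norm x \<ge> b \<Longrightarrow> D\<Phi> x = 0"
        "\<And>x. norm (D\<Phi> x) \<le> C1 / (b - a) * \<Phi> x powr ((p - 1) / p)"
      subgoal using * by blast
      subgoal using * by blast
      subgoal for x using *[rule_format, of x] by simp
      subgoal using * by blast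
      done
    \<comment> \<open>The values lie between 1 and 2: the lower bound keeps the integral of
      \<open>w\<close> over the inner ball, the upper one supplies the factor 2 in
      \<open>coercive_young\<close>.\<close>
    define h where "h t = 2 - (1 + t / s) powr (- \<gamma>)" for t
    define h' where "h' t = \<gamma> / s * (1 + t / s) powr (- \<gamma> - 1)" for t
    define H where "H = max 2 (\<gamma> / s)"
    have pos: "1 + t / s \<ge> 1" if "t \<ge> 0" for t using that s by simp
    have hd: "(h has_real_derivative h' t) (at t)" if "t \<ge> 0" for t
    proof -
      have "1 + t / s > 0" using pos[OF that] by linarith
      then show ?thesis unfolding h_def[abs_def] h'_def
        using s that by (auto intro!: derivative_eq_intros simp: field_simps powr_diff)
    qed
    have h'c: "isCont h' t" if "t \<ge> 0" for t
      unfolding h'_def using pos[OF that] s by (intro continuous_intros) auto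
    have le1: "0 < (1 + t / s) powr (- c)" "(1 + t / s) powr (- c) \<le> 1" if "t \<ge> 0" "c > 0" for t c
    proof -
      have "1 powr (- c) \<ge> (1 + t / s) powr (- c)" using pos[OF that(1)] that(2) by (intro powr_mono2') auto
      then show "(1 + t / s) powr (- c) \<le> 1" by simp
      show "0 < (1 + t / s) powr (- c)" using pos[OF that(1)] by simp
    qed
    have h12: "1 \<le> h t" "h t \<le> 2" if "t \<ge> 0" for t
      using le1[OF that \<gamma>] by (auto simp: h_def)
    have h'0: "h' t > 0" "h' t \<le> \<gamma> / s" if "t \<ge> 0" for t
    proof -
      have "- \<gamma> - 1 = - (\<gamma> + 1)" by simp
      then show "h' t > 0" "h' t \<le> \<gamma> / s"
        using le1[OF that, of "\<gamma> + 1"] \<gamma> s by (auto simp: h'_def intro!: divide_right_mono mult_left_le)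
    qed
    have ms: "h \<in> borel_measurable borel" "h' \<in> borel_measurable borel"
      unfolding h_def[abs_def] h'_def[abs_def] by measurable
    have ineq: "(\<integral>x. w x * \<phi> x \<partial>lebesgue) \<le> - (\<integral>x. F x \<bullet> D\<phi> x \<partial>lebesgue)"
      if "test_fun \<phi> D\<phi>" "\<And>x. \<phi> x \<ge> 0" for \<phi> D\<phi>
      using S' that by blast
    have hH: "0 \<le> h t" "h t \<le> H" "\<bar>h' t\<bar> \<le> H" if "t \<ge> 0" for t
      using h12[OF that] h'0[OF that] by (auto simp: H_def)
    have comp: "integrable lebesgue (\<lambda>x. w x * (\<Phi> x * h (v x)))"
      "integrable lebesgue (\<lambda>x. (F x \<bullet> G x) * (\<Phi> x * h' (v x)))"
      "integrable lebesgue (\<lambda>x. (F x \<bullet> D\<Phi> x) * h (v x))"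
      "(\<integral>x. w x * (\<Phi> x * h (v x)) \<partial>lebesgue) + (\<integral>x. (F x \<bullet> G x) * (\<Phi> x * h' (v x)) \<partial>lebesgue)
         \<le> - (\<integral>x. (F x \<bullet> D\<Phi> x) * h (v x) \<partial>lebesgue)"
      by (rule weak_ineq_composite[OF p v F w(1) ineq hd h'c hH ms tf \<Phi>(1)]; assumption)+
    define D where "D = C1 / (b - a)"
    have D0: "D \<ge> 0" using C1 ab by (simp add: D_def)
    define E where "E = C * s powr (p - 1) * (b - a) powr (- p)"
    have E0: "E \<ge> 0" using C0 by (simp add: E_def)
    \<comment> \<open>What Young's inequality leaves once the coercive term is absorbed. It lives on
      the outer ball, since the cutoff gradient vanishes beyond it.\<close>
    define rem where "rem x = E * (indicat_real (cball 0 b) x * (1 + s powr (- q) * v x powr q))" for x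
    have remi: "integrable lebesgue rem"
      unfolding rem_def distrib_left
      using loc_integrable_ball[OF vq, of b] integrable_indicator_compact[OF compact_cball, of 0 b "1::real"]
      by (intro Bochner_Integration.integrable_add integrable_mult_right) (auto simp: mult.left_commute)
    have rem_int: "(\<integral>x. rem x \<partial>lebesgue) = E * (measure lebesgue (cball (0::'a) b) + s powr (- q) * ball_integral (\<lambda>x. v x powr q) b)"
    proof -
      have "(\<integral>x. rem x \<partial>lebesgue) = E * (\<integral>x. indicat_real (cball 0 b) x + s powr (- q) * (indicat_real (cball 0 b) x * v x powr q) \<partial>lebesgue)"
        unfolding integral_mult_right_zero[symmetric]
        by (intro Bochner_Integration.integral_cong refl) (simp add: rem_def algebra_simps)
      also have "(\<integral>x. indicat_real (cball 0 b) x + s powr (- q) * (indicat_real (cball 0 b) x * v x powr q) \<partial>lebesgue)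
          = (\<integral>x. indicat_real (cball (0::'a) b) x \<partial>lebesgue) + s powr (- q) * ball_integral (\<lambda>x. v x powr q) b"
        using loc_integrable_ball[OF vq, of b] integrable_indicator_compact[OF compact_cball, of 0 b "1::real"]
        by (subst Bochner_Integration.integral_add) (auto simp: ball_integral_def)
      finally show ?thesis by simp
    qed
    have pt: "AE x in lebesgue. - ((F x \<bullet> D\<Phi> x) * h (v x)) \<le> (F x \<bullet> G x) * (\<Phi> x * h' (v x)) + rem x"
      using v(4)
    proof eventually_elim
      case (elim x)
      show ?case
      proof (cases "norm x < b")
        case True
        have "- ((F x \<bullet> D\<Phi> x) * h (v x)) \<le> \<bar>F x \<bullet> D\<Phi> x\<bar> * h (v x)"
          using h12[OF elim] mult_right_mono[OF abs_ge_minus_self[of "F x \<bullet> D\<Phi> x"], of "h (v x)"] by simp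
        also have "\<dots> \<le> (norm (F x) * norm (D\<Phi> x)) * 2"
          using h12[OF elim] by (intro mult_mono Cauchy_Schwarz_ineq2) auto
        also have "\<dots> \<le> (F x \<bullet> G x) * (\<Phi> x * h' (v x)) + (2 * D) powr p * k powr (1 - p) * h' (v x) powr (1 - p)"
          using coercive_young[OF p k FG(1) norm_ge_zero FG(2) \<Phi>(1) norm_ge_zero \<Phi>(4)[folded D_def] D0 h'0(1)[OF elim]]
          by (simp add: mult.commute)
        also have "(2 * D) powr p * k powr (1 - p) * h' (v x) powr (1 - p) \<le> rem x"
        proof -
          have "h' (v x) powr (1 - p) = \<gamma> powr (1 - p) * s powr (p - 1) * (1 + v x / s) powr ((\<gamma> + 1) * (p - 1))"
          proof -
            have e: "(- \<gamma> - 1) * (1 - p) = (\<gamma> + 1) * (p - 1)" by (simp add: algebra_simps)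
            have "s powr (1 - p) = inverse (s powr (p - 1))" using powr_minus[of s "p - 1"] by simp
            then have "(\<gamma> / s) powr (1 - p) = \<gamma> powr (1 - p) * s powr (p - 1)"
              using \<gamma> s by (simp add: powr_divide field_simps)
            then show ?thesis unfolding h'_def powr_mult powr_powr e by simp
          qed
          also have "\<dots> \<le> \<gamma> powr (1 - p) * s powr (p - 1) * (2 powr q * (1 + (v x / s) powr q))"
            unfolding \<gamma>1 using elim s q0 by (intro mult_left_mono powr_one_plus_le) auto
          also have "(v x / s) powr q = s powr (- q) * v x powr q"
            using s elim by (simp add: powr_divide powr_minus field_simps)
          finally have "(2 * D) powr p * k powr (1 - p) * h' (v x) powr (1 - p) \<le>
             (2 * D) powr p * k powr (1 - p) * (\<gamma> powr (1 - p) * s powr (p - 1) * (2 powr q * (1 + s powr (- q) * v x powr q)))"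
            by (intro mult_left_mono) auto
          also have "\<dots> = E * (1 + s powr (- q) * v x powr q)"
          proof -
            have "(2 * D) powr p = (2 * C1) powr p * (b - a) powr (- p)"
              using C1 ab by (simp add: D_def powr_mult powr_divide powr_minus field_simps)
            then show ?thesis by (simp add: E_def C_def mult_ac)
          qed
          finally show ?thesis using True by (simp add: rem_def)
        qed
        finally show ?thesis by simp
      next
        case False
        have "rem x \<ge> 0" using E0 s by (auto simp: rem_def)
        moreover have "(F x \<bullet> G x) * (\<Phi> x * h' (v x)) \<ge> 0"
          using FG(1)[of x] \<Phi>(1)[of x] h'0(1)[OF elim] by simp
        ultimately show ?thesis using False \<Phi>(3)[of x] by simp
      qed
    qed
    have "ball_integral w a \<le> (\<integral>x. w x * (\<Phi> x * h (v x)) \<partial>lebesgue)"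
      unfolding ball_integral_def
    proof (rule integral_mono_AE)
      show "AE x in lebesgue. indicat_real (cball 0 a) x * w x \<le> w x * (\<Phi> x * h (v x))"
        using v(4) w(2)
      proof eventually_elim
        case (elim x)
        show ?case
        proof (cases "norm x \<le> a")
          case True
          have "w x * 1 \<le> w x * h (v x)" using elim h12(1) by (intro mult_left_mono) auto
          then show ?thesis using True \<Phi>(2)[OF True] by simp
        next
          case False
          then show ?thesis using elim \<Phi>(1)[of x] h12(1)[of "v x"] by (simp add: zero_le_mult_iff)
        qed
      qed
    qed (use comp(1) loc_integrable_ball[OF w(1)] in auto)
    \<comment> \<open>The coercive integral occurs on both sides and cancels, which is legitimate
      because \<open>comp(2)\<close> makes it finite.\<close>
    also have "\<dots> \<le> (\<integral>x. rem x \<partial>lebesgue)"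
    proof -
      have "- (\<integral>x. (F x \<bullet> D\<Phi> x) * h (v x) \<partial>lebesgue) \<le> (\<integral>x. (F x \<bullet> G x) * (\<Phi> x * h' (v x)) + rem x \<partial>lebesgue)"
        unfolding integral_minus[symmetric]
        by (rule integral_mono_AE) (use pt comp(2,3) remi in auto)
      also have "\<dots> = (\<integral>x. (F x \<bullet> G x) * (\<Phi> x * h' (v x)) \<partial>lebesgue) + (\<integral>x. rem x \<partial>lebesgue)"
        by (intro Bochner_Integration.integral_add comp(2) remi)
      finally show ?thesis using comp(4) by linarith
    qed
    finally show "ball_integral w a \<le> C * s powr (p - 1) * (b - a) powr (- p) *
         (measure lebesgue (cball (0::'a) b) + s powr (- q) * ball_integral (\<lambda>x. v x powr q) b)"
      unfolding rem_int E_def .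
  qed
qed

section \<open>From sublinear bounds to decay of averages\<close>

text \<open>Multiplying \<open>X a\<close> by \<open>(2 * R - a) powr \<tau>\<close> makes the
  inequality scale invariant: with \<open>\<tau> = \<sigma> / (1 - \<kappa>)\<close> all powers of
  the distance to \<open>2 * R\<close> cancel, and the supremum \<open>M\<close> satisfies
  \<open>M \<le> K' * M powr \<kappa>\<close> with \<open>\<kappa> < 1\<close>. The bound
  \<open>B\<close> makes \<open>M\<close> finite and leaves no trace in the result.\<close>

lemma sublinear_absorption:
  fixes X :: "real \<Rightarrow> real"
  assumes R: "R > 0" and \<kappa>: "0 < \<kappa>" "\<kappa> < 1" and K: "K > 0" and \<sigma>: "\<sigma> > 0"
    and X: "\<And>a. R \<le> a \<Longrightarrow> a < 2 * R \<Longrightarrow> 0 \<le> X a \<and> X a \<le> B"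
    and step: "\<And>a d. R \<le> a \<Longrightarrow> d > 0 \<Longrightarrow> a + 2 * d < 2 * R \<Longrightarrow> X a \<le> K * d powr (- \<sigma>) * X (a + 2 * d) powr \<kappa>"
  defines "\<tau> \<equiv> \<sigma> / (1 - \<kappa>)"
  shows "X R \<le> (K * 4 powr \<sigma> * 2 powr (\<tau> * \<kappa>)) powr (1 / (1 - \<kappa>)) * R powr (- \<tau>)"
proof -
  have \<tau>: "\<tau> > 0" "\<tau> - \<sigma> - \<tau> * \<kappa> = 0" using \<kappa> \<sigma> by (auto simp: \<tau>_def field_simps)
  define g where "g a = (2 * R - a) powr \<tau> * X a" for a
  define M where "M = Sup (g ` {R..<2*R})"
  have B0: "B \<ge> 0" using X[of R] R by simp
  have "g a \<le> R powr \<tau> * B" if "a \<in> {R..<2*R}" for a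
    unfolding g_def using X[of a] that \<tau> by (intro mult_mono powr_mono2) auto
  then have bdd: "bdd_above (g ` {R..<2*R})" by (rule bdd_aboveI2)
  have gM: "g a \<le> M" if "R \<le> a" "a < 2 * R" for a
    unfolding M_def by (rule cSUP_upper[OF _ bdd]) (use that in auto)
  have g0: "g R \<ge> 0" using X[of R] R by (simp add: g_def)
  then have M0: "M \<ge> 0" using gM[of R] R by linarith
  define K' where "K' = K * 4 powr \<sigma> * 2 powr (\<tau> * \<kappa>)"
  have K'0: "K' > 0" using K by (simp add: K'_def)
  have "g a \<le> K' * M powr \<kappa>" if a: "R \<le> a" "a < 2 * R" for a
  proof -
    define e where "e = 2 * R - a"
    have e: "e > 0" using a by (simp add: e_def)
    \<comment> \<open>\<open>a'\<close> halves the distance \<open>e\<close> to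
      \<open>2 * R\<close>, with \<open>d = e / 4\<close> because a step advances by
      \<open>2 * d\<close>; the factors \<open>4 powr \<sigma>\<close> and
      \<open>2 powr (\<tau> * \<kappa>)\<close> come from here.\<close>
    define a' where "a' = a + 2 * (e / 4)"
    have a': "R \<le> a'" "a' < 2 * R" "2 * R - a' = e / 2" using a by (simp_all add: a'_def e_def field_simps)
    have "X a' * (e / 2) powr \<tau> \<le> M" using gM[OF a'(1,2)] unfolding g_def a'(3) by (simp add: mult.commute)
    then have "X a' \<le> M * (e / 2) powr (- \<tau>)" using e by (simp add: powr_minus field_simps)
    then have "X a' powr \<kappa> \<le> (M * (e / 2) powr (- \<tau>)) powr \<kappa>"
      using X[OF a'(1,2)] \<kappa> by (intro powr_mono2) auto
    moreover have "X a \<le> K * (e / 4) powr (- \<sigma>) * X a' powr \<kappa>"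
      unfolding a'_def by (rule step) (use a e a' in \<open>auto simp: a'_def\<close>)
    ultimately have "X a \<le> K * (e / 4) powr (- \<sigma>) * (M * (e / 2) powr (- \<tau>)) powr \<kappa>"
      using K by (meson mult_left_mono mult_nonneg_nonneg less_imp_le order_trans powr_ge_zero)
    then have "g a \<le> e powr \<tau> * (K * (e / 4) powr (- \<sigma>) * (M * (e / 2) powr (- \<tau>)) powr \<kappa>)"
      unfolding g_def e_def[symmetric] by (intro mult_left_mono) auto
    also have "\<dots> = K' * M powr \<kappa> * (e powr \<tau> * e powr (- \<sigma>) * e powr (- (\<tau> * \<kappa>)))"
      using e M0 by (simp add: powr_mult powr_divide powr_powr powr_minus K'_def field_simps)
    also have "e powr \<tau> * e powr (- \<sigma>) * e powr (- (\<tau> * \<kappa>)) = e powr (\<tau> - \<sigma> - \<tau> * \<kappa>)"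
      by (simp flip: powr_add)
    also have "\<dots> = 1" using \<tau>(2) e by simp
    finally show ?thesis by simp
  qed
  then have MK: "M \<le> K' * M powr \<kappa>"
    unfolding M_def using R by (intro cSUP_least) auto
  have "M \<le> K' powr (1 / (1 - \<kappa>))"
  proof (cases "M = 0")
    case False
    then have Mp: "M > 0" using M0 by simp
    have "M powr (1 - \<kappa>) \<le> K'" using MK Mp by (simp add: powr_diff field_simps)
    then have "(M powr (1 - \<kappa>)) powr (1 / (1 - \<kappa>)) \<le> K' powr (1 / (1 - \<kappa>))"
      using \<kappa> by (intro powr_mono2) auto
    then show ?thesis using \<kappa> Mp by (simp add: powr_powr)
  qed simp
  then have "R powr \<tau> * X R \<le> K' powr (1 / (1 - \<kappa>))"
    using gM[of R] R by (simp add: g_def)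
  then show ?thesis using R by (simp add: K'_def powr_minus field_simps)
qed

lemma ball_integral_nonneg:
  assumes "AE x in lebesgue. f x \<ge> 0"
  shows "ball_integral f r \<ge> 0"
  unfolding ball_integral_def
  by (rule integral_nonneg_AE) (use assms in eventually_elim, simp)

lemma ball_integral_mono:
  assumes "loc_integrable f" "AE x in lebesgue. f x \<ge> 0" "r \<le> s"
  shows "ball_integral f r \<le> ball_integral f s"
  unfolding ball_integral_def
proof (rule integral_mono_AE)
  show "AE x in lebesgue. indicat_real (cball 0 r) x * f x \<le> indicat_real (cball 0 s) x * f x"
    using assms(2) by eventually_elim (use assms(3) in \<open>auto simp: indicator_def\<close>)
qed (intro loc_integrable_ball assms(1))+

lemma ball_integral_eq_0_imp_AE:
  assumes f: "loc_integrable f" "AE x in lebesgue. f x \<ge> 0" and z: "\<And>n::nat. ball_integral f (real n) = 0"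
  shows "AE x in lebesgue. f x = 0"
proof -
  have "AE x in lebesgue. indicat_real (cball 0 (real n)) x * f x = 0" for n
  proof -
    have "AE x in lebesgue. 0 \<le> indicat_real (cball 0 (real n)) x * f x"
      using f(2) by eventually_elim simp
    from integral_nonneg_eq_0_iff_AE[OF loc_integrable_ball[OF f(1)] this] z[of n]
    show ?thesis by (simp add: ball_integral_def)
  qed
  then have "AE x in lebesgue. \<forall>n. indicat_real (cball 0 (real n)) x * f x = 0"
    unfolding AE_all_countable by blast
  then show ?thesis
  proof eventually_elim
    case (elim x)
    obtain n :: nat where "norm x \<le> real n" using real_arch_simple by blast
    with elim[rule_format, of n] show ?case by simp
  qed
qed

text \<open>The free scale in \<open>key_estimate\<close> is set to the q-mean of \<open>v\<close>,
  which makes the second term of the bracket equal to the volume. Dividing by the volume of a ball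
  of separate radius \<open>r\<close> lets estimates at different radii be composed with one
  normalization.\<close>

lemma average_estimate:
  fixes p q k :: real
  assumes p: "p > 1" and q: "q > p - 1" and k: "k > 0"
  obtains C where "C > 0"
    "\<And>v w G (F :: 'a::euclidean_space \<Rightarrow> 'a) a b r. coercive_subsolution p q k v w G F \<Longrightarrow> 0 < a \<Longrightarrow> a < b \<Longrightarrow> b \<le> r \<Longrightarrow>
       ball_integral (\<lambda>x. v x powr q) b > 0 \<Longrightarrow>
       ball_integral w a / measure lebesgue (cball (0::'a) r) \<le> C * (b - a) powr (- p) *
         (ball_integral (\<lambda>x. v x powr q) b / measure lebesgue (cball (0::'a) r)) powr ((p - 1) / q)"
proof -
  obtain C where C: "C > 0"
    and est: "\<And>v w G (F :: 'a \<Rightarrow> 'a) a b s. coercive_subsolution p q k v w G F \<Longrightarrow> 0 < a \<Longrightarrow> a < b \<Longrightarrow> s > 0 \<Longrightarrow>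
       ball_integral w a \<le> C * s powr (p - 1) * (b - a) powr (- p) *
         (measure lebesgue (cball (0::'a) b) + s powr (- q) * ball_integral (\<lambda>x. v x powr q) b)"
    using key_estimate[OF p q k, where 'a='a] by blast
  have q0: "q > 0" using p q by simp
  show ?thesis
  proof (rule that[of "2 * C"])
    show "2 * C > 0" using C by simp
    fix v w :: "'a \<Rightarrow> real" and G F :: "'a \<Rightarrow> 'a" and a b r :: real
    assume S: "coercive_subsolution p q k v w G F" and ab: "0 < a" "a < b" "b \<le> r"
      and V: "ball_integral (\<lambda>x. v x powr q) b > 0"
    define W where "W = measure lebesgue (cball (0::'a) r)"
    define V where "V = ball_integral (\<lambda>x. v x powr q) b"
    have V0: "V > 0" using V by (simp add: V_def)
    have W0: "W > 0" unfolding W_def using ab content_cball_pos[of r 0] by simp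
    define s where "s = (V / W) powr (1 / q)"
    have s0: "s > 0" using V0 W0 by (simp add: s_def)
    have sq: "s powr (- q) * V = W" using V0 W0 q0 by (simp add: s_def powr_powr powr_minus)
    have sp: "s powr (p - 1) = (V / W) powr ((p - 1) / q)" by (simp add: s_def powr_powr)
    have "measure lebesgue (cball (0::'a) b) \<le> W"
      unfolding W_def by (intro measure_mono_fmeasurable) (use ab in auto)
    then have "C * s powr (p - 1) * (b - a) powr (- p) * (measure lebesgue (cball (0::'a) b) + s powr (- q) * V)
        \<le> C * s powr (p - 1) * (b - a) powr (- p) * (W + W)"
      unfolding sq using C by (intro mult_left_mono) auto
    with est[OF S ab(1,2) s0] have "ball_integral w a \<le> C * s powr (p - 1) * (b - a) powr (- p) * (W + W)"
      unfolding V_def[symmetric] by linarith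
    then show "ball_integral w a / measure lebesgue (cball (0::'a) r) \<le> 2 * C * (b - a) powr (- p) *
         (ball_integral (\<lambda>x. v x powr q) b / measure lebesgue (cball (0::'a) r)) powr ((p - 1) / q)"
      unfolding V_def[symmetric] W_def[symmetric] using W0 sp by (simp add: field_simps)
  qed
qed

text \<open>The two estimates compose to a sublinear one for the averages of \<^term>\<open>\<lambda>x. u x powr q1\<close>,
  because $(p_1-1)(p_2-1) < q_1 q_2$.\<close>

lemma average_tendsto_0:
  fixes u v :: "'a::euclidean_space \<Rightarrow> real"
  assumes p: "p1 > 1" "p2 > 1" and q: "q1 > p1 - 1" "q2 > p2 - 1" and k: "k1 > 0" "k2 > 0"
    and S1: "coercive_subsolution p1 q1 k1 u (\<lambda>x. v x powr q2) Gu F1"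
    and S2: "coercive_subsolution p2 q2 k2 v (\<lambda>x. u x powr q1) Gv F2"
    and pos: "r0 > 0" "ball_integral (\<lambda>x. u x powr q1) r0 > 0" "ball_integral (\<lambda>x. v x powr q2) r0 > 0"
  shows "((\<lambda>R. ball_integral (\<lambda>x. u x powr q1) R / R ^ DIM('a)) \<longlongrightarrow> 0) at_top"
proof -
  define U where "U = ball_integral (\<lambda>x. u x powr q1)"
  define V where "V = ball_integral (\<lambda>x. v x powr q2)"
  have li: "loc_integrable (\<lambda>x. u x powr q1)" "loc_integrable (\<lambda>x. v x powr q2)"
    using S1 S2 by (auto simp: coercive_subsolution_def)
  have U0: "U r \<ge> 0" and V0: "V r \<ge> 0" for r unfolding U_def V_def by (auto intro: ball_integral_nonneg)
  have Um: "U r \<le> U s" and Vm: "V r \<le> V s" if "r \<le> s" for r s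
    unfolding U_def V_def using that li by (auto intro: ball_integral_mono)
  define \<kappa>1 where "\<kappa>1 = (p1 - 1) / q1"
  define \<kappa>2 where "\<kappa>2 = (p2 - 1) / q2"
  define \<kappa> where "\<kappa> = \<kappa>1 * \<kappa>2"
  have \<kappa>12: "0 < \<kappa>1" "\<kappa>1 < 1" "0 < \<kappa>2" "\<kappa>2 < 1" using p q by (auto simp: \<kappa>1_def \<kappa>2_def)
  then have \<kappa>: "0 < \<kappa>" "\<kappa> < 1" unfolding \<kappa>_def
    using mult_strict_mono[of \<kappa>1 1 \<kappa>2 1] by auto
  obtain C1 where C1: "C1 > 0"
    and "\<And>v w G (F :: 'a \<Rightarrow> 'a) a b r. coercive_subsolution p1 q1 k1 v w G F \<Longrightarrow> 0 < a \<Longrightarrow> a < b \<Longrightarrow> b \<le> r \<Longrightarrow>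
       ball_integral (\<lambda>x. v x powr q1) b > 0 \<Longrightarrow>
       ball_integral w a / measure lebesgue (cball (0::'a) r) \<le> C1 * (b - a) powr (- p1) *
         (ball_integral (\<lambda>x. v x powr q1) b / measure lebesgue (cball (0::'a) r)) powr ((p1 - 1) / q1)"
    using average_estimate[OF p(1) q(1) k(1), where 'a='a] by blast
  from this(2)[OF S1]
  have est1: "\<And>a b r. 0 < a \<Longrightarrow> a < b \<Longrightarrow> b \<le> r \<Longrightarrow> U b > 0 \<Longrightarrow>
       V a / measure lebesgue (cball (0::'a) r) \<le> C1 * (b - a) powr (- p1) * (U b / measure lebesgue (cball (0::'a) r)) powr \<kappa>1"
    unfolding U_def V_def \<kappa>1_def .
  obtain C2 where C2: "C2 > 0"
    and "\<And>v w G (F :: 'a \<Rightarrow> 'a) a b r. coercive_subsolution p2 q2 k2 v w G F \<Longrightarrow> 0 < a \<Longrightarrow> a < b \<Longrightarrow> b \<le> r \<Longrightarrow>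
       ball_integral (\<lambda>x. v x powr q2) b > 0 \<Longrightarrow>
       ball_integral w a / measure lebesgue (cball (0::'a) r) \<le> C2 * (b - a) powr (- p2) *
         (ball_integral (\<lambda>x. v x powr q2) b / measure lebesgue (cball (0::'a) r)) powr ((p2 - 1) / q2)"
    using average_estimate[OF p(2) q(2) k(2), where 'a='a] by blast
  from this(2)[OF S2]
  have est2: "\<And>a b r. 0 < a \<Longrightarrow> a < b \<Longrightarrow> b \<le> r \<Longrightarrow> V b > 0 \<Longrightarrow>
       U a / measure lebesgue (cball (0::'a) r) \<le> C2 * (b - a) powr (- p2) * (V b / measure lebesgue (cball (0::'a) r)) powr \<kappa>2"
    unfolding U_def V_def \<kappa>2_def .
  define K where "K = C2 * C1 powr \<kappa>2"
  define \<sigma> where "\<sigma> = p2 + p1 * \<kappa>2"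
  have K: "K > 0" using C1 C2 by (simp add: K_def)
  have \<sigma>: "\<sigma> > 0" using p \<kappa>12 by (simp add: \<sigma>_def add_pos_pos)
  define \<tau> where "\<tau> = \<sigma> / (1 - \<kappa>)"
  have \<tau>: "\<tau> > 0" using \<kappa> \<sigma> by (simp add: \<tau>_def)
  define L where "L = (K * 4 powr \<sigma> * 2 powr (\<tau> * \<kappa>)) powr (1 / (1 - \<kappa>))"
  define vol where "vol = unit_ball_vol (real DIM('a))"
  have vol: "measure lebesgue (cball (0::'a) r) = vol * r ^ DIM('a)" if "r \<ge> 0" for r
    using content_cball[OF that, of "0::'a"] by (simp add: vol_def)
  have bound: "U R / R ^ DIM('a) \<le> vol * 2 ^ DIM('a) * L * R powr (- \<tau>)" if R: "R \<ge> r0" for R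
  proof -
    have R0: "R > 0" using R pos by simp
    \<comment> \<open>The common normalization for all radii between \<open>R\<close> and
      \<open>2 * R\<close> in the absorption argument.\<close>
    define W where "W = measure lebesgue (cball (0::'a) (2 * R))"
    have W0: "W > 0" unfolding W_def using R0 content_cball_pos[of "2*R" 0] by simp
    have "U R / W \<le> (K * 4 powr \<sigma> * 2 powr (\<sigma> / (1 - \<kappa>) * \<kappa>)) powr (1 / (1 - \<kappa>)) * R powr (- (\<sigma> / (1 - \<kappa>)))"
    proof (rule sublinear_absorption[OF R0 \<kappa> K \<sigma>])
      fix a assume "R \<le> a" "a < 2 * R"
      then show "0 \<le> U a / W \<and> U a / W \<le> U (2 * R) / W"
        using U0 Um[of a "2*R"] W0 by (auto intro: divide_right_mono)
    next
      fix a d :: real assume a: "R \<le> a" "d > 0" "a + 2 * d < 2 * R"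
      \<comment> \<open>One step uses both inequalities: from \<open>U\<close> at \<open>a\<close>
        to \<open>V\<close> at \<open>a + d\<close>, then to \<open>U\<close> at
        \<open>a + 2 * d\<close>. Positivity at \<open>r0\<close> passes to all larger radii by
        monotonicity.\<close>
      have Vp: "V (a + d) > 0" using Vm[of r0 "a + d"] pos(3) a R by (simp add: V_def)
      have Up: "U (a + 2 * d) > 0" using Um[of r0 "a + 2 * d"] pos(2) a R by (simp add: U_def)
      have a0: "a > 0" using a R0 by simp
      have e1: "V (a + d) / W \<le> C1 * d powr (- p1) * (U (a + 2 * d) / W) powr \<kappa>1"
        using est1[of "a + d" "a + 2 * d" "2 * R"] a a0 Up by (simp add: W_def)
      have "U a / W \<le> C2 * d powr (- p2) * (V (a + d) / W) powr \<kappa>2"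
        using est2[of a "a + d" "2 * R"] a a0 Vp by (simp add: W_def)
      also have "\<dots> \<le> C2 * d powr (- p2) * (C1 * d powr (- p1) * (U (a + 2 * d) / W) powr \<kappa>1) powr \<kappa>2"
        using e1 C2 \<kappa>12 Vp W0 by (intro mult_left_mono powr_mono2) auto
      also have "\<dots> = K * d powr (- \<sigma>) * (U (a + 2 * d) / W) powr \<kappa>"
      proof -
        have "d powr (- \<sigma>) = d powr (- p2) * d powr (- (p1 * \<kappa>2))"
          by (simp add: \<sigma>_def flip: powr_add)
        then show ?thesis by (simp add: powr_mult powr_powr K_def \<kappa>_def mult_ac)
      qed
      finally show "U a / W \<le> K * d powr (- \<sigma>) * (U (a + 2 * d) / W) powr \<kappa>" .
    qed
    then have "U R / W \<le> L * R powr (- \<tau>)" by (simp add: L_def \<tau>_def)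
    then have "U R \<le> W * (L * R powr (- \<tau>))" using W0 by (simp add: field_simps)
    also have "W = vol * 2 ^ DIM('a) * R ^ DIM('a)"
      using vol[of "2 * R"] R0 by (simp add: W_def power_mult_distrib)
    finally have "U R \<le> (vol * 2 ^ DIM('a) * L * R powr (- \<tau>)) * R ^ DIM('a)" by (simp add: mult_ac)
    then show ?thesis using R0 by (simp add: pos_divide_le_eq)
  qed
  have "((\<lambda>R::real. vol * 2 ^ DIM('a) * L * R powr (- \<tau>)) \<longlongrightarrow> vol * 2 ^ DIM('a) * L * 0) at_top"
    using \<tau> by (intro tendsto_mult_left tendsto_neg_powr filterlim_ident) auto
  then have lim: "((\<lambda>R::real. vol * 2 ^ DIM('a) * L * R powr (- \<tau>)) \<longlongrightarrow> 0) at_top" by simp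
  show ?thesis
    unfolding U_def[symmetric]
  proof (rule Lim_null_comparison[OF _ lim])
    show "\<forall>\<^sub>F R in at_top. norm (U R / R ^ DIM('a)) \<le> vol * 2 ^ DIM('a) * L * R powr (- \<tau>)"
      using eventually_ge_at_top[of r0]
    proof eventually_elim
      case (elim R)
      have "U R / R ^ DIM('a) \<ge> 0" using U0 elim pos(1) by simp
      then show ?case using bound[OF elim] by simp
    qed
  qed
qed

text \<open>For \<open>v = 0\<close> the bracket in \<open>key_estimate\<close> is independent of
  the scale, so the prefactor \<open>s powr (p - 1)\<close> can be sent to 0.\<close>

lemma coercive_subsolution_zero_rhs:
  fixes v w :: "'a::euclidean_space \<Rightarrow> real"
  assumes p: "p > 1" and q: "q > p - 1" and k: "k > 0"
    and S: "coercive_subsolution p q k v w G F" and v0: "AE x in lebesgue. v x = 0"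
  shows "AE x in lebesgue. w x = 0"
proof -
  obtain C where C: "C > 0"
    and est: "\<And>v w G (F :: 'a \<Rightarrow> 'a) a b s. coercive_subsolution p q k v w G F \<Longrightarrow> 0 < a \<Longrightarrow> a < b \<Longrightarrow> s > 0 \<Longrightarrow>
       ball_integral w a \<le> C * s powr (p - 1) * (b - a) powr (- p) *
         (measure lebesgue (cball (0::'a) b) + s powr (- q) * ball_integral (\<lambda>x. v x powr q) b)"
    using key_estimate[OF p q k, where 'a='a] by blast
  have w: "loc_integrable w" "AE x in lebesgue. w x \<ge> 0" using S by (auto simp: coercive_subsolution_def)
  have vz: "ball_integral (\<lambda>x. v x powr q) b = 0" for b
  proof -
    have "ball_integral (\<lambda>x. v x powr q) b = (\<integral>x. 0 \<partial>(lebesgue :: 'a measure))"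
      unfolding ball_integral_def
    proof (rule integral_cong_AE)
      show "(\<lambda>x. indicat_real (cball 0 b) x * v x powr q) \<in> borel_measurable lebesgue"
        using S loc_integrable_ball by (intro borel_measurable_integrable) (auto simp: coercive_subsolution_def)
      show "AE x in lebesgue. indicat_real (cball 0 b) x * v x powr q = 0"
        using v0 by eventually_elim simp
    qed simp
    then show ?thesis by simp
  qed
  have pos: "ball_integral w a \<le> 0" if a: "a > 0" for a
  proof -
    define M where "M = C * measure lebesgue (cball (0::'a) (a + 1))"
    have le: "ball_integral w a \<le> s powr (p - 1) * M" if "s > 0" for s
      using est[OF S a, of "a + 1" s] that by (simp add: vz M_def mult_ac)
    have "((\<lambda>s::real. s powr (p - 1) * M) \<longlongrightarrow> 0 powr (p - 1) * M) (at_right 0)"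
      using p by (intro tendsto_intros tendsto_powr' ) (auto simp: eventually_at_filter)
    then have "((\<lambda>s::real. s powr (p - 1) * M) \<longlongrightarrow> 0) (at_right 0)" by simp
    then show ?thesis
      by (rule tendsto_lowerbound) (auto simp: eventually_at_filter le)
  qed
  have "ball_integral w (real n) = 0" for n
  proof -
    \<comment> \<open>The estimate is stated for positive radii; the shift by 1 covers
      \<open>n = 0\<close>.\<close>
    have "ball_integral w (real n) \<le> ball_integral w (real n + 1)" by (rule ball_integral_mono[OF w]) simp
    also have "\<dots> \<le> 0" by (rule pos) simp
    finally show ?thesis using ball_integral_nonneg[OF w(2), of "real n"] by linarith
  qed
  then show ?thesis by (rule ball_integral_eq_0_imp_AE[OF w])
qed

section \<open>Classical and weak gradients\<close>

lemma continuous_vanishing_integrable: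
  fixes f :: "'a::euclidean_space \<Rightarrow> 'b::euclidean_space"
  assumes "continuous_on UNIV f" "\<And>x. norm x \<ge> r \<Longrightarrow> f x = 0"
  shows "integrable lebesgue f"
proof -
  have "(\<lambda>x. indicat_real (cball 0 r) x *\<^sub>R f x) = f"
    using assms(2) by (auto simp: fun_eq_iff indicator_def)
  with loc_integrableD(1)[OF loc_integrable_continuous[OF assms(1)] compact_cball, of 0 r]
  show ?thesis by simp
qed

text \<open>Difference quotients of \<Phi> integrate to 0 by translation invariance. They converge
  to the directional derivative and are dominated by a Lipschitz bound on one fixed ball, so the
  vanishing passes to the limit.\<close>

lemma test_fun_integral_grad_0:
  fixes \<Phi> :: "'a::euclidean_space \<Rightarrow> real"
  assumes t: "test_fun \<Phi> D\<Phi>"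
  shows "(\<integral>x. D\<Phi> x \<bullet> b \<partial>lebesgue) = 0"
proof -
  obtain r where r: "\<And>x. norm x \<ge> r \<Longrightarrow> \<Phi> x = 0" "\<And>x. norm x \<ge> r \<Longrightarrow> D\<Phi> x = 0"
    using test_fun_support[OF t] by metis
  have d: "(\<Phi> has_derivative (\<lambda>h. D\<Phi> x \<bullet> h)) (at x)" for x
    using t by (simp add: test_fun_def C1_grad_def)
  have c: "continuous_on UNIV \<Phi>" "continuous_on UNIV D\<Phi>"
    using t C1_grad_continuous by (auto simp: test_fun_def C1_grad_def)
  have [measurable]: "\<Phi> \<in> borel_measurable borel" "D\<Phi> \<in> borel_measurable borel"
    using c by (auto intro: borel_measurable_continuous_onI)
  obtain B where B: "B > 0" "\<And>x. norm (D\<Phi> x) \<le> B" using continuous_vanishing_bounded[OF c(2) r(2)] by blast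
  define h where "h n = 1 / real (Suc n)" for n
  have h: "0 < h n" "h n \<le> 1" for n by (auto simp: h_def)
  have h0: "h \<longlonglongrightarrow> 0" unfolding h_def by (rule LIMSEQ_inverse_real_of_nat[unfolded inverse_eq_divide])
  define s where "s n x = (\<Phi> (x + h n *\<^sub>R b) - \<Phi> x) / h n" for n x
  \<comment> \<open>The shifts \<open>h n *\<^sub>R b\<close> have norm at most
    \<open>norm b\<close>, so every difference quotient vanishes beyond this radius.\<close>
  define R where "R = r + norm b"
  have lip: "\<bar>\<Phi> x - \<Phi> y\<bar> \<le> B * norm (x - y)" for x y
  proof -
    have "norm (\<Phi> x - \<Phi> y) \<le> B * norm (x - y)"
    proof (rule differentiable_bound[where S=UNIV and f'="\<lambda>x h. D\<Phi> x \<bullet> h"])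
      show "onorm (\<lambda>h. D\<Phi> x \<bullet> h) \<le> B" for x
      proof (rule onorm_le)
        fix k
        have "norm (D\<Phi> x \<bullet> k) \<le> norm (D\<Phi> x) * norm k" by (simp add: Cauchy_Schwarz_ineq2)
        also have "\<dots> \<le> B * norm k" using B by (intro mult_right_mono) auto
        finally show "norm (D\<Phi> x \<bullet> k) \<le> B * norm k" .
      qed
    qed (use d in \<open>auto intro: has_derivative_at_withinI\<close>)
    then show ?thesis by simp
  qed
  have \<Phi>i: "integrable lborel \<Phi>"
  proof -
    have "integrable lebesgue \<Phi>" by (rule continuous_vanishing_integrable[OF c(1) r(1)])
    then show ?thesis by (subst (asm) integrable_completion) auto
  qed
  have tr: "(\<integral>x. \<Phi> (x + w) \<partial>lborel) = (\<integral>x. \<Phi> x \<partial>lborel)" "integrable lborel (\<lambda>x. \<Phi> (x + w))" for w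
  proof -
    have "(\<integral>x. \<Phi> x \<partial>lborel) = (\<integral>x. \<Phi> x \<partial>distr lborel borel ((+) w))" by (simp add: lborel_distr_plus)
    also have "\<dots> = (\<integral>x. \<Phi> (w + x) \<partial>lborel)" by (rule integral_distr) auto
    finally show "(\<integral>x. \<Phi> (x + w) \<partial>lborel) = (\<integral>x. \<Phi> x \<partial>lborel)" by (simp add: add.commute)
    have "integrable (distr lborel borel ((+) w)) \<Phi>" using \<Phi>i by (simp add: lborel_distr_plus)
    then show "integrable lborel (\<lambda>x. \<Phi> (x + w))"
      by (subst (asm) integrable_distr_eq) (auto simp: add.commute)
  qed
  have s0: "(\<integral>x. s n x \<partial>lborel) = 0" for n
    unfolding s_def using tr[of "h n *\<^sub>R b"] \<Phi>i by simp
  have "(\<lambda>n. \<integral>x. s n x \<partial>lborel) \<longlonglongrightarrow> (\<integral>x. D\<Phi> x \<bullet> b \<partial>lborel)"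
  proof (rule integral_dominated_convergence[where w="\<lambda>x. B * norm b * indicat_real (cball 0 R) x"])
    show "integrable lborel (\<lambda>x::'a. B * norm b * indicat_real (cball 0 R) x)"
      by (intro integrable_mult_right integrable_real_indicator) (use emeasure_lborel_cball_finite[of "0::'a" R] in auto)
    show "AE x in lborel. (\<lambda>n. s n x) \<longlonglongrightarrow> D\<Phi> x \<bullet> b"
    proof (rule AE_I2)
      fix x
      have "((\<lambda>t. x + t *\<^sub>R b) has_derivative (\<lambda>t. t *\<^sub>R b)) (at 0)" by (auto intro!: derivative_eq_intros)
      moreover have "(\<Phi> has_derivative (\<lambda>h. D\<Phi> x \<bullet> h)) (at (x + 0 *\<^sub>R b))" using d[of x] by simp
      ultimately have "((\<lambda>t. \<Phi> (x + t *\<^sub>R b)) has_derivative (\<lambda>t. D\<Phi> x \<bullet> (t *\<^sub>R b))) (at 0)"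
        by (rule has_derivative_compose)
      then have "((\<lambda>t. \<Phi> (x + t *\<^sub>R b)) has_real_derivative D\<Phi> x \<bullet> b) (at 0)"
        by (simp add: has_field_derivative_def mult_commute_abs)
      then have "(\<lambda>t. (\<Phi> (x + t *\<^sub>R b) - \<Phi> x) / t) \<midarrow>0\<rightarrow> D\<Phi> x \<bullet> b"
        by (simp add: DERIV_def)
      moreover have "filterlim h (at 0) sequentially"
        using h0 h by (auto simp: filterlim_at intro!: always_eventually less_imp_neq[symmetric])
      ultimately show "(\<lambda>n. s n x) \<longlonglongrightarrow> D\<Phi> x \<bullet> b"
        unfolding s_def by (rule filterlim_compose)
    qed
    have "norm (s n x) \<le> B * norm b * indicat_real (cball 0 R) x" for n x
    proof (cases "x \<in> cball 0 R")
      case True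
      have "\<bar>\<Phi> (x + h n *\<^sub>R b) - \<Phi> x\<bar> \<le> B * norm b * h n"
        using lip[of "x + h n *\<^sub>R b" x] h[of n] by (simp add: mult_ac)
      then show ?thesis using True h[of n] by (simp add: s_def field_simps)
    next
      case False
      then have nx: "norm x > r + norm b" by (simp add: R_def)
      have "norm (h n *\<^sub>R b) \<le> norm b" using h[of n] by (simp add: mult_left_le_one_le)
      then have "norm (x + h n *\<^sub>R b) \<ge> r" using nx norm_diff_ineq[of x "h n *\<^sub>R b"] by linarith
      then have "s n x = 0" using nx r(1) norm_ge_zero[of b] by (simp add: s_def del: norm_ge_zero)
      then show ?thesis using False by simp
    qed
    then show "AE x in lborel. norm (s n x) \<le> B * norm b * indicat_real (cball 0 R) x" for n by simp
  qed (auto simp: s_def)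
  then have "(\<integral>x. D\<Phi> x \<bullet> b \<partial>lborel) = 0" unfolding s0 by (simp add: LIMSEQ_const_iff)
  then show ?thesis by (simp add: integral_completion)
qed

text \<open>The product of \<open>u\<close> and a test function is again a test function, and the
  integral of its gradient is 0.\<close>

lemma C1_grad_imp_weak_grad:
  fixes u :: "'a::euclidean_space \<Rightarrow> real"
  assumes u: "C1_grad u g"
  shows "weak_grad u g"
  unfolding weak_grad_def
proof (intro allI impI ballI)
  fix \<phi> :: "'a \<Rightarrow> real" and D\<phi> and b :: 'a assume t: "test_fun \<phi> D\<phi>" and "b \<in> Basis"
  obtain r where r: "\<And>x. norm x \<ge> r \<Longrightarrow> \<phi> x = 0" "\<And>x. norm x \<ge> r \<Longrightarrow> D\<phi> x = 0"
    using test_fun_support[OF t] by metis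
  have c: "continuous_on UNIV \<phi>" "continuous_on UNIV D\<phi>" "continuous_on UNIV u" "continuous_on UNIV g"
    using t u C1_grad_continuous by (auto simp: test_fun_def C1_grad_def)
  have d: "\<And>x. (\<phi> has_derivative (\<lambda>h. D\<phi> x \<bullet> h)) (at x)" "\<And>x. (u has_derivative (\<lambda>h. g x \<bullet> h)) (at x)"
    using t u by (auto simp: test_fun_def C1_grad_def)
  have "test_fun (\<lambda>x. u x * \<phi> x) (\<lambda>x. \<phi> x *\<^sub>R g x + u x *\<^sub>R D\<phi> x)"
  proof (rule test_funI[of _ _ r])
    have "((\<lambda>x. u x * \<phi> x) has_derivative (\<lambda>h. (\<phi> x *\<^sub>R g x + u x *\<^sub>R D\<phi> x) \<bullet> h)) (at x)" for x
      by (rule has_derivative_eq_rhs[OF has_derivative_mult[OF d(2,1)]]) (simp add: fun_eq_iff inner_add_left mult_ac)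
    then show "C1_grad (\<lambda>x. u x * \<phi> x) (\<lambda>x. \<phi> x *\<^sub>R g x + u x *\<^sub>R D\<phi> x)"
      unfolding C1_grad_def by (intro conjI allI continuous_intros c)
  qed (use r in simp)
  from test_fun_integral_grad_0[OF this, of b]
  have z: "(\<integral>x. (g x \<bullet> b) * \<phi> x + u x * (D\<phi> x \<bullet> b) \<partial>lebesgue) = 0"
    by (simp add: inner_add_left mult.commute)
  have "integrable lebesgue (\<lambda>x. (g x \<bullet> b) * \<phi> x)" "integrable lebesgue (\<lambda>x. u x * (D\<phi> x \<bullet> b))"
    using r by (auto intro!: continuous_vanishing_integrable[where r=r] continuous_intros c)
  with z show "(\<integral>x. u x * (D\<phi> x \<bullet> b) \<partial>lebesgue) = - (\<integral>x. (g x \<bullet> b) * \<phi> x \<partial>lebesgue)" by simp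
qed

text \<open>Mollified weak gradients are determined by \<open>u\<close> alone, by
  \<open>mollify_weak_grad\<close>. Hence the difference of \<open>G\<close> and \<open>G'\<close>
  mollifies to 0, while its mollifications converge to it locally in L1.\<close>

lemma weak_grad_unique:
  fixes u :: "'a::euclidean_space \<Rightarrow> real"
  assumes u: "loc_integrable u" and G: "loc_integrable G" "weak_grad u G" and G': "loc_integrable G'" "weak_grad u G'"
  shows "AE x in lebesgue. G x = G' x"
proof -
  obtain \<rho> :: "nat \<Rightarrow> 'a \<Rightarrow> real" and D\<rho> where m: "mollifier_seq \<rho> D\<rho>" using mollifier_seq_exists by blast
  have \<rho>: "test_fun (\<rho> n) (D\<rho> n)" "continuous_on UNIV (\<rho> n)" "\<And>x. norm x \<ge> 1 / Suc n \<Longrightarrow> \<rho> n x = 0" for n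
    using m by (auto simp: mollifier_seq_def test_fun_def intro: C1_grad_continuous)
  define D where "D x = G x - G' x" for x
  have [measurable]: "G \<in> borel_measurable lebesgue" "G' \<in> borel_measurable lebesgue"
    using G G' by (auto simp: loc_integrable_def)
  have D: "loc_integrable D"
    using G(1) G'(1) unfolding loc_integrable_def D_def by (auto intro!: set_integral_diff)
  have m0: "mollify (\<rho> n) D x = 0" for n x
  proof -
    have "mollify (\<rho> n) D x = mollify (\<rho> n) G x - mollify (\<rho> n) G' x"
      unfolding mollify_def D_def scaleR_diff_right
      by (intro Bochner_Integration.integral_diff mollify_integrable[OF \<rho>(2,3)] G(1) G'(1))
    then show ?thesis
      using mollify_weak_grad[OF u G \<rho>(1), of n x] mollify_weak_grad[OF u G' \<rho>(1), of n x] by simp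
  qed
  have "AE x in lebesgue. norm (D x) = 0"
  proof (rule ball_integral_eq_0_imp_AE)
    show "loc_integrable (\<lambda>x. norm (D x))"
    proof -
      have "set_integrable lebesgue K (\<lambda>x. norm (D x))" if "compact K" for K
        using loc_integrableD(1)[OF D that, THEN integrable_norm] by (simp add: set_integrable_def)
      then show ?thesis using D by (auto simp: loc_integrable_def)
    qed
    fix n :: nat
    have "(\<lambda>k::nat. ball_integral (\<lambda>x. norm (D x)) (real n)) \<longlonglongrightarrow> 0"
      using mollify_tendsto_L1_loc[OF m D, of "real n"] by (simp add: m0 ball_integral_def)
    then show "ball_integral (\<lambda>x. norm (D x)) (real n) = 0" by (simp add: LIMSEQ_const_iff)
  qed simp
  then show ?thesis by eventually_elim (simp add: D_def)
qed

lemma weak_solution_imp_coercive: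
  fixes A1 A2 :: "'a::euclidean_space \<Rightarrow> real \<Rightarrow> 'a \<Rightarrow> 'a"
  assumes "WpC p1 A1" "WpC p2 A2" "weak_solution p1 p2 q1 q2 A1 A2 u v"
  obtains Gu Gv k1 k2 where "k1 > 0" "k2 > 0"
    "coercive_subsolution p1 q1 k1 u (\<lambda>x. v x powr q2) Gu (\<lambda>x. A1 x (u x) (Gu x))"
    "coercive_subsolution p2 q2 k2 v (\<lambda>x. u x powr q1) Gv (\<lambda>x. A2 x (v x) (Gv x))"
proof -
  obtain Gu Gv where s: "W1p_loc p1 u Gu" "W1p_loc p2 v Gv"
      "AE x in lebesgue. u x \<ge> 0" "AE x in lebesgue. v x \<ge> 0"
      "Lp_loc_vec (p1 / (p1 - 1)) (\<lambda>x. A1 x (u x) (Gu x))"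
      "Lp_loc_vec (p2 / (p2 - 1)) (\<lambda>x. A2 x (v x) (Gv x))"
      "Lp_loc 1 (\<lambda>x. u x powr q1)" "Lp_loc 1 (\<lambda>x. v x powr q2)"
    and i: "\<And>\<phi> D\<phi>. test_fun \<phi> D\<phi> \<and> (\<forall>x. \<phi> x \<ge> 0) \<Longrightarrow>
          - (\<integral>x. A1 x (u x) (Gu x) \<bullet> D\<phi> x \<partial>lebesgue) \<ge> (\<integral>x. v x powr q2 * \<phi> x \<partial>lebesgue) \<and>
          - (\<integral>x. A2 x (v x) (Gv x) \<bullet> D\<phi> x \<partial>lebesgue) \<ge> (\<integral>x. u x powr q1 * \<phi> x \<partial>lebesgue)"
    using assms(3) unfolding weak_solution_def by blast
  obtain k1 where k1: "k1 > 0" "\<And>x t \<xi>. (A1 x t \<xi> \<bullet> \<xi>) powr (p1 - 1) \<ge> k1 powr (p1 - 1) * norm (A1 x t \<xi>) powr p1"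
    and n1: "\<And>x t \<xi>. A1 x t \<xi> \<bullet> \<xi> \<ge> 0" using assms(1) unfolding WpC_def by blast
  obtain k2 where k2: "k2 > 0" "\<And>x t \<xi>. (A2 x t \<xi> \<bullet> \<xi>) powr (p2 - 1) \<ge> k2 powr (p2 - 1) * norm (A2 x t \<xi>) powr p2"
    and n2: "\<And>x t \<xi>. A2 x t \<xi> \<bullet> \<xi> \<ge> 0" using assms(2) unfolding WpC_def by blast
  have l: "loc_integrable (\<lambda>x. u x powr q1)" "loc_integrable (\<lambda>x. v x powr q2)"
    using s(7,8) by (auto intro: Lp_loc_loc_integrable)
  have "coercive_subsolution p1 q1 k1 u (\<lambda>x. v x powr q2) Gu (\<lambda>x. A1 x (u x) (Gu x))"
    using s l i k1 n1 unfolding coercive_subsolution_def W1p_loc_def by simp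
  moreover have "coercive_subsolution p2 q2 k2 v (\<lambda>x. u x powr q1) Gv (\<lambda>x. A2 x (v x) (Gv x))"
    using s l i k2 n2 unfolding coercive_subsolution_def W1p_loc_def by simp
  ultimately show ?thesis using that k1(1) k2(1) by blast
qed

section \<open>The radial case\<close>

text \<open>Along each ray \<open>u\<close> restricts to \<open>f\<close>, so the radial component
  of \<open>g\<close> is a derivative of \<open>f\<close>. Uniqueness of derivatives makes it
  independent of the direction; a fixed direction yields continuity, the direction of
  \<open>x\<close> the last identity.\<close>

lemma radial_C1_derivative:
  fixes u :: "'a::euclidean_space \<Rightarrow> real"
  assumes g: "C1_grad u g" and f: "\<And>x. u x = f (norm x)"
  obtains f' where "continuous_on {0<..} f'" "\<And>r. r > 0 \<Longrightarrow> (f has_real_derivative f' r) (at r)"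
    "\<And>x. x \<noteq> 0 \<Longrightarrow> g x \<bullet> x = norm x * f' (norm x)"
proof -
  have ray: "(f has_real_derivative g (r *\<^sub>R e) \<bullet> e) (at r)" if r: "r > 0" and e: "norm e = 1" for r e
  proof -
    have "((\<lambda>t. t *\<^sub>R e) has_derivative (\<lambda>t. t *\<^sub>R e)) (at r)" by (auto intro!: derivative_eq_intros)
    moreover have "(u has_derivative (\<lambda>h. g (r *\<^sub>R e) \<bullet> h)) (at (r *\<^sub>R e))" using g by (simp add: C1_grad_def)
    ultimately have "((\<lambda>t. u (t *\<^sub>R e)) has_derivative (\<lambda>t. g (r *\<^sub>R e) \<bullet> (t *\<^sub>R e))) (at r)"
      by (rule has_derivative_compose)
    then have "((\<lambda>t. u (t *\<^sub>R e)) has_real_derivative g (r *\<^sub>R e) \<bullet> e) (at r)"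
      by (simp add: has_field_derivative_def mult_commute_abs)
    then show ?thesis
      by (rule has_field_derivative_transform_within_open[OF _ open_greaterThan[of 0]]) (use r e f in auto)
  qed
  obtain e :: 'a where e: "norm e = 1" using nonempty_Basis norm_Basis by blast
  have gc: "continuous_on UNIV g" using g by (simp add: C1_grad_def)
  show ?thesis
  proof (rule that[of "\<lambda>r. g (r *\<^sub>R e) \<bullet> e"])
    show "continuous_on {0<..} (\<lambda>r. g (r *\<^sub>R e) \<bullet> e)"
      by (intro continuous_intros continuous_on_compose2[OF gc]) auto
    show "(f has_real_derivative g (r *\<^sub>R e) \<bullet> e) (at r)" if "r > 0" for r by (rule ray[OF that e])
    fix x :: 'a assume x: "x \<noteq> 0"
    have "(f has_real_derivative g (norm x *\<^sub>R (x /\<^sub>R norm x)) \<bullet> (x /\<^sub>R norm x)) (at (norm x))"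
      by (rule ray) (use x in auto)
    from DERIV_unique[OF ray[of "norm x" e] this] x e
    have "g (norm x *\<^sub>R e) \<bullet> e = g x \<bullet> (x /\<^sub>R norm x)" by simp
    then show "g x \<bullet> x = norm x * (g (norm x *\<^sub>R e) \<bullet> e)" using x by simp
  qed
qed

text \<open>By radiality the field is \<open>a\<close> times \<open>x\<close>, and its nonnegative
  product with the gradient forces \<open>a \<le> 0\<close> when \<open>g x \<bullet> x\<close> is
  negative. When \<open>g x \<bullet> x\<close> is zero that product vanishes, and coercivity forces
  the field itself to vanish.\<close>

lemma radial_op_inner_nonpos:
  fixes A :: "'a::euclidean_space \<Rightarrow> real \<Rightarrow> 'a \<Rightarrow> 'a"
  assumes p: "p > 1" and W: "WpC p A" and r: "radial_op A" and u: "C1_grad u g" "\<And>x. u x = f (norm x)"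
    and x: "x \<noteq> 0" and le: "g x \<bullet> x \<le> 0"
  shows "A x (u x) (g x) \<bullet> x \<le> 0"
proof -
  obtain A0 where A0: "\<And>f g. C1_grad (\<lambda>x. f (norm x)) g \<Longrightarrow>
        (\<forall>x. x \<noteq> 0 \<longrightarrow> A x (f (norm x)) (g x) = A0 (norm x) (f (norm x)) (deriv f (norm x)) *\<^sub>R (x /\<^sub>R norm x))"
    using r unfolding radial_op_def by blast
  have "C1_grad (\<lambda>x. f (norm x)) g" using u(1) by (simp add: u(2)[abs_def])
  from A0[OF this] x obtain a where a: "A x (u x) (g x) = a *\<^sub>R x" by (auto simp: u(2))
  have n: "a * (g x \<bullet> x) \<ge> 0"
    using W a unfolding WpC_def by (metis inner_commute inner_scaleR_left)
  obtain k where k: "k > 0" "(A x (u x) (g x) \<bullet> g x) powr (p - 1) \<ge> k powr (p - 1) * norm (A x (u x) (g x)) powr p"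
    using W unfolding WpC_def by blast
  show ?thesis
  proof (cases "g x \<bullet> x = 0")
    case True
    then have "A x (u x) (g x) \<bullet> g x = 0" by (simp add: a inner_commute)
    then have "k powr (p - 1) * norm (A x (u x) (g x)) powr p \<le> 0" using k(2) by simp
    then have "A x (u x) (g x) = 0" using k(1) by (simp add: mult_le_0_iff)
    then show ?thesis by simp
  next
    case False
    then have "a \<le> 0" using n le by (simp add: zero_le_mult_iff)
    then show ?thesis by (simp add: a mult_nonpos_nonneg)
  qed
qed

text \<open>The cutoff gradient is a nonpositive multiple of \<open>x\<close> that vanishes off the
  annulus, so the sign of \<open>F x \<bullet> x\<close> there makes the right side of the weak
  inequality nonpositive. As \<Phi> is 1 inside, the integral of \<open>w\<close> over the inner
  ball is squeezed to 0.\<close>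

lemma rhs_vanishes_of_nonincreasing:
  fixes u :: "'a::euclidean_space \<Rightarrow> real"
  assumes p: "p > 1" and S: "coercive_subsolution p q k u w Gu F"
    and Fx: "AE x in lebesgue. a < norm x \<and> norm x < b \<longrightarrow> F x \<bullet> x \<le> 0" and ab: "0 < a" "a < b"
  shows "ball_integral w a = 0"
proof -
  have w: "loc_integrable w" "AE x in lebesgue. w x \<ge> 0"
    and ineq: "\<And>\<phi> D\<phi>. test_fun \<phi> D\<phi> \<and> (\<forall>x. \<phi> x \<ge> 0) \<Longrightarrow>
        (\<integral>x. w x * \<phi> x \<partial>lebesgue) \<le> - (\<integral>x. F x \<bullet> D\<phi> x \<partial>lebesgue)"
    using S by (auto simp: coercive_subsolution_def)
  obtain C1 and \<Phi> :: "'a \<Rightarrow> real" and D\<Phi> \<kappa> where \<Phi>c: "radial_cutoff_fun p C1 a b \<Phi> D\<Phi> \<kappa>"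
    using radial_cutoff[OF p, where 'a='a] ab by metis
  then have tf: "test_fun \<Phi> D\<Phi>" by (simp add: radial_cutoff_fun_def)
  note * = \<Phi>c[unfolded radial_cutoff_fun_def, THEN conjunct2]
  have \<Phi>: "0 \<le> \<Phi> x" "\<Phi> x \<le> 1" "norm x \<le> a \<Longrightarrow> \<Phi> x = 1" "norm x \<ge> b \<Longrightarrow> \<Phi> x = 0" for x using *[rule_format, of x] by simp_all
  have \<kappa>: "D\<Phi> x = (- \<kappa> x) *\<^sub>R x" "\<kappa> x \<ge> 0" "norm x \<le> a \<or> norm x \<ge> b \<Longrightarrow> \<kappa> x = 0" for x
    using *[rule_format, of x] by blast+
  have "0 \<le> (\<integral>x. F x \<bullet> D\<Phi> x \<partial>lebesgue)"
  proof (rule integral_nonneg_AE)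
    show "AE x in lebesgue. 0 \<le> F x \<bullet> D\<Phi> x"
      using Fx
    proof eventually_elim
      case (elim x)
      show ?case
      proof (cases "a < norm x \<and> norm x < b")
        case True
        then show ?thesis using elim \<kappa>(1,2)[of x] by (simp add: mult_nonneg_nonpos)
      next
        case False
        then have "\<kappa> x = 0" by (intro \<kappa>(3)) auto
        then show ?thesis by (simp add: \<kappa>(1))
      qed
    qed
  qed
  with ineq[of \<Phi> D\<Phi>] tf \<Phi>(1) have le: "(\<integral>x. w x * \<Phi> x \<partial>lebesgue) \<le> 0" by fastforce
  have "continuous_on UNIV \<Phi>" using tf C1_grad_continuous by (auto simp: test_fun_def)
  then have wi: "integrable lebesgue (\<lambda>x. w x * \<Phi> x)"
    using loc_integrable_bounded_scale[OF w(1) continuous_borel_lebesgue, of \<Phi> 1 0 b] \<Phi>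
    by (simp add: mult.commute)
  have "ball_integral w a \<le> (\<integral>x. w x * \<Phi> x \<partial>lebesgue)"
    unfolding ball_integral_def
  proof (rule integral_mono_AE)
    show "AE x in lebesgue. indicat_real (cball 0 a) x * w x \<le> w x * \<Phi> x"
      using w(2) by eventually_elim (use \<Phi> in \<open>auto simp: indicator_def\<close>)
  qed (intro loc_integrable_ball w wi)+
  with le ball_integral_nonneg[OF w(2), of a] show ?thesis by linarith
qed

text \<open>Keeping only the shell between \<open>R1\<close> and \<open>R\<close> bounds the
  integral below by \<open>c\<close> times the volume of the shell, and the ratio of this bound to
  \<open>R ^ DIM('a)\<close> tends to a positive number. The second conclusion provides a radius at
  which the integral is already positive.\<close>

lemma average_lower_bound:
  fixes w :: "'a::euclidean_space \<Rightarrow> real"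
  assumes w: "loc_integrable w" "AE x in lebesgue. w x \<ge> 0"
    and c: "c > 0" "R1 > 0" "\<And>x. norm x \<ge> R1 \<Longrightarrow> w x \<ge> c"
  shows "\<not> ((\<lambda>R. ball_integral w R / R ^ DIM('a)) \<longlongrightarrow> 0) at_top" and "ball_integral w (2 * R1) > 0"
proof -
  define vol where "vol = unit_ball_vol (real DIM('a))"
  have vol0: "vol > 0" by (simp add: vol_def)
  have vol: "measure lebesgue (cball (0::'a) r) = vol * r ^ DIM('a)" if "r \<ge> 0" for r
    using content_cball[OF that, of "0::'a"] by (simp add: vol_def)
  have lower: "c * vol * (R ^ DIM('a) - R1 ^ DIM('a)) \<le> ball_integral w R" if R: "R \<ge> R1" for R
  proof -
    have i: "integrable lebesgue (indicat_real (cball (0::'a) r))" for r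
      using integrable_indicator_compact[OF compact_cball, of "0::'a" r "1::real"] by simp
    have "c * vol * (R ^ DIM('a) - R1 ^ DIM('a)) = (\<integral>x. c * (indicat_real (cball (0::'a) R) x - indicat_real (cball 0 R1) x) \<partial>lebesgue)"
      using i[of R] i[of R1] vol[of R] vol[of R1] R c(2) by (simp add: algebra_simps)
    also have "\<dots> \<le> ball_integral w R"
      unfolding ball_integral_def
    proof (rule integral_mono_AE)
      show "AE x in lebesgue. c * (indicat_real (cball 0 R) x - indicat_real (cball 0 R1) x) \<le> indicat_real (cball 0 R) x * w x"
        using w(2) by eventually_elim (use c R in \<open>auto simp: indicator_def\<close>)
      show "integrable lebesgue (\<lambda>x::'a. c * (indicat_real (cball 0 R) x - indicat_real (cball 0 R1) x))"
        using i by auto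
    qed (rule loc_integrable_ball[OF w(1)])
    finally show ?thesis .
  qed
  have dim: "DIM('a) > 0" by simp
  have "R1 ^ DIM('a) < (2 * R1) ^ DIM('a)" using c(2) by (intro power_strict_mono) auto
  then have "0 < c * vol * ((2 * R1) ^ DIM('a) - R1 ^ DIM('a))" using c vol0 by simp
  with lower[of "2 * R1"] c(2) show "ball_integral w (2 * R1) > 0" by linarith
  show "\<not> ((\<lambda>R. ball_integral w R / R ^ DIM('a)) \<longlongrightarrow> 0) at_top"
  proof
    assume lim: "((\<lambda>R. ball_integral w R / R ^ DIM('a)) \<longlongrightarrow> 0) at_top"
    have "((\<lambda>R::real. c * vol * (1 - R1 ^ DIM('a) / R ^ DIM('a))) \<longlongrightarrow> c * vol * (1 - 0)) at_top"
      by (intro tendsto_intros real_tendsto_divide_at_top[OF tendsto_const] filterlim_pow_at_top filterlim_ident dim)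
    then have "c * vol * (1 - 0) \<le> 0"
    proof (rule tendsto_le[OF trivial_limit_at_top_linorder lim])
      show "\<forall>\<^sub>F R in at_top. c * vol * (1 - R1 ^ DIM('a) / R ^ DIM('a)) \<le> ball_integral w R / R ^ DIM('a)"
        using eventually_ge_at_top[of R1]
      proof eventually_elim
        case (elim R)
        then have "R > 0" using c(2) by simp
        then have "c * vol * (1 - R1 ^ DIM('a) / R ^ DIM('a)) = c * vol * (R ^ DIM('a) - R1 ^ DIM('a)) / R ^ DIM('a)"
          by (simp add: field_simps)
        then show ?case using lower[OF elim] \<open>R > 0\<close> by (simp add: divide_right_mono)
      qed
    qed
    then show False using c(1) vol0 by (simp add: mult_le_0_iff)
  qed
qed

text \<open>A negative value would persist on a ball by continuity, and balls have positive
  measure.\<close>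

lemma continuous_AE_nonneg:
  fixes u :: "'a::euclidean_space \<Rightarrow> real"
  assumes c: "continuous_on UNIV u" and ae: "AE x in lebesgue. u x \<ge> 0"
  shows "u x \<ge> 0"
proof (rule ccontr)
  assume "\<not> u x \<ge> 0"
  then have x: "x \<in> {x. u x < 0}" by simp
  have o: "open {x. u x < 0}" by (intro open_Collect_less continuous_intros c)
  obtain d where d: "d > 0" "ball x d \<subseteq> {x. u x < 0}"
    using o x unfolding open_contains_ball by blast
  have "AE y in lebesgue. y \<notin> ball x d" using ae by eventually_elim (use d in force)
  then have "emeasure lebesgue (ball x d) = 0"
    by (subst (asm) AE_iff_null_sets[symmetric]) auto
  then have "measure lebesgue (ball x d) = 0" by (simp add: measure_def)
  then show False using content_ball_pos[OF d(1), of x] by simp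
qed

lemma radial_liouville:
  fixes A1 A2 :: "'a::euclidean_space \<Rightarrow> real \<Rightarrow> 'a \<Rightarrow> 'a"
  assumes p: "p1 > 1" "p2 > 1" and q: "q1 > p1 - 1" "q2 > p2 - 1" and W: "WpC p1 A1" "WpC p2 A2"
    and sol: "weak_solution p1 p2 q1 q2 A1 A2 u v"
    and rad: "radial_op A1" "radial_C1 u"
  shows "AE x in lebesgue. u x = 0 \<and> v x = 0"
proof -
  obtain Gu Gv k1 k2 where k: "k1 > 0" "k2 > 0"
    and S1: "coercive_subsolution p1 q1 k1 u (\<lambda>x. v x powr q2) Gu (\<lambda>x. A1 x (u x) (Gu x))"
    and S2: "coercive_subsolution p2 q2 k2 v (\<lambda>x. u x powr q1) Gv (\<lambda>x. A2 x (v x) (Gv x))"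
    by (rule weak_solution_imp_coercive[OF W sol]) (rule that)
  obtain g f where g: "C1_grad u g" and f: "\<And>x. u x = f (norm x)"
    using rad(2) unfolding radial_C1_def by blast
  have uc: "continuous_on UNIV u" by (rule C1_grad_continuous[OF g])
  have u0: "u x \<ge> 0" for x
  proof -
    have "AE x in lebesgue. u x \<ge> 0" using S1 by (simp add: coercive_subsolution_def)
    then show ?thesis by (rule continuous_AE_nonneg[OF uc])
  qed
  have q0: "q1 > 0" "q2 > 0" using p q by auto
  have lv: "loc_integrable (\<lambda>x. v x powr q2)" and lu: "loc_integrable (\<lambda>x. u x powr q1)"
    using S1 S2 by (auto simp: coercive_subsolution_def)
  \<comment> \<open>Vanishing of \<open>v\<close> forces the right side \<open>u powr q1\<close> of
    its own inequality to vanish.\<close>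
  have v_zero: ?thesis if "\<And>n::nat. ball_integral (\<lambda>x. v x powr q2) (real n) = 0"
  proof -
    have "AE x in lebesgue. v x powr q2 = 0" by (rule ball_integral_eq_0_imp_AE[OF lv _ that]) simp
    then have v: "AE x in lebesgue. v x = 0" by eventually_elim simp
    from coercive_subsolution_zero_rhs[OF p(2) q(2) k(2) S2 v]
    have "AE x in lebesgue. u x = 0" by eventually_elim simp
    with v show ?thesis by eventually_elim simp
  qed
  \<comment> \<open>\<open>Gu\<close> is an arbitrary weak gradient, whereas radiality of the
    operator speaks of classical gradients.\<close>
  have Gg: "AE x in lebesgue. Gu x = g x"
  proof (rule weak_grad_unique)
    show "loc_integrable u" by (rule loc_integrable_continuous[OF uc])
    show "loc_integrable Gu"
      using S1 p(1) Lp_loc_vec_loc_integrable[of p1 Gu] by (simp add: coercive_subsolution_def)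
    show "weak_grad u Gu" using S1 by (simp add: coercive_subsolution_def)
    show "loc_integrable g" using g by (intro loc_integrable_continuous) (simp add: C1_grad_def)
    show "weak_grad u g" by (rule C1_grad_imp_weak_grad[OF g])
  qed
  obtain f' where f': "continuous_on {0<..} f'" "\<And>r. r > 0 \<Longrightarrow> (f has_real_derivative f' r) (at r)"
    "\<And>x. x \<noteq> 0 \<Longrightarrow> g x \<bullet> x = norm x * f' (norm x)"
    using radial_C1_derivative[OF g f] by blast
  have v_ball: "ball_integral (\<lambda>x. v x powr q2) a = 0"
    if ab: "0 < a" "a < b" and le: "\<And>r. a < r \<Longrightarrow> r < b \<Longrightarrow> f' r \<le> 0" for a b
  proof (rule rhs_vanishes_of_nonincreasing[OF p(1) S1 _ ab])
    show "AE x in lebesgue. a < norm x \<and> norm x < b \<longrightarrow> A1 x (u x) (Gu x) \<bullet> x \<le> 0"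
      using Gg
    proof eventually_elim
      case (elim x)
      show ?case
      proof (intro impI)
        assume x: "a < norm x \<and> norm x < b"
        then have x0: "x \<noteq> 0" using ab by auto
        have "norm x * f' (norm x) \<le> 0" using le[of "norm x"] x by (simp add: mult_nonneg_nonpos)
        then have "g x \<bullet> x \<le> 0" using f'(3)[OF x0] by simp
        from radial_op_inner_nonpos[OF p(1) W(1) rad(1) g f x0 this]
        show "A1 x (u x) (Gu x) \<bullet> x \<le> 0" by (simp add: elim)
      qed
    qed
  qed
  show ?thesis
  proof (cases "\<forall>n::nat. ball_integral (\<lambda>x. v x powr q2) (real n) = 0")
    case True
    then show ?thesis using v_zero by blast
  next
    case False
    then obtain n :: nat where n: "ball_integral (\<lambda>x. v x powr q2) (real n) \<noteq> 0" by blast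
    have Vpos: "ball_integral (\<lambda>x. v x powr q2) R > 0" if "R \<ge> real n" for R
      using ball_integral_mono[OF lv _ that] n ball_integral_nonneg[of "\<lambda>x. v x powr q2" "real n"] by simp
    \<comment> \<open>Otherwise \<open>f'\<close> would be nonpositive on a whole annulus, and
      \<open>v_ball\<close> would contradict the positivity in \<open>Vpos\<close>.\<close>
    have ex: "\<exists>r. a < r \<and> r < b \<and> f' r > 0" if "a > 0" "a \<ge> real n" "a < b" for a b
    proof (rule ccontr)
      assume "\<not> (\<exists>r. a < r \<and> r < b \<and> f' r > 0)"
      then have "f' r \<le> 0" if "a < r" "r < b" for r using that by (meson not_le)
      from v_ball[OF that(1,3) this] Vpos[OF that(2)] show False by simp
    qed
    \<comment> \<open>The shift by 1 makes the radius positive also for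
      \<open>n = 0\<close>.\<close>
    define R0 where "R0 = real n + 1"
    have R0: "R0 > 0" by (simp add: R0_def)
    \<comment> \<open>By continuity a negative value of \<open>f'\<close> would spread to an
      interval, which \<open>ex\<close> excludes.\<close>
    have f'nn: "f' r \<ge> 0" if r: "r > R0" for r
    proof (rule ccontr)
      assume neg: "\<not> f' r \<ge> 0"
      have "isCont f' r" using f'(1) r R0 by (simp add: continuous_on_eq_continuous_at)
      moreover have "- f' r > 0" using neg by simp
      ultimately obtain d where d: "d > 0" "\<And>s. dist s r < d \<Longrightarrow> dist (f' s) (f' r) < - f' r"
        unfolding continuous_at_eps_delta by blast
      obtain s where s: "r < s" "s < r + d" "f' s > 0" using ex[of r "r + d"] r d(1) R0 by (auto simp: R0_def)
      then show False using d(2)[of s] by (simp add: dist_real_def)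
    qed
    \<comment> \<open>Monotonicity alone would permit \<open>u\<close> to vanish far out. One point
      with positive \<open>f'\<close>, together with \<open>f r1 \<ge> 0\<close>, makes
      \<open>f\<close> positive just to its right and from there on.\<close>
    obtain r1 where r1: "R0 < r1" "f' r1 > 0" using ex[of R0 "R0 + 1"] R0 by (auto simp: R0_def)
    obtain d where d: "d > 0" "\<And>h. h > 0 \<Longrightarrow> h < d \<Longrightarrow> f r1 < f (r1 + h)"
      using DERIV_pos_inc_right[OF f'(2) r1(2)] r1 R0 by auto
    define R1 where "R1 = r1 + d / 2"
    have R1: "R1 > R0" "R1 > 0" using r1 d R0 by (auto simp: R1_def)
    obtain e :: 'a where e: "norm e = 1" using nonempty_Basis norm_Basis by blast
    have "f r1 \<ge> 0" using u0[of "r1 *\<^sub>R e"] f[of "r1 *\<^sub>R e"] e r1 R0 by simp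
    then have fR1: "f R1 > 0" using d(2)[of "d / 2"] d(1) by (simp add: R1_def)
    have low: "u x powr q1 \<ge> f R1 powr q1" if "norm x \<ge> R1" for x
    proof -
      have "f R1 \<le> f (norm x)"
      proof (rule DERIV_nonneg_imp_nondecreasing[OF that])
        fix y assume "R1 \<le> y" "y \<le> norm x"
        then show "\<exists>z. (f has_real_derivative z) (at y) \<and> 0 \<le> z"
          using f'(2)[of y] f'nn[of y] R1 by auto
      qed
      then show ?thesis using fR1 q0 f by (intro powr_mono2) auto
    qed
    have c: "f R1 powr q1 > 0" using fR1 by simp
    note lb = average_lower_bound[OF lu _ c R1(2) low]
    \<comment> \<open>Both integrals must be positive at the starting radius: \<open>2 * R1\<close>
      serves \<open>u\<close>, and \<open>n\<close> serves \<open>v\<close>.\<close>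
    define r0 where "r0 = max (2 * R1) (real n)"
    have "ball_integral (\<lambda>x. u x powr q1) r0 > 0"
      using lb(2) ball_integral_mono[OF lu, of "2 * R1" r0] by (auto simp: r0_def)
    moreover have "ball_integral (\<lambda>x. v x powr q2) r0 > 0" by (rule Vpos) (simp add: r0_def)
    moreover have "r0 > 0" using R1 by (simp add: r0_def)
    ultimately have "((\<lambda>R. ball_integral (\<lambda>x. u x powr q1) R / R ^ DIM('a)) \<longlongrightarrow> 0) at_top"
      using average_tendsto_0[OF p q k S1 S2] by blast
    with lb(1) show ?thesis by simp
  qed
qed

text \<open>Symmetry of the system under exchange of the two unknowns reduces the case of radial
  \<open>v\<close> to that of radial \<open>u\<close>.\<close>

lemma weak_solution_swap:
  "weak_solution p1 p2 q1 q2 A1 A2 u v \<Longrightarrow> weak_solution p2 p1 q2 q1 A2 A1 v u"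
  unfolding weak_solution_def by blast

theorem theorem4p9:
  fixes A1 A2 :: "'a::euclidean_space \<Rightarrow> real \<Rightarrow> 'a \<Rightarrow> 'a"
    and u v :: "'a \<Rightarrow> real"
    and p1 p2 q1 q2 :: real
  assumes "p1 > 1" and "p2 > 1" and "q1 > p1 - 1" and "q2 > p2 - 1"
    and "WpC p1 A1" and "WpC p2 A2"
    and "weak_solution p1 p2 q1 q2 A1 A2 u v"
    and "(radial_op A1 \<and> radial_C1 u) \<or> (radial_op A2 \<and> radial_C1 v)"
  shows "AE x in lebesgue. u x = 0 \<and> v x = 0"
  using assms(8)
proof
  assume "radial_op A1 \<and> radial_C1 u"
  then show ?thesis using radial_liouville[OF assms(1-7)] by blast
next
  assume "radial_op A2 \<and> radial_C1 v"
  then have "AE x in lebesgue. v x = 0 \<and> u x = 0"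
    using radial_liouville[OF assms(2,1,4,3,6,5) weak_solution_swap[OF assms(7)]] by blast
  then show ?thesis by eventually_elim simp
qed

end
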